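(* If $\mathcal L$ is a sequential symmetric multicategory and $\mathcal M$ is any symmetric multicategory, then $\mathcal M\otimes\mathcal L$, $[\mathcal M,\mathcal L]$ and $[\mathcal L,\mathcal M]$ are also sequential.
   Context: $\mathbf{sMlt}$ is the category of (small) symmetric multicategories and symmetric functors; a permutation $\sigma$ of the domain of an arrow $f$ gives an arrow $\sigma f$. For a category $\mathcal C$, $\mathcal C_\blacktriangleright$ is the symmetric multicategory with the objects of $\mathcal C$ and $\mathcal C_\blacktriangleright(X_1,\dots,X_n;X)=\mathcal C(X_1;X)\times\cdots\times\mathcal C(X_n;X)$, composition $\langle f_1,\dots,f_n\rangle(\langle g_{11},\dots,g_{1m_1}\rangle,\dots,\langle g_{n1},\dots,g_{nm_n}\rangle)=\langle f_1g_{11},\dots,f_1g_{1m_1},\dots,f_ng_{n1},\dots,f_ng_{nm_n}\rangle$, and symmetric structure given by permuting sequences. A symmetric multicategory is sequential if it is isomorphic to some $\mathcal C_\blacktriangleright$. $\otimes$ is the Boardman–Vogt tensor product. The objects of $\mathcal M\otimes\mathcal N$ are pairs $\langle A,X\rangle$; its arrows are generated by $f_X:\langle A_1,X\rangle,\dots,\langle A_n,X\rangle\to\langle A,X\rangle$ for $f:A_1,\dots,A_n\to A$ in $\mathcal M$ and $h_A:\langle A,X_1\rangle,\dots,\langle A,X_m\rangle\to\langle A,X\rangle$ for $h:X_1,\dots,X_m\to X$ in $\mathcal N$, subject to the relations making $(-)_X:\mathcal M\to\mathcal M\otimes\mathcal N$ and $(-)_A:\mathcal N\to\mathcal M\otimes\mathcal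 N$ symmetric functors and to $f_X(h_{A_1},\dots,h_{A_n})=\sigma\,h_A(f_{X_1},\dots,f_{X_m})$, with $\sigma$ the evident permutation matching the domains. The associated internal hom $[\mathcal M,\mathcal N]$ has as objects the symmetric functors $\mathcal M\to\mathcal N$; an arrow $\alpha:F_1,\dots,F_n\to F$ is a family of arrows $\alpha_A:F_1A,\dots,F_nA\to FA$ ($A\in\mathcal M$) such that $Ff(\alpha_{A_1},\dots,\alpha_{A_m})=\sigma\,\alpha_A(F_1f,\dots,F_nf)$ for every $f:A_1,\dots,A_m\to A$ in $\mathcal M$, with $\sigma$ the evident permutation; composition and symmetric structure are pointwise. *)

theory Defs
  imports "HOL-Combinatorics.Permutations" "HOL-Library.FuncSet"
begin

section \<open>Permutations of concatenated lists\<close>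

text \<open>
  A permutation of the domain of an \<open>n\<close>-ary arrow is a function that permutes \<open>{..<n}\<close>, and it acts
  on lists by \<^const>\<open>permute_list\<close>: entry \<open>i\<close> of \<open>permute_list \<sigma> xs\<close> is \<open>xs ! \<sigma> i\<close>.  All the
  \<open>evident\<close> permutations below are given as the list of their values, obtained by rearranging
  the index list \<open>[0..<n]\<close> in the way in which the domain is to be rearranged.
\<close>

definition perm_of_list :: "nat list \<Rightarrow> nat \<Rightarrow> nat" where
  "perm_of_list is i = (if i < length is then is ! i else i)"

text \<open>\<open>index_blocks [m\<^sub>1, \<dots>, m\<^sub>n]\<close> cuts \<open>[0..<m\<^sub>1 + \<dots> + m\<^sub>n]\<close> into consecutive blocks of these lengths.\<close>

definition index_blocks :: "nat list \<Rightarrow> nat list list" where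
  "index_blocks ms =
     map (\<lambda>i. [sum_list (take i ms) ..< sum_list (take (Suc i) ms)]) [0..<length ms]"

text \<open>\<open>\<sigma>\<^sub>1 \<oplus> \<dots> \<oplus> \<sigma>\<^sub>n\<close>, permuting within each of the blocks of lengths \<open>ms\<close>.\<close>

definition sum_perm :: "(nat \<Rightarrow> nat) list \<Rightarrow> nat list \<Rightarrow> nat \<Rightarrow> nat" where
  "sum_perm \<sigma>s ms = perm_of_list (concat (map2 permute_list \<sigma>s (index_blocks ms)))"

text \<open>The permutation of the blocks of lengths \<open>ms\<close> among each other that is induced by \<open>\<sigma>\<close>.\<close>

definition block_perm :: "(nat \<Rightarrow> nat) \<Rightarrow> nat list \<Rightarrow> nat \<Rightarrow> nat" where
  "block_perm \<sigma> ms = perm_of_list (concat (permute_list \<sigma> (index_blocks ms)))"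

text \<open>
  \<open>interchange_perm n m\<close> turns the column-major enumeration of an \<open>n \<times> m\<close> array (in which entry
  \<open>(i, j)\<close> is at position \<open>j * n + i\<close>) into its row-major enumeration.
\<close>

definition interchange_perm :: "nat \<Rightarrow> nat \<Rightarrow> nat \<Rightarrow> nat" where
  "interchange_perm n m = perm_of_list (concat (map (\<lambda>i. map (\<lambda>j. j * n + i) [0..<m]) [0..<n]))"


section \<open>Symmetric multicategories\<close>

record ('o, 'a) smulticat =
  Obj :: "'o set"
  Arr :: "'a set"
  Dom :: "'a \<Rightarrow> 'o list"
  Cod :: "'a \<Rightarrow> 'o"
  Ident :: "'o \<Rightarrow> 'a"
  Comp :: "'a \<Rightarrow> 'a list \<Rightarrow> 'a"
  Act :: "(nat \<Rightarrow> nat) \<Rightarrow> 'a \<Rightarrow> 'a"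

definition arity :: "('o, 'a) smulticat \<Rightarrow> 'a \<Rightarrow> nat" where
  "arity M f = length (Dom M f)"

definition composable :: "('o, 'a) smulticat \<Rightarrow> 'a \<Rightarrow> 'a list \<Rightarrow> bool" where
  "composable M f gs \<longleftrightarrow> f \<in> Arr M \<and> set gs \<subseteq> Arr M \<and> map (Cod M) gs = Dom M f"

text \<open>
  The domain of \<open>\<sigma>f\<close> is \<open>permute_list \<sigma>\<close> of the domain of \<open>f\<close>, so that \<open>(\<sigma> \<circ> \<tau>)f = \<tau>(\<sigma>f)\<close>.
\<close>

locale symmetric_multicategory =
  fixes M :: "('o, 'a) smulticat"
  assumes Dom_closed: "f \<in> Arr M \<Longrightarrow> set (Dom M f) \<subseteq> Obj M"
    and Cod_closed: "f \<in> Arr M \<Longrightarrow> Cod M f \<in> Obj M"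
    and Ident_closed: "A \<in> Obj M \<Longrightarrow> Ident M A \<in> Arr M"
    and Dom_Ident: "A \<in> Obj M \<Longrightarrow> Dom M (Ident M A) = [A]"
    and Cod_Ident: "A \<in> Obj M \<Longrightarrow> Cod M (Ident M A) = A"
    and Comp_closed: "composable M f gs \<Longrightarrow> Comp M f gs \<in> Arr M"
    and Dom_Comp: "composable M f gs \<Longrightarrow> Dom M (Comp M f gs) = concat (map (Dom M) gs)"
    and Cod_Comp: "composable M f gs \<Longrightarrow> Cod M (Comp M f gs) = Cod M f"
    and Comp_Ident_left: "f \<in> Arr M \<Longrightarrow> Comp M (Ident M (Cod M f)) [f] = f"
    and Comp_Ident_right: "f \<in> Arr M \<Longrightarrow> Comp M f (map (Ident M) (Dom M f)) = f"
    and Comp_assoc: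
      "\<lbrakk>composable M f gs; length hss = length gs;
        \<And>i. i < length gs \<Longrightarrow> composable M (gs ! i) (hss ! i)\<rbrakk>
       \<Longrightarrow> Comp M f (map2 (Comp M) gs hss) = Comp M (Comp M f gs) (concat hss)"
    and Act_closed: "\<lbrakk>f \<in> Arr M; \<sigma> permutes {..<arity M f}\<rbrakk> \<Longrightarrow> Act M \<sigma> f \<in> Arr M"
    and Dom_Act:
      "\<lbrakk>f \<in> Arr M; \<sigma> permutes {..<arity M f}\<rbrakk> \<Longrightarrow> Dom M (Act M \<sigma> f) = permute_list \<sigma> (Dom M f)"
    and Cod_Act: "\<lbrakk>f \<in> Arr M; \<sigma> permutes {..<arity M f}\<rbrakk> \<Longrightarrow> Cod M (Act M \<sigma> f) = Cod M f"
    and Act_id: "f \<in> Arr M \<Longrightarrow> Act M id f = f"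
    and Act_comp:
      "\<lbrakk>f \<in> Arr M; \<sigma> permutes {..<arity M f}; \<tau> permutes {..<arity M f}\<rbrakk>
       \<Longrightarrow> Act M (\<sigma> \<circ> \<tau>) f = Act M \<tau> (Act M \<sigma> f)"
    and Comp_Act_inner:
      "\<lbrakk>composable M f gs; length \<sigma>s = length gs;
        \<And>i. i < length gs \<Longrightarrow> \<sigma>s ! i permutes {..<arity M (gs ! i)}\<rbrakk>
       \<Longrightarrow> Comp M f (map2 (Act M) \<sigma>s gs) = Act M (sum_perm \<sigma>s (map (arity M) gs)) (Comp M f gs)"
    and Comp_Act_outer:
      "\<lbrakk>composable M f gs; \<sigma> permutes {..<arity M f}\<rbrakk>
       \<Longrightarrow> Comp M (Act M \<sigma> f) (permute_list \<sigma> gs)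
            = Act M (block_perm \<sigma> (map (arity M) gs)) (Comp M f gs)"

record ('o, 'a, 'p, 'b) mfunctor =
  on_obj :: "'o \<Rightarrow> 'p"
  on_arr :: "'a \<Rightarrow> 'b"

locale symmetric_functor =
  dom: symmetric_multicategory M + cod: symmetric_multicategory N
  for M :: "('o, 'a) smulticat" and N :: "('p, 'b) smulticat" +
  fixes F :: "('o, 'a, 'p, 'b) mfunctor"
  assumes on_obj_closed: "A \<in> Obj M \<Longrightarrow> on_obj F A \<in> Obj N"
    and on_arr_closed: "f \<in> Arr M \<Longrightarrow> on_arr F f \<in> Arr N"
    and Dom_on_arr: "f \<in> Arr M \<Longrightarrow> Dom N (on_arr F f) = map (on_obj F) (Dom M f)"
    and Cod_on_arr: "f \<in> Arr M \<Longrightarrow> Cod N (on_arr F f) = on_obj F (Cod M f)"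
    and on_arr_Ident: "A \<in> Obj M \<Longrightarrow> on_arr F (Ident M A) = Ident N (on_obj F A)"
    and on_arr_Comp:
      "composable M f gs \<Longrightarrow> on_arr F (Comp M f gs) = Comp N (on_arr F f) (map (on_arr F) gs)"
    and on_arr_Act:
      "\<lbrakk>f \<in> Arr M; \<sigma> permutes {..<arity M f}\<rbrakk> \<Longrightarrow> on_arr F (Act M \<sigma> f) = Act N \<sigma> (on_arr F f)"

text \<open>Isomorphism in \<open>sMlt\<close>; in particular, both sides are symmetric multicategories.\<close>

definition smulticat_iso :: "('o, 'a) smulticat \<Rightarrow> ('p, 'b) smulticat \<Rightarrow> bool" where
  "smulticat_iso M N \<longleftrightarrow> (\<exists>F G. symmetric_functor M N F \<and> symmetric_functor N M G \<and>
     (\<forall>A\<in>Obj M. on_obj G (on_obj F A) = A) \<and> (\<forall>f\<in>Arr M. on_arr G (on_arr F f) = f) \<and>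
     (\<forall>X\<in>Obj N. on_obj F (on_obj G X) = X) \<and> (\<forall>h\<in>Arr N. on_arr F (on_arr G h) = h))"


section \<open>Categories and sequential multicategories\<close>

record ('o, 'a) cat =
  obj :: "'o set"
  arr :: "'a set"
  src :: "'a \<Rightarrow> 'o"
  tgt :: "'a \<Rightarrow> 'o"
  idn :: "'o \<Rightarrow> 'a"
  cmp :: "'a \<Rightarrow> 'a \<Rightarrow> 'a"

text \<open>Composition is written in applicative order: \<open>cmp C f g\<close> is \<open>f\<close> after \<open>g\<close>.\<close>

locale category =
  fixes C :: "('o, 'a) cat"
  assumes src_closed: "f \<in> arr C \<Longrightarrow> src C f \<in> obj C"
    and tgt_closed: "f \<in> arr C \<Longrightarrow> tgt C f \<in> obj C"
    and idn_closed: "X \<in> obj C \<Longrightarrow> idn C X \<in> arr C"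
    and src_idn: "X \<in> obj C \<Longrightarrow> src C (idn C X) = X"
    and tgt_idn: "X \<in> obj C \<Longrightarrow> tgt C (idn C X) = X"
    and cmp_closed: "\<lbrakk>f \<in> arr C; g \<in> arr C; src C f = tgt C g\<rbrakk> \<Longrightarrow> cmp C f g \<in> arr C"
    and src_cmp: "\<lbrakk>f \<in> arr C; g \<in> arr C; src C f = tgt C g\<rbrakk> \<Longrightarrow> src C (cmp C f g) = src C g"
    and tgt_cmp: "\<lbrakk>f \<in> arr C; g \<in> arr C; src C f = tgt C g\<rbrakk> \<Longrightarrow> tgt C (cmp C f g) = tgt C f"
    and cmp_idn_left: "f \<in> arr C \<Longrightarrow> cmp C (idn C (tgt C f)) f = f"
    and cmp_idn_right: "f \<in> arr C \<Longrightarrow> cmp C f (idn C (src C f)) = f"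
    and cmp_assoc:
      "\<lbrakk>f \<in> arr C; g \<in> arr C; h \<in> arr C; src C f = tgt C g; src C g = tgt C h\<rbrakk>
       \<Longrightarrow> cmp C f (cmp C g h) = cmp C (cmp C f g) h"

text \<open>
  The multicategory \<open>\<C>\<^sub>\<triangleright>\<close> of sequences of concurrent arrows.  The common codomain is part of an arrow,
  since it cannot be recovered from the empty sequence.
\<close>

definition seq_multicat :: "('o, 'a) cat \<Rightarrow> ('o, 'a list \<times> 'o) smulticat" where
  "seq_multicat C = \<lparr>
     Obj = obj C,
     Arr = {(fs, X). X \<in> obj C \<and> (\<forall>f\<in>set fs. f \<in> arr C \<and> tgt C f = X)},
     Dom = (\<lambda>(fs, X). map (src C) fs),
     Cod = (\<lambda>(fs, X). X),
     Ident = (\<lambda>X. ([idn C X], X)),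
     Comp = (\<lambda>(fs, X) gs. (concat (map2 (\<lambda>f (hs, Y). map (cmp C f) hs) fs gs), X)),
     Act = (\<lambda>\<sigma> (fs, X). (permute_list \<sigma> fs, X))\<rparr>"

text \<open>
  The category is taken over the types of objects and arrows of the multicategory itself.  This is
  no restriction, see \<open>sequential_if_iso\<close> below.
\<close>

definition sequential :: "('o, 'a) smulticat \<Rightarrow> bool" where
  "sequential M \<longleftrightarrow> (\<exists>C :: ('o, 'a) cat. category C \<and> smulticat_iso M (seq_multicat C))"


section \<open>The internal hom\<close>

record ('o, 'a, 'p, 'b) mtransf =
  tr_dom :: "('o, 'a, 'p, 'b) mfunctor list"
  tr_cod :: "('o, 'a, 'p, 'b) mfunctor"
  tr_at :: "'o \<Rightarrow> 'b"

text \<open>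
  Functors and families are made \<^const>\<open>extensional\<close>, so that equality in HOL is equality of
  functors and of families on \<open>M\<close>.
\<close>

definition hom_objects ::
    "('o, 'a) smulticat \<Rightarrow> ('p, 'b) smulticat \<Rightarrow> ('o, 'a, 'p, 'b) mfunctor set" where
  "hom_objects M N = {F. symmetric_functor M N F \<and>
     on_obj F \<in> extensional (Obj M) \<and> on_arr F \<in> extensional (Arr M)}"

definition hom_arrows ::
    "('o, 'a) smulticat \<Rightarrow> ('p, 'b) smulticat \<Rightarrow> ('o, 'a, 'p, 'b) mtransf set" where
  "hom_arrows M N = {\<alpha>. set (tr_dom \<alpha>) \<subseteq> hom_objects M N \<and> tr_cod \<alpha> \<in> hom_objects M N \<and>
     tr_at \<alpha> \<in> extensional (Obj M) \<and>
     (\<forall>A\<in>Obj M. tr_at \<alpha> A \<in> Arr N \<and>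
        Dom N (tr_at \<alpha> A) = map (\<lambda>F. on_obj F A) (tr_dom \<alpha>) \<and>
        Cod N (tr_at \<alpha> A) = on_obj (tr_cod \<alpha>) A) \<and>
     (\<forall>f\<in>Arr M.
        Comp N (on_arr (tr_cod \<alpha>) f) (map (tr_at \<alpha>) (Dom M f)) =
        Act N (interchange_perm (arity M f) (length (tr_dom \<alpha>)))
          (Comp N (tr_at \<alpha> (Cod M f)) (map (\<lambda>F. on_arr F f) (tr_dom \<alpha>))))}"

definition internal_hom :: "('o, 'a) smulticat \<Rightarrow> ('p, 'b) smulticat
    \<Rightarrow> (('o, 'a, 'p, 'b) mfunctor, ('o, 'a, 'p, 'b) mtransf) smulticat" where
  "internal_hom M N = \<lparr>
     Obj = hom_objects M N,
     Arr = hom_arrows M N,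
     Dom = tr_dom,
     Cod = tr_cod,
     Ident = (\<lambda>F. \<lparr>tr_dom = [F], tr_cod = F, tr_at = (\<lambda>A\<in>Obj M. Ident N (on_obj F A))\<rparr>),
     Comp = (\<lambda>\<alpha> \<beta>s. \<lparr>tr_dom = concat (map tr_dom \<beta>s), tr_cod = tr_cod \<alpha>,
        tr_at = (\<lambda>A\<in>Obj M. Comp N (tr_at \<alpha> A) (map (\<lambda>\<beta>. tr_at \<beta> A) \<beta>s))\<rparr>),
     Act = (\<lambda>\<sigma> \<alpha>. \<lparr>tr_dom = permute_list \<sigma> (tr_dom \<alpha>), tr_cod = tr_cod \<alpha>,
        tr_at = (\<lambda>A\<in>Obj M. Act N \<sigma> (tr_at \<alpha> A))\<rparr>)\<rparr>"


section \<open>The Boardman--Vogt tensor product\<close>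

text \<open>
  Formal expressions in the generators \<open>f\<^sub>X\<close> (\<open>GenL f X\<close>) and \<open>h\<^sub>A\<close> (\<open>GenR A h\<close>) and the operations of a
  symmetric multicategory with object set \<open>Obj M \<times> Obj N\<close>.
\<close>

datatype ('o, 'a, 'p, 'b) bv_term =
    GenL 'a 'p
  | GenR 'o 'b
  | IdT "'o \<times> 'p"
  | CompT "('o, 'a, 'p, 'b) bv_term" "('o, 'a, 'p, 'b) bv_term list"
  | ActT "nat \<Rightarrow> nat" "('o, 'a, 'p, 'b) bv_term"

context
  fixes M :: "('o, 'a) smulticat" and N :: "('p, 'b) smulticat"
begin

primrec tm_dom :: "('o, 'a, 'p, 'b) bv_term \<Rightarrow> ('o \<times> 'p) list" where
  "tm_dom (GenL f X) = map (\<lambda>A. (A, X)) (Dom M f)"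
| "tm_dom (GenR A h) = map (\<lambda>X. (A, X)) (Dom N h)"
| "tm_dom (IdT P) = [P]"
| "tm_dom (CompT t us) = concat (map tm_dom us)"
| "tm_dom (ActT \<sigma> t) = permute_list \<sigma> (tm_dom t)"

primrec tm_cod :: "('o, 'a, 'p, 'b) bv_term \<Rightarrow> 'o \<times> 'p" where
  "tm_cod (GenL f X) = (Cod M f, X)"
| "tm_cod (GenR A h) = (A, Cod N h)"
| "tm_cod (IdT P) = P"
| "tm_cod (CompT t us) = tm_cod t"
| "tm_cod (ActT \<sigma> t) = tm_cod t"

definition tm_arity :: "('o, 'a, 'p, 'b) bv_term \<Rightarrow> nat" where
  "tm_arity t = length (tm_dom t)"

fun tm_wf :: "('o, 'a, 'p, 'b) bv_term \<Rightarrow> bool" where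
  "tm_wf (GenL f X) \<longleftrightarrow> f \<in> Arr M \<and> X \<in> Obj N"
| "tm_wf (GenR A h) \<longleftrightarrow> A \<in> Obj M \<and> h \<in> Arr N"
| "tm_wf (IdT P) \<longleftrightarrow> P \<in> Obj M \<times> Obj N"
| "tm_wf (CompT t us) \<longleftrightarrow> tm_wf t \<and> (\<forall>u\<in>set us. tm_wf u) \<and> map tm_cod us = tm_dom t"
| "tm_wf (ActT \<sigma> t) \<longleftrightarrow> tm_wf t \<and> \<sigma> permutes {..<tm_arity t}"

text \<open>
  The least congruence on well-formed terms containing the laws of a symmetric multicategory, the
  functoriality of \<open>(-)\<^sub>X\<close> and \<open>(-)\<^sub>A\<close>, and the interchange law.
\<close>

inductive bv_eq :: "('o, 'a, 'p, 'b) bv_term \<Rightarrow> ('o, 'a, 'p, 'b) bv_term \<Rightarrow> bool" where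
  refl: "tm_wf t \<Longrightarrow> bv_eq t t"
| sym: "bv_eq t u \<Longrightarrow> bv_eq u t"
| trans: "\<lbrakk>bv_eq t u; bv_eq u v\<rbrakk> \<Longrightarrow> bv_eq t v"
| cong_CompT:
    "\<lbrakk>tm_wf (CompT t us); bv_eq t t'; list_all2 bv_eq us us'\<rbrakk>
     \<Longrightarrow> bv_eq (CompT t us) (CompT t' us')"
| cong_ActT: "\<lbrakk>tm_wf (ActT \<sigma> t); bv_eq t t'\<rbrakk> \<Longrightarrow> bv_eq (ActT \<sigma> t) (ActT \<sigma> t')"
| id_left: "tm_wf t \<Longrightarrow> bv_eq (CompT (IdT (tm_cod t)) [t]) t"
| id_right: "tm_wf t \<Longrightarrow> bv_eq (CompT t (map IdT (tm_dom t))) t"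
| assoc:
    "\<lbrakk>tm_wf (CompT t us); length vss = length us;
      \<And>i. i < length us \<Longrightarrow> tm_wf (CompT (us ! i) (vss ! i))\<rbrakk>
     \<Longrightarrow> bv_eq (CompT t (map2 CompT us vss)) (CompT (CompT t us) (concat vss))"
| act_id: "tm_wf t \<Longrightarrow> bv_eq (ActT id t) t"
| act_comp:
    "\<lbrakk>tm_wf t; \<sigma> permutes {..<tm_arity t}; \<tau> permutes {..<tm_arity t}\<rbrakk>
     \<Longrightarrow> bv_eq (ActT (\<sigma> \<circ> \<tau>) t) (ActT \<tau> (ActT \<sigma> t))"
| act_inner:
    "\<lbrakk>tm_wf (CompT t us); length \<sigma>s = length us;
      \<And>i. i < length us \<Longrightarrow> \<sigma>s ! i permutes {..<tm_arity (us ! i)}\<rbrakk>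
     \<Longrightarrow> bv_eq (CompT t (map2 ActT \<sigma>s us)) (ActT (sum_perm \<sigma>s (map tm_arity us)) (CompT t us))"
| act_outer:
    "\<lbrakk>tm_wf (CompT t us); \<sigma> permutes {..<tm_arity t}\<rbrakk>
     \<Longrightarrow> bv_eq (CompT (ActT \<sigma> t) (permute_list \<sigma> us))
               (ActT (block_perm \<sigma> (map tm_arity us)) (CompT t us))"
| GenL_Ident: "\<lbrakk>A \<in> Obj M; X \<in> Obj N\<rbrakk> \<Longrightarrow> bv_eq (GenL (Ident M A) X) (IdT (A, X))"
| GenL_Comp:
    "\<lbrakk>composable M f gs; X \<in> Obj N\<rbrakk>
     \<Longrightarrow> bv_eq (GenL (Comp M f gs) X) (CompT (GenL f X) (map (\<lambda>g. GenL g X) gs))"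
| GenL_Act:
    "\<lbrakk>f \<in> Arr M; \<sigma> permutes {..<arity M f}; X \<in> Obj N\<rbrakk>
     \<Longrightarrow> bv_eq (GenL (Act M \<sigma> f) X) (ActT \<sigma> (GenL f X))"
| GenR_Ident: "\<lbrakk>A \<in> Obj M; X \<in> Obj N\<rbrakk> \<Longrightarrow> bv_eq (GenR A (Ident N X)) (IdT (A, X))"
| GenR_Comp:
    "\<lbrakk>A \<in> Obj M; composable N h ks\<rbrakk>
     \<Longrightarrow> bv_eq (GenR A (Comp N h ks)) (CompT (GenR A h) (map (GenR A) ks))"
| GenR_Act:
    "\<lbrakk>A \<in> Obj M; h \<in> Arr N; \<sigma> permutes {..<arity N h}\<rbrakk>
     \<Longrightarrow> bv_eq (GenR A (Act N \<sigma> h)) (ActT \<sigma> (GenR A h))"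
| interchange:
    "\<lbrakk>f \<in> Arr M; h \<in> Arr N\<rbrakk>
     \<Longrightarrow> bv_eq (CompT (GenL f (Cod N h)) (map (\<lambda>A. GenR A h) (Dom M f)))
               (ActT (interchange_perm (arity M f) (arity N h))
                 (CompT (GenR (Cod M f) h) (map (\<lambda>X. GenL f X) (Dom N h))))"

definition bv_class :: "('o, 'a, 'p, 'b) bv_term \<Rightarrow> ('o, 'a, 'p, 'b) bv_term set" where
  "bv_class t = {u. bv_eq t u}"

definition bv_rep :: "('o, 'a, 'p, 'b) bv_term set \<Rightarrow> ('o, 'a, 'p, 'b) bv_term" where
  "bv_rep c = (SOME t. t \<in> c)"

definition bv_tensor :: "('o \<times> 'p, ('o, 'a, 'p, 'b) bv_term set) smulticat" where
  "bv_tensor = \<lparr>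
     Obj = Obj M \<times> Obj N,
     Arr = bv_class ` {t. tm_wf t},
     Dom = (\<lambda>c. tm_dom (bv_rep c)),
     Cod = (\<lambda>c. tm_cod (bv_rep c)),
     Ident = (\<lambda>P. bv_class (IdT P)),
     Comp = (\<lambda>c ds. bv_class (CompT (bv_rep c) (map bv_rep ds))),
     Act = (\<lambda>\<sigma> c. bv_class (ActT \<sigma> (bv_rep c)))\<rparr>"

end


section \<open>Supporting facts\<close>

subsection \<open>The permutations\<close>

lemma perm_of_list_permutes:
  assumes "mset is = mset [0..<n]"
  shows "perm_of_list is permutes {..<n}"
proof -
  have l: "length is = n" using arg_cong[OF assms, of size] by simp
  have d: "distinct is" by (rule iffD2[OF mset_eq_imp_distinct_iff[OF assms] distinct_upt])
  have s: "set is = {..<n}" unfolding mset_eq_setD[OF assms] set_upt by (rule atLeast0LessThan)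
  have "bij_betw ((!) is) {..<n} {..<n}"
    using bij_betw_nth[OF d] l s by simp
  then have "bij_betw (perm_of_list is) {..<n} {..<n}"
    by (rule iffD1[OF bij_betw_cong, rotated]) (simp add: perm_of_list_def l)
  then show ?thesis
    by (rule bij_imp_permutes) (simp add: perm_of_list_def l)
qed

lemma permute_list_perm_of_list:
  "length xs = length is \<Longrightarrow> permute_list (perm_of_list is) xs = map ((!) xs) is"
  by (rule nth_equalityI) (simp_all add: permute_list_def perm_of_list_def)

lemma index_blocks_Nil [simp]: "index_blocks [] = []"
  by (simp add: index_blocks_def)

lemma length_index_blocks [simp]: "length (index_blocks ms) = length ms"
  by (simp add: index_blocks_def)

lemma nth_index_blocks:
  "i < length ms \<Longrightarrow> index_blocks ms ! i = [sum_list (take i ms) ..< sum_list (take i ms) + ms ! i]"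
  by (simp add: index_blocks_def take_Suc_conv_app_nth)

lemma index_blocks_snoc:
  "index_blocks (ms @ [m]) = index_blocks ms @ [[sum_list ms ..< sum_list ms + m]]"
  by (rule nth_equalityI) (auto simp: nth_index_blocks nth_append less_Suc_eq)

lemma concat_index_blocks: "concat (index_blocks ms) = [0..<sum_list ms]"
  by (induction ms rule: rev_induct) (simp_all add: index_blocks_snoc upt_add_eq_append[of 0, simplified])

lemma map_nth_index_blocks:
  "map (map ((!) (concat xss))) (index_blocks (map length xss)) = xss"
proof (induction xss rule: rev_induct)
  case (snoc xs xss)
  have l: "sum_list (map length xss) = length (concat xss)"
    by (simp add: length_concat)
  have "map (map ((!) (concat (xss @ [xs])))) (index_blocks (map length xss))
      = map (map ((!) (concat xss))) (index_blocks (map length xss))"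
  proof (intro list.map_cong0)
    fix b i assume "b \<in> set (index_blocks (map length xss))" "i \<in> set b"
    then have "i \<in> set (concat (index_blocks (map length xss)))" by auto
    then have "i < length (concat xss)" by (simp add: concat_index_blocks l)
    then show "concat (xss @ [xs]) ! i = concat xss ! i" by (simp add: nth_append)
  qed
  moreover have "map ((!) (concat (xss @ [xs]))) [length (concat xss)..<length (concat xss) + length xs] = xs"
    by (rule nth_equalityI) (simp_all add: nth_append)
  ultimately show ?case using snoc l by (simp add: index_blocks_snoc)
qed simp

lemma mset_concat_map2_permute_list:
  assumes "length \<sigma>s = length xss" "\<And>i. i < length xss \<Longrightarrow> \<sigma>s ! i permutes {..<length (xss ! i)}"
  shows "mset (concat (map2 permute_list \<sigma>s xss)) = mset (concat xss)"
  using assms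
proof (induction \<sigma>s xss rule: list_induct2)
  case (Cons s ss x xs)
  have "mset (concat (map2 permute_list ss xs)) = mset (concat xs)"
    by (rule Cons.IH) (use Cons.prems[of "Suc i" for i] in auto)
  then show ?case using Cons.prems[of 0] by simp
qed simp

lemma sum_perm_permutes:
  assumes "length \<sigma>s = length ms" "\<And>i. i < length ms \<Longrightarrow> \<sigma>s ! i permutes {..<ms ! i}"
  shows "sum_perm \<sigma>s ms permutes {..<sum_list ms}"
  unfolding sum_perm_def
  by (rule perm_of_list_permutes, subst mset_concat_map2_permute_list)
     (use assms in \<open>simp_all add: nth_index_blocks concat_index_blocks\<close>)

lemma mset_concat_cong: "mset xs = mset ys \<Longrightarrow> mset (concat xs) = mset (concat ys)"
  by (simp add: mset_concat sum_mset_sum_list[symmetric] del: sum_mset_sum_list)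

lemma block_perm_permutes:
  assumes "\<sigma> permutes {..<length ms}"
  shows "block_perm \<sigma> ms permutes {..<sum_list ms}"
  unfolding block_perm_def
  by (rule perm_of_list_permutes, subst mset_concat_cong[OF mset_permute_list])
     (use assms in \<open>simp_all add: concat_index_blocks\<close>)

lemma permute_list_perm_of_list_concat:
  assumes "mset is = mset [0..<length xs]"
  shows "permute_list (perm_of_list is) xs = map ((!) xs) is"
proof -
  have "length is = length xs" using arg_cong[OF assms, of size] by simp
  then show ?thesis by (simp add: permute_list_perm_of_list)
qed

lemma map2_permute_list_map:
  assumes "length \<sigma>s = length xss" "\<And>i. i < length xss \<Longrightarrow> \<sigma>s ! i permutes {..<length (xss ! i)}"
  shows "map (map f) (map2 permute_list \<sigma>s xss) = map2 permute_list \<sigma>s (map (map f) xss)"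
  by (rule nth_equalityI) (use assms in \<open>simp_all add: permute_list_map\<close>)

lemma permute_list_sum_perm:
  assumes "length \<sigma>s = length xss" "\<And>i. i < length xss \<Longrightarrow> \<sigma>s ! i permutes {..<length (xss ! i)}"
  shows "permute_list (sum_perm \<sigma>s (map length xss)) (concat xss) = concat (map2 permute_list \<sigma>s xss)"
proof -
  let ?b = "index_blocks (map length xss)"
  have m: "mset (concat (map2 permute_list \<sigma>s ?b)) = mset [0..<length (concat xss)]"
    by (subst mset_concat_map2_permute_list)
       (use assms in \<open>simp_all add: nth_index_blocks concat_index_blocks length_concat\<close>)
  show ?thesis unfolding sum_perm_def
    by (subst permute_list_perm_of_list_concat[OF m], subst map_concat, subst map2_permute_list_map)
       (use assms in \<open>simp_all add: nth_index_blocks map_nth_index_blocks\<close>)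
qed

lemma permute_list_block_perm:
  assumes "\<sigma> permutes {..<length xss}"
  shows "permute_list (block_perm \<sigma> (map length xss)) (concat xss) = concat (permute_list \<sigma> xss)"
proof -
  let ?b = "index_blocks (map length xss)"
  have m: "mset (concat (permute_list \<sigma> ?b)) = mset [0..<length (concat xss)]"
    by (subst mset_concat_cong[OF mset_permute_list])
       (use assms in \<open>simp_all add: concat_index_blocks length_concat\<close>)
  show ?thesis unfolding block_perm_def
    by (subst permute_list_perm_of_list_concat[OF m], subst map_concat, subst permute_list_map[symmetric])
       (use assms in \<open>simp_all add: map_nth_index_blocks\<close>)
qed


lemma mset_interchange:
  "mset (concat (map (\<lambda>i. map (\<lambda>j. j * n + i) [0..<m]) [0..<n])) = mset [0..<n * m]"
proof -
  let ?r = "\<lambda>i. map (\<lambda>j. j * n + i) [0..<m]"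
  have inj: "j = j'" if "j * n + i = j' * n + i'" "i < n" "i' < n" for i i' j j' :: nat
  proof -
    have "(j * n + i) div n = j" "(j' * n + i') div n = j'" using that(2,3) by simp_all
    then show ?thesis using that(1) by simp
  qed
  have "distinct (concat (map ?r [0..<k]))" if "k \<le> n" for k
    using that
  proof (induction k)
    case (Suc k)
    have "set (concat (map ?r [0..<k])) \<inter> set (?r k) = {}"
    proof -
      have "j' * n + i \<noteq> j * n + k" if "i < k" for i j j'
        using inj[of j' i j k] that Suc.prems by auto
      then show ?thesis unfolding disjoint_iff by auto
    qed
    then show ?case using Suc by (auto simp: distinct_map inj_on_def)
  qed simp
  then have d: "distinct (concat (map ?r [0..<n]))" by simp
  have sub: "set (concat (map ?r [0..<n])) \<subseteq> {..<n * m}"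
  proof -
    have "j * n + i < n * m" if "i < n" "j < m" for i j
    proof -
      have "(j + 1) * n \<le> m * n" using that by (intro mult_le_mono1) simp
      then show ?thesis using that by (simp add: algebra_simps)
    qed
    then show ?thesis by auto
  qed
  have "length (concat (map ?r [0..<n])) = n * m"
    by (simp add: length_concat comp_def sum_list_triv)
  then have "card (set (concat (map ?r [0..<n]))) = n * m"
    using distinct_card[OF d] by simp
  then have "set (concat (map ?r [0..<n])) = {..<n * m}"
    by (intro card_subset_eq) (use sub in auto)
  then show ?thesis
    using d by (subst set_eq_iff_mset_eq_distinct[symmetric]) (auto simp: atLeast0LessThan)
qed

lemma interchange_perm_permutes: "interchange_perm n m permutes {..<n * m}"
  unfolding interchange_perm_def by (rule perm_of_list_permutes[OF mset_interchange])

lemma nth_concat_columns: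
  "\<lbrakk>j < length ys; i < length xs\<rbrakk>
   \<Longrightarrow> concat (map (\<lambda>y. map (\<lambda>x. f x y) xs) ys) ! (j * length xs + i) = f (xs ! i) (ys ! j)"
proof (induction ys arbitrary: j)
  case (Cons y ys)
  then show ?case by (cases j) (auto simp: nth_append)
qed simp

lemma permute_list_interchange_perm:
  "permute_list (interchange_perm (length xs) (length ys)) (concat (map (\<lambda>y. map (\<lambda>x. f x y) xs) ys))
   = concat (map (\<lambda>x. map (\<lambda>y. f x y) ys) xs)"
proof -
  have l: "length (concat (map (\<lambda>y. map (\<lambda>x. f x y) xs) ys)) = length xs * length ys"
    by (simp add: length_concat comp_def sum_list_triv)
  have "permute_list (interchange_perm (length xs) (length ys)) (concat (map (\<lambda>y. map (\<lambda>x. f x y) xs) ys))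
    = concat (map (\<lambda>i. map (\<lambda>j. f (xs ! i) (ys ! j)) [0..<length ys]) [0..<length xs])"
    unfolding interchange_perm_def
    by (subst permute_list_perm_of_list_concat)
       (auto simp: l mset_interchange map_concat nth_concat_columns intro!: arg_cong[where f = concat])
  also have "\<dots> = concat (map (\<lambda>x. map (\<lambda>y. f x y) ys) xs)"
  proof -
    show ?thesis by (intro arg_cong[where f = concat] nth_equalityI) (auto intro: nth_equalityI)
  qed
  finally show ?thesis .
qed


subsection \<open>Well-typedness of the tensor product relations\<close>

lemma concat_map_concat: "concat (map concat xsss) = concat (concat xsss)"
  by (induction xsss) simp_all

lemma list_all2_bv:
  "list_all2 (\<lambda>t u. bv_eq M N t u \<and> tm_wf M N t \<and> tm_wf M N u \<and>
      tm_dom M N t = tm_dom M N u \<and> tm_cod M N t = tm_cod M N u) us us'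
   \<Longrightarrow> (\<forall>u\<in>set us'. tm_wf M N u) \<and> map (tm_cod M N) us = map (tm_cod M N) us' \<and>
      map (tm_dom M N) us = map (tm_dom M N) us'"
  unfolding list_all2_conv_all_nth list_eq_iff_nth_eq[of "map _ _"] all_set_conv_all_nth by simp

context
  fixes M :: "('o, 'a) smulticat" and N :: "('p, 'b) smulticat"
  assumes M: "symmetric_multicategory M" and N: "symmetric_multicategory N"
begin

interpretation M: symmetric_multicategory M by (rule M)
interpretation N: symmetric_multicategory N by (rule N)

lemma bv_eq_typed:
  "bv_eq M N t u \<Longrightarrow> tm_wf M N t \<and> tm_wf M N u \<and>
     tm_dom M N t = tm_dom M N u \<and> tm_cod M N t = tm_cod M N u"
proof (induction rule: bv_eq.induct)
  case (cong_CompT t us t' us')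
  note l = list_all2_bv[OF cong_CompT(4)]
  have "tm_wf M N t" "\<forall>u\<in>set us. tm_wf M N u" "map (tm_cod M N) us = tm_dom M N t" using cong_CompT(1) by auto
  then have "tm_wf M N (CompT t' us')" "tm_dom M N (CompT t us) = tm_dom M N (CompT t' us')"
    using l cong_CompT(3) by (metis tm_wf.simps(4), metis l tm_dom.simps(4))
  then show ?case using cong_CompT(1,3) by simp
next
  case (cong_ActT \<sigma> t t') then show ?case by (auto simp: tm_arity_def)
next
  case (id_left t)
  have "tm_wf M N t \<Longrightarrow> tm_cod M N t \<in> Obj M \<times> Obj N" for t
    by (induction t) (auto simp: M.Cod_closed N.Cod_closed)
  then show ?case using id_left by auto
next
  case (id_right t)
  have "tm_wf M N t \<Longrightarrow> set (tm_dom M N t) \<subseteq> Obj M \<times> Obj N" for t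
  proof (induction t)
    case (GenL x1 x2) then show ?case using M.Dom_closed[of x1] by auto
  next case (GenR x1 x2) then show ?case using N.Dom_closed[of x2] by auto
  next case (ActT \<sigma> t) then show ?case by (auto simp: tm_arity_def)
  next case (CompT t us) then show ?case by (fastforce)
  qed auto
  then have "set (tm_dom M N t) \<subseteq> Obj M \<times> Obj N" using id_right .
  moreover have "concat (map (\<lambda>x. [x]) xs) = xs" for xs :: "'z list" by (induction xs) auto
  ultimately show ?case using id_right by (auto simp: comp_def)
next
  case (assoc t us vss)
  have w: "tm_wf M N t" "\<forall>u\<in>set us. tm_wf M N u" "map (tm_cod M N) us = tm_dom M N t" using assoc(1) by auto
  have e: "\<And>i. i < length us \<Longrightarrow> map (tm_cod M N) (vss!i) = tm_dom M N (us!i)"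
   "\<And>i v. i < length us \<Longrightarrow> v \<in> set (vss!i) \<Longrightarrow> tm_wf M N v" using assoc(3) by auto
  have 1: "map (tm_cod M N) (map2 CompT us vss) = map (tm_cod M N) us"
    by (rule nth_equalityI) (use assoc(2) in auto)
  have 2: "map (map (tm_cod M N)) vss = map (tm_dom M N) us"
    by (rule nth_equalityI) (use assoc(2) e in auto)
  have 3: "map (tm_dom M N) (map2 CompT us vss) = map concat (map (map (tm_dom M N)) vss)"
    by (rule nth_equalityI) (use assoc(2) e in auto)
  have 4: "\<forall>u\<in>set (map2 CompT us vss). tm_wf M N u"
    unfolding all_set_conv_all_nth using assoc by auto
  have 5: "\<forall>v\<in>set (concat vss). tm_wf M N v"
    using e(2) assoc(2) by (metis (no_types) UN_E in_set_conv_nth set_concat)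
  have "tm_dom M N (CompT t (map2 CompT us vss)) = tm_dom M N (CompT (CompT t us) (concat vss))"
    unfolding tm_dom.simps 3 concat_map_concat by (simp only: map_concat)
  moreover have "map (tm_cod M N) (concat vss) = tm_dom M N (CompT t us)"
    unfolding map_concat 2 by simp
  ultimately show ?case using w 1 4 5 by (simp del: map_concat tm_dom.simps)
next
  case (act_comp t \<sigma> \<tau>) then show ?case by (auto simp: tm_arity_def permutes_compose permute_list_compose)
next
  case (act_inner t us \<sigma>s)
  have 1: "map (tm_cod M N) (map2 ActT \<sigma>s us) = map (tm_cod M N) us"
    by (rule nth_equalityI) (use act_inner(2) in auto)
  have 4: "\<forall>u\<in>set (map2 ActT \<sigma>s us). tm_wf M N u"
    unfolding all_set_conv_all_nth using act_inner by auto
  have a: "map (tm_arity M N) us = map length (map (tm_dom M N) us)" by (simp add: tm_arity_def)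
  have 3: "map (tm_dom M N) (map2 ActT \<sigma>s us) = map2 permute_list \<sigma>s (map (tm_dom M N) us)"
    by (rule nth_equalityI) (use act_inner in auto)
  have "permute_list (sum_perm \<sigma>s (map (tm_arity M N) us)) (concat (map (tm_dom M N) us)) = concat (map2 permute_list \<sigma>s (map (tm_dom M N) us))"
    unfolding a by (rule permute_list_sum_perm) (use act_inner in \<open>auto simp: tm_arity_def\<close>)
  moreover have "sum_perm \<sigma>s (map (tm_arity M N) us) permutes {..<sum_list (map (tm_arity M N) us)}"
    by (rule sum_perm_permutes) (use act_inner in auto)
  ultimately show ?case using act_inner 1 3 4 a by (auto simp: tm_arity_def length_concat comp_def simp del: map_map)
next
  case (act_outer t us \<sigma>)
  have l: "length us = tm_arity M N t" using act_outer(1) by (metis length_map tm_wf.simps(4) tm_arity_def)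
  have a: "map (tm_arity M N) us = map length (map (tm_dom M N) us)" by (simp add: tm_arity_def)
  have "permute_list (block_perm \<sigma> (map (tm_arity M N) us)) (concat (map (tm_dom M N) us)) = concat (permute_list \<sigma> (map (tm_dom M N) us))"
    unfolding a by (rule permute_list_block_perm) (use act_outer l in auto)
  moreover have "block_perm \<sigma> (map (tm_arity M N) us) permutes {..<sum_list (map (tm_arity M N) us)}"
    by (rule block_perm_permutes) (use act_outer l in auto)
  ultimately show ?case using act_outer l a by (auto simp: tm_arity_def length_concat comp_def permute_list_map[symmetric] simp del: map_map)
next
  case (GenL_Comp f gs X)
  have "map (Cod M) gs = Dom M f" using GenL_Comp by (simp add: composable_def)
  then have "map (\<lambda>g. (Cod M g, X)) gs = map (\<lambda>A. (A, X)) (Dom M f)" by (simp add: comp_def flip: \<open>map (Cod M) gs = Dom M f\<close>)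
  then show ?case using GenL_Comp M.Comp_closed[of f gs] M.Dom_Comp[of f gs] M.Cod_Comp[of f gs]
    by (auto simp: composable_def map_concat comp_def)
next
  case (GenR_Comp A f gs)
  have "map (Cod N) gs = Dom N f" using GenR_Comp by (simp add: composable_def)
  then have "map (\<lambda>g. (A, Cod N g)) gs = map (\<lambda>X. (A, X)) (Dom N f)" by (simp add: comp_def flip: \<open>map (Cod N) gs = Dom N f\<close>)
  then show ?case using GenR_Comp N.Comp_closed[of f gs] N.Dom_Comp[of f gs] N.Cod_Comp[of f gs]
    by (auto simp: composable_def map_concat comp_def)
next
  case (interchange f h)
  have "interchange_perm (arity M f) (arity N h) permutes {..<arity M f * arity N h}" by (rule interchange_perm_permutes)
  moreover have "length (concat (map (\<lambda>X. map (\<lambda>A. (A,X)) (Dom M f)) (Dom N h))) = arity M f * arity N h"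
     by (simp add: arity_def length_concat comp_def sum_list_triv)
  ultimately show ?case using interchange M.Dom_closed[of f] N.Dom_closed[of h] M.Cod_closed[of f] N.Cod_closed[of h]
     permute_list_interchange_perm[of "Dom M f" "Dom N h" Pair]
    by (auto simp: arity_def tm_arity_def comp_def)
qed (auto simp: tm_arity_def arity_def M.Act_closed M.Dom_Act M.Cod_Act N.Act_closed N.Dom_Act N.Cod_Act
   M.Ident_closed N.Ident_closed M.Dom_Ident M.Cod_Ident N.Dom_Ident N.Cod_Ident permute_list_map)

end


subsection \<open>Independence of \<^const>\<open>sequential\<close> from the types of the category\<close>

lemma map2_concat:
  assumes "length xss = length yss" "\<And>i. i < length xss \<Longrightarrow> length (xss ! i) = length (yss ! i)"
  shows "map2 h (concat xss) (concat yss) = concat (map2 (map2 h) xss yss)"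
  using assms
proof (induction xss yss rule: list_induct2)
  case (Cons xs xss ys yss)
  have "map2 h (concat xss) (concat yss) = concat (map2 (map2 h) xss yss)"
    by (rule Cons.IH) (use Cons.prems[of "Suc i" for i] in auto)
  then show ?case using Cons.prems[of 0] by simp
qed simp

lemma permute_list_map2:
  assumes "\<sigma> permutes {..<length xs}" "length xs = length ys"
  shows "permute_list \<sigma> (map2 h xs ys) = map2 h (permute_list \<sigma> xs) (permute_list \<sigma> ys)"
  using assms by (simp add: permute_list_map permute_list_zip)

context category
begin

abbreviation (input) S where "S \<equiv> seq_multicat C"

lemma in_Arr_S: "p \<in> Arr S \<longleftrightarrow> snd p \<in> obj C \<and> (\<forall>f\<in>set (fst p). f \<in> arr C \<and> tgt C f = snd p)"
  by (auto simp: seq_multicat_def)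

lemma S_simps:
  "Obj S = obj C" "Dom S p = map (src C) (fst p)" "Cod S p = snd p" "Ident S X = ([idn C X], X)"
  "Comp S p qs = (concat (map2 (\<lambda>f q. map (cmp C f) (fst q)) (fst p) qs), snd p)"
  "Act S \<sigma> p = (permute_list \<sigma> (fst p), snd p)" "arity S p = length (fst p)"
  by (simp_all add: seq_multicat_def arity_def split_def)

lemma composable_S:
  "composable S p qs \<longleftrightarrow> p \<in> Arr S \<and> (\<forall>q\<in>set qs. q \<in> Arr S) \<and> length qs = length (fst p) \<and>
     (\<forall>i<length qs. snd (qs ! i) = src C (fst p ! i))"
  by (auto simp: composable_def S_simps list_eq_iff_nth_eq)

lemma composable_S_nth:
  assumes "composable S p qs" "i < length qs" "g \<in> set (fst (qs ! i))"
  shows "fst p ! i \<in> arr C" "tgt C (fst p ! i) = snd p" "g \<in> arr C" "tgt C g = src C (fst p ! i)"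
proof -
  have "qs ! i \<in> Arr S" "fst p ! i \<in> set (fst p)" using assms by (auto simp: composable_S)
  then show "fst p ! i \<in> arr C" "tgt C (fst p ! i) = snd p" "g \<in> arr C" "tgt C g = src C (fst p ! i)"
    using assms by (auto simp: composable_S in_Arr_S)
qed

lemma map2_cmp_S:
  assumes "length xs = length ys"
  shows "map2 f xs ys = map (\<lambda>i. f (xs ! i) (ys ! i)) [0..<length ys]"
  by (rule nth_equalityI) (use assms in auto)

theorem seq_multicat_symmetric: "symmetric_multicategory S"
proof (unfold_locales, goal_cases)
  case (1 f) then show ?case by (auto simp: in_Arr_S S_simps src_closed)
next
  case (2 f) then show ?case by (auto simp: in_Arr_S S_simps)
next
  case (3 A) then show ?case by (auto simp: in_Arr_S S_simps idn_closed tgt_idn)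
next
  case (4 A) then show ?case by (auto simp: S_simps src_idn)
next
  case (5 A) then show ?case by (auto simp: S_simps)
next
  case (6 p qs)
  then have l: "length (fst p) = length qs" and X: "snd p \<in> obj C" by (auto simp: composable_S in_Arr_S)
  show ?case
    unfolding in_Arr_S S_simps using X composable_S_nth[OF 6]
    by (auto simp: map2_cmp_S[OF l] cmp_closed tgt_cmp)
next
  case (7 p qs)
  then have l: "length (fst p) = length qs" by (auto simp: composable_S)
  have "map (src C) (map (cmp C (fst p ! i)) (fst (qs ! i))) = map (src C) (fst (qs ! i))" if "i < length qs" for i
    using composable_S_nth[OF 7 that] by (auto simp: src_cmp)
  then have "map (map (src C)) (map2 (\<lambda>f q. map (cmp C f) (fst q)) (fst p) qs) = map (Dom S) qs"
    by (intro nth_equalityI) (auto simp: l S_simps)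
  then show ?case by (simp only: S_simps map_concat fst_conv)
next
  case (8 p qs) show ?case by (simp add: S_simps)
next
  case (9 p)
  have "map (cmp C (idn C (snd p))) (fst p) = fst p"
    by (rule map_idI) (use 9 cmp_idn_left in \<open>force simp: in_Arr_S\<close>)
  then show ?case by (simp add: S_simps)
next
  case (10 p)
  have "map2 (\<lambda>f q. map (cmp C f) (fst q)) (fst p) (map (Ident S) (Dom S p)) = map (\<lambda>f. [f]) (fst p)"
    by (rule nth_equalityI) (use 10 cmp_idn_right in \<open>auto simp: S_simps in_Arr_S\<close>)
  then show ?case by (simp add: S_simps)
next
  case (11 p qs rss)
  have l: "length (fst p) = length qs" using 11 by (auto simp: composable_S)
  have l': "length (fst (qs ! i)) = length (rss ! i)" if "i < length qs" for i
    using 11(3)[OF that] by (auto simp: composable_S)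
  let ?h = "\<lambda>f q. map (cmp C f) (fst q)"
  have "?h (fst p ! i) (Comp S (qs ! i) (rss ! i)) = concat (map2 ?h (map (cmp C (fst p ! i)) (fst (qs ! i))) (rss ! i))"
    if i: "i < length qs" for i
  proof -
    have "map (map (cmp C (fst p ! i))) (map2 ?h (fst (qs ! i)) (rss ! i)) = map2 ?h (map (cmp C (fst p ! i)) (fst (qs ! i))) (rss ! i)"
    proof (rule nth_equalityI, goal_cases)
      case (2 j)
      then have j: "j < length (rss ! i)" "j < length (fst (qs ! i))" using l'[OF i] by auto
      have "cmp C (fst p ! i) (cmp C (fst (qs ! i) ! j) r) = cmp C (cmp C (fst p ! i) (fst (qs ! i) ! j)) r"
        if "r \<in> set (fst (rss ! i ! j))" for r
        using composable_S_nth[OF 11(1) i nth_mem[OF j(2)]] composable_S_nth[OF 11(3)[OF i] j(1) that]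
        by (intro cmp_assoc) auto
      then show ?case using j by simp
    qed simp
    then show ?thesis by (simp only: S_simps map_concat fst_conv)
  qed
  then have "map2 ?h (fst p) (map2 (Comp S) qs rss) = map concat (map2 (map2 ?h) (map2 ?h (fst p) qs) rss)"
    by (intro nth_equalityI) (use l 11(2) in auto)
  then have "concat (map2 ?h (fst p) (map2 (Comp S) qs rss)) = concat (concat (map2 (map2 ?h) (map2 ?h (fst p) qs) rss))"
    by (simp only: concat_map_concat)
  also have "concat (map2 (map2 ?h) (map2 ?h (fst p) qs) rss) = map2 ?h (concat (map2 ?h (fst p) qs)) (concat rss)"
    by (rule map2_concat[symmetric]) (use l l' 11(2) in auto)
  finally show ?case unfolding S_simps(5)[of p] S_simps(5)[of "(_, _)"] by simp
next
  case (12 f \<sigma>) then show ?case by (auto simp: in_Arr_S S_simps)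
next
  case (13 f \<sigma>) then show ?case by (auto simp: S_simps permute_list_map)
next
  case (14 f \<sigma>) then show ?case by (auto simp: S_simps)
next
  case (15 f) then show ?case by (auto simp: S_simps)
next
  case (16 f \<sigma> \<tau>) then show ?case by (auto simp: S_simps permute_list_compose)
next
  case (17 p qs \<sigma>s)
  have l: "length (fst p) = length qs" using 17 by (auto simp: composable_S)
  let ?h = "\<lambda>f q. map (cmp C f) (fst q)"
  have e: "map2 ?h (fst p) (map2 (Act S) \<sigma>s qs) = map2 permute_list \<sigma>s (map2 ?h (fst p) qs)"
    by (rule nth_equalityI) (use 17 l in \<open>auto simp: S_simps permute_list_map\<close>)
  have "map (arity S) qs = map length (map2 ?h (fst p) qs)"
    by (rule nth_equalityI) (use l in \<open>auto simp: S_simps\<close>)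
  then have "permute_list (sum_perm \<sigma>s (map (arity S) qs)) (concat (map2 ?h (fst p) qs)) = concat (map2 ?h (fst p) (map2 (Act S) \<sigma>s qs))"
    by (simp only: e) (rule permute_list_sum_perm, use 17 l in \<open>auto simp: S_simps\<close>)
  then show ?case unfolding S_simps(5,6) by simp
next
  case (18 p qs \<sigma>)
  have l: "length (fst p) = length qs" using 18 by (auto simp: composable_S)
  let ?h = "\<lambda>f q. map (cmp C f) (fst q)"
  have "map (arity S) qs = map length (map2 ?h (fst p) qs)"
    by (rule nth_equalityI) (use l in \<open>auto simp: S_simps\<close>)
  then have "permute_list (block_perm \<sigma> (map (arity S) qs)) (concat (map2 ?h (fst p) qs)) = concat (permute_list \<sigma> (map2 ?h (fst p) qs))"
    by (simp only:) (rule permute_list_block_perm, use 18 l in \<open>auto simp: S_simps\<close>)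
  also have "permute_list \<sigma> (map2 ?h (fst p) qs) = map2 ?h (permute_list \<sigma> (fst p)) (permute_list \<sigma> qs)"
    by (rule permute_list_map2) (use 18 l in \<open>auto simp: S_simps\<close>)
  finally show ?case unfolding S_simps(5,6) by simp
qed

end

lemma symmetric_functor_compose:
  assumes "symmetric_functor M N F" "symmetric_functor N P G"
  shows "symmetric_functor M P \<lparr>on_obj = on_obj G \<circ> on_obj F, on_arr = on_arr G \<circ> on_arr F\<rparr>"
proof -
  interpret F: symmetric_functor M N F by fact
  interpret G: symmetric_functor N P G by fact
  have c: "composable N (on_arr F f) (map (on_arr F) gs)" if "composable M f gs" for f gs
  proof -
    have gs: "set gs \<subseteq> Arr M" "map (Cod M) gs = Dom M f" "f \<in> Arr M"
      using that by (auto simp: composable_def)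
    have "map (Cod N) (map (on_arr F) gs) = map (on_obj F) (map (Cod M) gs)"
      using gs(1) by (auto simp: F.Cod_on_arr)
    then show ?thesis
      using gs by (auto simp: composable_def F.on_arr_closed F.Dom_on_arr simp del: map_map)
  qed
  show ?thesis
    by unfold_locales
      (simp_all add: F.on_obj_closed F.on_arr_closed F.Dom_on_arr F.Cod_on_arr F.on_arr_Ident
        F.on_arr_Comp F.on_arr_Act G.on_obj_closed G.on_arr_closed G.Dom_on_arr G.Cod_on_arr
        G.on_arr_Ident G.on_arr_Comp[OF c] G.on_arr_Act arity_def)
qed

lemma smulticat_iso_trans:
  assumes "smulticat_iso M N" "smulticat_iso N P"
  shows "smulticat_iso M P"
proof -
  from assms(1) obtain F G where F: "symmetric_functor M N F" "symmetric_functor N M G"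
    "\<forall>A\<in>Obj M. on_obj G (on_obj F A) = A" "\<forall>f\<in>Arr M. on_arr G (on_arr F f) = f"
    "\<forall>X\<in>Obj N. on_obj F (on_obj G X) = X" "\<forall>h\<in>Arr N. on_arr F (on_arr G h) = h"
    unfolding smulticat_iso_def by blast
  from assms(2) obtain H K where H: "symmetric_functor N P H" "symmetric_functor P N K"
    "\<forall>A\<in>Obj N. on_obj K (on_obj H A) = A" "\<forall>f\<in>Arr N. on_arr K (on_arr H f) = f"
    "\<forall>X\<in>Obj P. on_obj H (on_obj K X) = X" "\<forall>h\<in>Arr P. on_arr H (on_arr K h) = h"
    unfolding smulticat_iso_def by blast
  interpret F: symmetric_functor M N F by fact
  interpret G: symmetric_functor N M G by fact
  interpret H: symmetric_functor N P H by fact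
  interpret K: symmetric_functor P N K by fact
  show ?thesis unfolding smulticat_iso_def
    using symmetric_functor_compose[OF F(1) H(1)] symmetric_functor_compose[OF H(2) F(2)] F(3-) H(3-)
    by (intro exI conjI) (auto simp: F.on_obj_closed F.on_arr_closed K.on_obj_closed K.on_arr_closed)
qed

lemma seq_multicat_functor:
  assumes "category C" "category D"
    and \<phi>: "\<And>X. X \<in> obj C \<Longrightarrow> \<phi> X \<in> obj D" "\<And>f. f \<in> arr C \<Longrightarrow> \<psi> f \<in> arr D"
      "\<And>f. f \<in> arr C \<Longrightarrow> src D (\<psi> f) = \<phi> (src C f)" "\<And>f. f \<in> arr C \<Longrightarrow> tgt D (\<psi> f) = \<phi> (tgt C f)"
      "\<And>X. X \<in> obj C \<Longrightarrow> \<psi> (idn C X) = idn D (\<phi> X)"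
      "\<And>f g. \<lbrakk>f \<in> arr C; g \<in> arr C; src C f = tgt C g\<rbrakk> \<Longrightarrow> \<psi> (cmp C f g) = cmp D (\<psi> f) (\<psi> g)"
  shows "symmetric_functor (seq_multicat C) (seq_multicat D)
    \<lparr>on_obj = \<phi>, on_arr = \<lambda>p. (map \<psi> (fst p), \<phi> (snd p))\<rparr>"
proof -
  interpret C: category C by fact
  interpret D: category D by fact
  show ?thesis
  proof (intro symmetric_functor.intro C.seq_multicat_symmetric D.seq_multicat_symmetric,
      unfold_locales, goal_cases)
    case (1 A) then show ?case using \<phi>(1) by (simp add: C.S_simps D.S_simps)
  next
    case (2 f) then show ?case using \<phi> by (auto simp: C.in_Arr_S D.in_Arr_S)
  next
    case (3 f) then show ?case using \<phi> by (auto simp: C.in_Arr_S C.S_simps D.S_simps)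
  next
    case (4 f) then show ?case by (auto simp: C.in_Arr_S C.S_simps D.S_simps)
  next
    case (5 A) then show ?case using \<phi> by (auto simp: C.S_simps D.S_simps)
  next
    case (6 p qs)
    have l: "length (fst p) = length qs" using 6 by (auto simp: C.composable_S)
    have "map \<psi> (map (cmp C (fst p ! i)) (fst (qs ! i))) = map (cmp D (\<psi> (fst p ! i))) (map \<psi> (fst (qs ! i)))"
      if "i < length qs" for i
      using C.composable_S_nth[OF 6 that] \<phi>(6) by auto
    then have "map (map \<psi>) (map2 (\<lambda>f q. map (cmp C f) (fst q)) (fst p) qs)
        = map2 (\<lambda>f q. map (cmp D f) (fst q)) (map \<psi> (fst p)) (map (\<lambda>p. (map \<psi> (fst p), \<phi> (snd p))) qs)"
      by (intro nth_equalityI) (use l in auto)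
    then show ?case by (simp add: C.S_simps D.S_simps map_concat del: map_map)
  next
    case (7 f \<sigma>) then show ?case by (simp add: C.S_simps D.S_simps permute_list_map)
  qed
qed

definition unary_cat :: "('o, 'a) smulticat \<Rightarrow> ('o, 'a) cat" where
  "unary_cat M = \<lparr>obj = Obj M, arr = {f \<in> Arr M. arity M f = 1}, src = hd \<circ> Dom M, tgt = Cod M,
     idn = Ident M, cmp = (\<lambda>f g. Comp M f [g])\<rparr>"

lemma unary_simps:
  "obj (unary_cat M) = Obj M" "f \<in> arr (unary_cat M) \<longleftrightarrow> f \<in> Arr M \<and> arity M f = 1" "src (unary_cat M) f = hd (Dom M f)"
  "tgt (unary_cat M) = Cod M" "idn (unary_cat M) = Ident M" "cmp (unary_cat M) f g = Comp M f [g]"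
  by (simp_all add: unary_cat_def)

lemma unary_Dom: "arity M f = 1 \<Longrightarrow> Dom M f = [hd (Dom M f)]"
  by (cases "Dom M f") (auto simp: arity_def)

context symmetric_multicategory
begin

lemma composable_unary:
  "\<lbrakk>f \<in> arr (unary_cat M); g \<in> arr (unary_cat M); src (unary_cat M) f = tgt (unary_cat M) g\<rbrakk> \<Longrightarrow> composable M f [g]"
  using unary_Dom[of M f] by (simp add: composable_def unary_simps)

lemma category_unary: "category (unary_cat M)"
proof (unfold_locales, goal_cases)
  case (1 f) then show ?case
    using Dom_closed[of f] unary_Dom[of M f] by (auto simp: unary_simps) (metis list.set_intros(1) subsetD)
next
  case (6 f g) then show ?case
    using composable_unary[of f g] by (simp add: unary_simps Comp_closed arity_def Dom_Comp)
next
  case (7 f g) then show ?case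
    using composable_unary[of f g] by (simp add: unary_simps Dom_Comp)
next
  case (8 f g) then show ?case
    using composable_unary[of f g] by (simp add: unary_simps Cod_Comp)
next
  case (9 f) then show ?case by (simp add: unary_simps Comp_Ident_left)
next
  case (10 f) then show ?case
    using Comp_Ident_right[of f] unary_Dom[of M f] by (simp add: unary_simps) (metis list.map)
next
  case (11 f g h) then show ?case
    using Comp_assoc[of f "[g]" "[[h]]"] composable_unary[of f g] composable_unary[of g h]
    by (simp add: unary_simps)
qed (auto simp: unary_simps Cod_closed Ident_closed Dom_Ident Cod_Ident arity_def)

end

theorem sequential_if_iso:
  fixes M :: "('o, 'a) smulticat" and C :: "('x, 'y) cat"
  assumes "category C" "smulticat_iso M (seq_multicat C)"
  shows "sequential M"
proof -
  interpret C: category C by fact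
  let ?S = "seq_multicat C"
  from assms(2) obtain F G where F: "symmetric_functor M ?S F" "symmetric_functor ?S M G"
    "\<And>A. A\<in>Obj M \<Longrightarrow> on_obj G (on_obj F A) = A" "\<And>f. f\<in>Arr M \<Longrightarrow> on_arr G (on_arr F f) = f"
    "\<And>X. X\<in>Obj ?S \<Longrightarrow> on_obj F (on_obj G X) = X" "\<And>h. h\<in>Arr ?S \<Longrightarrow> on_arr F (on_arr G h) = h"
    unfolding smulticat_iso_def by blast
  interpret F: symmetric_functor M ?S F by fact
  interpret G: symmetric_functor ?S M G by fact
  interpret U: category "unary_cat M" by (rule F.dom.category_unary)
  define \<gamma> where "\<gamma> c = on_arr G ([c], tgt C c)" for c
  define \<delta> where "\<delta> f = hd (fst (on_arr F f))" for f
  have s: "([c], tgt C c) \<in> Arr ?S" if "c \<in> arr C" for c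
    using that by (simp add: C.in_Arr_S C.tgt_closed)
  have \<gamma>: "\<gamma> c \<in> Arr M" "Dom M (\<gamma> c) = [on_obj G (src C c)]" "Cod M (\<gamma> c) = on_obj G (tgt C c)"
    "on_arr F (\<gamma> c) = ([c], tgt C c)" if "c \<in> arr C" for c
    using s[OF that] G.on_arr_closed[OF s[OF that]] G.Dom_on_arr[OF s[OF that]] G.Cod_on_arr[OF s[OF that]] F(6)[OF s[OF that]]
    by (simp_all add: \<gamma>_def C.S_simps)
  have \<delta>: "on_arr F f = ([\<delta> f], on_obj F (Cod M f))" "\<delta> f \<in> arr C"
    "src C (\<delta> f) = on_obj F (hd (Dom M f))" "tgt C (\<delta> f) = on_obj F (Cod M f)"
    if "f \<in> arr (unary_cat M)" for f
  proof -
    have f: "f \<in> Arr M" "Dom M f = [hd (Dom M f)]" using that unary_Dom by (auto simp: unary_simps)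
    have "map (src C) (fst (on_arr F f)) = map (on_obj F) (Dom M f)"
      using F.Dom_on_arr[OF f(1)] by (simp add: C.S_simps)
    then have d: "map (src C) (fst (on_arr F f)) = [on_obj F (hd (Dom M f))]"
      using f(2) by (metis list.map)
    then obtain c where c: "fst (on_arr F f) = [c]" by auto
    have "snd (on_arr F f) = on_obj F (Cod M f)" using F.Cod_on_arr[OF f(1)] by (simp add: C.S_simps)
    then show "on_arr F f = ([\<delta> f], on_obj F (Cod M f))" "\<delta> f \<in> arr C"
      "src C (\<delta> f) = on_obj F (hd (Dom M f))" "tgt C (\<delta> f) = on_obj F (Cod M f)"
      using c d F.on_arr_closed[OF f(1)] by (auto simp: \<delta>_def C.in_Arr_S intro: prod_eqI)
  qed
  have \<gamma>\<delta>: "\<gamma> (\<delta> f) = f" if "f \<in> arr (unary_cat M)" for f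
    using \<delta>[OF that] F(4)[of f] that by (simp add: \<gamma>_def unary_simps)
  have \<delta>\<gamma>: "\<delta> (\<gamma> c) = c" if "c \<in> arr C" for c
    using \<gamma>(4)[OF that] by (simp add: \<delta>_def)
  have 1: "symmetric_functor ?S (seq_multicat (unary_cat M))
      \<lparr>on_obj = on_obj G, on_arr = \<lambda>p. (map \<gamma> (fst p), on_obj G (snd p))\<rparr>"
  proof (rule seq_multicat_functor[OF assms(1) U.category_axioms], goal_cases)
    case (1 X) then show ?case using G.on_obj_closed by (simp add: unary_simps C.S_simps)
  next
    case (5 X) then show ?case using G.on_arr_Ident[of X]
      by (simp add: unary_simps C.S_simps \<gamma>_def C.tgt_idn)
  next
    case (6 f g)
    have "composable ?S ([f], tgt C f) [([g], tgt C g)]"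
      using 6 s by (simp add: C.composable_S)
    from G.on_arr_Comp[OF this] show ?case
      using 6 by (simp add: unary_simps C.S_simps \<gamma>_def C.tgt_cmp)
  qed (simp_all add: unary_simps \<gamma> arity_def)
  have 2: "symmetric_functor (seq_multicat (unary_cat M)) ?S
      \<lparr>on_obj = on_obj F, on_arr = \<lambda>p. (map \<delta> (fst p), on_obj F (snd p))\<rparr>"
  proof (rule seq_multicat_functor[OF U.category_axioms assms(1)], goal_cases)
    case (1 X) then show ?case using F.on_obj_closed by (simp add: unary_simps C.S_simps)
  next
    case (5 X) then show ?case using F.on_arr_Ident[of X] by (simp add: unary_simps C.S_simps \<delta>_def)
  next
    case (6 f g)
    then have "on_arr F (Comp M f [g]) = Comp ?S (on_arr F f) [on_arr F g]"
      using F.on_arr_Comp[OF F.dom.composable_unary] by simp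
    then show ?case using \<delta>(1)[OF 6(1)] \<delta>(1)[OF 6(2)] by (simp add: \<delta>_def[of "Comp M f [g]"] unary_simps C.S_simps)
  qed (simp_all add: unary_simps \<delta>)
  have "smulticat_iso ?S (seq_multicat (unary_cat M))"
    unfolding smulticat_iso_def
  proof (intro exI conjI ballI, rule 1, rule 2, goal_cases)
    case (2 p) then have "map (\<delta> \<circ> \<gamma>) (fst p) = fst p" "snd p \<in> Obj ?S"
      using \<delta>\<gamma> by (auto simp: C.in_Arr_S C.S_simps intro: map_idI)
    then show ?case using F(5) by (simp add: prod_eq_iff)
  next
    case (4 p) then have "map (\<gamma> \<circ> \<delta>) (fst p) = fst p" "snd p \<in> Obj M"
      using \<gamma>\<delta> by (auto simp: U.in_Arr_S unary_simps intro: map_idI)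
    then show ?case using F(3) by (simp add: prod_eq_iff)
  qed (use F(3,5) in \<open>simp_all add: C.S_simps U.S_simps unary_simps\<close>)
  then have "smulticat_iso M (seq_multicat (unary_cat M))"
    using smulticat_iso_trans assms(2) by blast
  then show ?thesis
    unfolding sequential_def using U.category_axioms by blast
qed

end

(*
  A symmetric multicategory is sequential iff every object A carries arrows m n A : A, ..., A -> A that
  form a commutative monoid and every arrow is a homomorphism of these monoids, i.e. interchanges with
  m n.  In C_> these are the sequences of n identities.  Conversely, given such m, let u = m 0 and
  f_i = f(u, ..., id, ..., u) be the unary components of f : A_1, ..., A_n -> A; plugging the n x n array
  with id on and u off the diagonal into the interchange of f with m n gives f = m n (f_1, ..., f_n), so
  arrows into A correspond to sequences of unary ones.

  Such structures are inherited from L by the tensor product and by both internal homs: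
  M (x) L has (m n X)_A, [M, L] has m n (F A) at A, and [L, M] has F (m n X) at X.  The closure of
  interchange under composition and permutation is one pasting lemma on interchange squares, which also
  shows that transformations compose.
*)
theory Submission
  imports Defs
begin

section \<open>Interchange squares\<close>

text \<open>The obstacle is the tensor product: its arrows are classes of formal terms, for which no
  normal form is at hand, so a category of unary arrows and an isomorphism with sequences cannot
  simply be read off. The criterion by monoids is intrinsic, and its one condition on all arrows can
  be checked on generators and propagated along composition and permutation. The category is then
  always the one of unary arrows.

  The technical weight lies in the permutations. An equation of composites does not say how arrays
  fit together, so a square also records the domains of rows and columns. Pasting produces
  permutations of blocks followed by permutations inside blocks; \<open>interchange_perm_sum\<close>
  and \<open>interchange_perm_block_perm\<close> bring these back to a single transposition, the
  first for composition, the second for the action of permutations.\<close>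

lemma permutes_eqI:
  assumes "\<sigma> permutes {..<length xs}" "\<tau> permutes {..<length xs}" "distinct xs"
    "permute_list \<sigma> xs = permute_list \<tau> xs"
  shows "\<sigma> = \<tau>"
proof (rule ext)
  fix i show "\<sigma> i = \<tau> i"
  proof (cases "i < length xs")
    case True
    then have "xs ! \<sigma> i = xs ! \<tau> i"
      using assms(4) permute_list_nth[OF assms(1) True] permute_list_nth[OF assms(2) True] by simp
    moreover have "\<sigma> i < length xs" "\<tau> i < length xs"
      using assms(1,2) True by (metis permutes_in_image lessThan_iff)+
    ultimately show ?thesis using assms(3) nth_eq_iff_index_eq by metis
  next
    case False then show ?thesis using assms(1,2) by (simp add: permutes_def)
  qed
qed

lemma permutes_eq_idI:
  assumes "\<sigma> permutes {..<length xs}" "distinct xs" "permute_list \<sigma> xs = xs"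
  shows "\<sigma> = id"
  using assms by (intro permutes_eqI[of _ xs]) (simp_all add: permutes_id)

text \<open>An array is transposed and transposed back. The labels are all pairs of indices; on
  lists the left factor of a composite of permutations acts first.\<close>

lemma interchange_perm_transpose: "interchange_perm n m \<circ> interchange_perm m n = id"
proof (rule permutes_eq_idI)
  let ?xs = "List.product [0..<m] [0..<n]"
  have p: "interchange_perm n m permutes {..<length ?xs}" "interchange_perm m n permutes {..<length ?xs}"
    using interchange_perm_permutes[of n m] interchange_perm_permutes[of m n] by (simp_all add: mult.commute)
  show "interchange_perm n m \<circ> interchange_perm m n permutes {..<length ?xs}"
    using p by (rule permutes_compose[rotated])
  show "distinct ?xs"
    by (simp add: distinct_product)
  have "permute_list (interchange_perm n m) ?xs = concat (map (\<lambda>x. map (\<lambda>y. (y, x)) [0..<m]) [0..<n])"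
    unfolding product_concat_map
    using permute_list_interchange_perm[of "[0..<n]" "[0..<m]" "\<lambda>x y. (y, x)"] by simp
  moreover have "permute_list (interchange_perm m n) (concat (map (\<lambda>x. map (\<lambda>y. (y, x)) [0..<m]) [0..<n])) = ?xs"
    unfolding product_concat_map
    using permute_list_interchange_perm[of "[0..<m]" "[0..<n]" Pair] by simp
  ultimately show "permute_list (interchange_perm n m \<circ> interchange_perm m n) ?xs = ?xs"
    using permute_list_compose[OF p(2), of "interchange_perm n m"] by (simp only:)
qed

text \<open>An array with one row or one column, or an empty one, has the same enumeration by rows
  and by columns. Hence interchange with unary arrows and with \<open>m 0\<close> involves no
  permutation.\<close>

lemma interchange_perm_trivial [simp]:
  "interchange_perm (Suc 0) m = id" "interchange_perm m (Suc 0) = id"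
  "interchange_perm m 0 = id" "interchange_perm 0 m = id"
proof -
  have *: "perm_of_list [0..<n] = id" for n
    by (auto simp: perm_of_list_def)
  show "interchange_perm (Suc 0) m = id" "interchange_perm m (Suc 0) = id"
    by (simp_all add: interchange_perm_def *)
  show "interchange_perm m 0 = id" "interchange_perm 0 m = id"
    using interchange_perm_permutes[of m 0] interchange_perm_permutes[of 0 m] by simp_all
qed

section \<open>Composable families and interchange squares\<close>

context symmetric_multicategory
begin

lemma composable_length: "composable M f gs \<Longrightarrow> length gs = arity M f"
  by (metis arity_def composable_def length_map)

lemma composable_nth:
  assumes "composable M f gs" "i < length gs"
  shows "gs ! i \<in> Arr M" "Cod M (gs ! i) = Dom M f ! i"
  using assms by (auto simp: composable_def dest: nth_mem) (metis nth_map)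

lemma composable_Arr: "composable M f gs \<Longrightarrow> f \<in> Arr M"
  by (simp add: composable_def)

lemma composableI:
  assumes "f \<in> Arr M" "length gs = arity M f" "\<And>i. i < length gs \<Longrightarrow> gs ! i \<in> Arr M \<and> Cod M (gs ! i) = Dom M f ! i"
  shows "composable M f gs"
proof -
  have "set gs \<subseteq> Arr M" using assms(3) by (auto simp: in_set_conv_nth)
  moreover have "map (Cod M) gs = Dom M f"
    by (rule nth_equalityI) (use assms in \<open>auto simp: arity_def\<close>)
  ultimately show ?thesis using assms(1) by (simp add: composable_def)
qed

lemma arity_Comp: "composable M f gs \<Longrightarrow> arity M (Comp M f gs) = sum_list (map (arity M) gs)"
  by (simp add: arity_def[abs_def] Dom_Comp length_concat comp_def)

lemma composable_concat:
  assumes "composable M f gs" "length hss = length gs" "\<And>i. i < length gs \<Longrightarrow> composable M (gs ! i) (hss ! i)"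
  shows "composable M (Comp M f gs) (concat hss)"
proof -
  have "set (concat hss) \<subseteq> Arr M"
    using assms(2,3) by (auto simp: composable_def in_set_conv_nth) (metis nth_mem subsetD)
  moreover have "map (map (Cod M)) hss = map (Dom M) gs"
    by (rule nth_equalityI) (use assms in \<open>auto simp: composable_def\<close>)
  ultimately show ?thesis
    using assms(1) by (simp add: composable_def[of M "Comp M f gs"] Comp_closed Dom_Comp map_concat)
qed

lemma composable_map2_Comp:
  assumes "composable M f gs" "length hss = length gs" "\<And>i. i < length gs \<Longrightarrow> composable M (gs ! i) (hss ! i)"
  shows "composable M f (map2 (Comp M) gs hss)"
  by (rule composableI)
    (use assms in \<open>auto simp: composable_Arr composable_length Comp_closed Cod_Comp composable_nth\<close>)

lemma composable_permute:
  assumes "composable M f gs" "\<sigma> permutes {..<arity M f}"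
  shows "composable M (Act M \<sigma> f) (permute_list \<sigma> gs)"
  using assms composable_length[OF assms(1)]
  by (auto simp: composable_def Act_closed Dom_Act permute_list_map[symmetric])

text \<open>
  The domains of the \<open>hs ! i\<close> and of the \<open>fs ! j\<close> are the rows and the columns of an array of objects;
  contracting the rows and then applying \<open>f\<close> agrees with contracting the columns and then applying \<open>h\<close>.
\<close>

definition square :: "'a \<Rightarrow> 'a list \<Rightarrow> 'a \<Rightarrow> 'a list \<Rightarrow> bool" where
  "square f hs h fs \<longleftrightarrow> composable M f hs \<and> composable M h fs \<and>
     (\<forall>i<length hs. Dom M (hs ! i) = map (\<lambda>f'. Dom M f' ! i) fs) \<and>
     (\<forall>j<length fs. Dom M (fs ! j) = map (\<lambda>h'. Dom M h' ! j) hs) \<and>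
     Comp M f hs = Act M (interchange_perm (length hs) (length fs)) (Comp M h fs)"

lemma square_arity:
  assumes "square f hs h fs"
  shows "i < length hs \<Longrightarrow> arity M (hs ! i) = length fs" "j < length fs \<Longrightarrow> arity M (fs ! j) = length hs"
    "arity M (Comp M h fs) = length hs * length fs" "arity M (Comp M f hs) = length hs * length fs"
proof -
  show *: "i < length hs \<Longrightarrow> arity M (hs ! i) = length fs" "j < length fs \<Longrightarrow> arity M (fs ! j) = length hs" for i j
    using assms by (simp_all add: square_def arity_def)
  have "map (arity M) fs = replicate (length fs) (length hs)" "map (arity M) hs = replicate (length hs) (length fs)"
    by (rule nth_equalityI; simp add: *)+
  then show "arity M (Comp M h fs) = length hs * length fs" "arity M (Comp M f hs) = length hs * length fs"
    using assms arity_Comp[of h fs] arity_Comp[of f hs]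
    by (simp_all add: square_def sum_list_replicate del: map_eq_conv)
qed

lemma square_composable: "square f hs h fs \<Longrightarrow> composable M f hs \<and> composable M h fs"
  unfolding square_def by blast

lemma square_eq:
  "square f hs h fs \<Longrightarrow> Comp M f hs = Act M (interchange_perm (length hs) (length fs)) (Comp M h fs)"
  unfolding square_def by blast

lemma square_Dom:
  assumes "square f hs h fs" "i < length hs" "j < length fs"
  shows "Dom M (hs ! i) ! j = Dom M (fs ! j) ! i"
proof -
  have "Dom M (hs ! i) = map (\<lambda>f'. Dom M f' ! i) fs" using assms unfolding square_def by blast
  then show ?thesis using assms(3) by simp
qed

text \<open>The transpositions of an array and of its transpose are mutually inverse, so acting by
  the second moves the permutation to the other side of the equation. Pasting then needs a proof in
  one direction only, and squares are flipped to bring the arrow that varies into the first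
  place.\<close>

lemma square_commute: "square f hs h fs \<longleftrightarrow> square h fs f hs"
proof -
  have "square h fs f hs" if s: "square f hs h fs" for f hs h fs
  proof -
    let ?i = "interchange_perm (length hs) (length fs)" and ?i' = "interchange_perm (length fs) (length hs)"
    have p: "?i permutes {..<length hs * length fs}" "?i' permutes {..<length hs * length fs}"
      using interchange_perm_permutes[of "length hs" "length fs"] interchange_perm_permutes[of "length fs" "length hs"]
      by (simp_all add: mult.commute)
    have c: "Comp M h fs \<in> Arr M" using s by (simp add: square_def Comp_closed)
    have "Act M ?i' (Comp M f hs) = Act M ?i' (Act M ?i (Comp M h fs))"
      using s by (simp add: square_def)
    also have "\<dots> = Comp M h fs"
      using c p square_arity[OF s] by (simp add: Act_comp[symmetric] interchange_perm_transpose Act_id)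
    finally show ?thesis using s by (auto simp: square_def)
  qed
  then show ?thesis by blast
qed

text \<open>The array has a single row, so the permutation is trivial and both composites reduce to
  \<open>h\<close>. Needed for identity transformations and for the terms
  \<open>IdT\<close>.\<close>

lemma square_Ident:
  assumes "h \<in> Arr M"
  shows "square (Ident M (Cod M h)) [h] h (map (Ident M) (Dom M h))"
proof -
  have *: "Dom M h ! i \<in> Obj M" if "i < arity M h" for i
    using that Dom_closed[OF assms] by (auto simp: arity_def)
  then have "composable M h (map (Ident M) (Dom M h))"
    by (intro composableI) (auto simp: assms Ident_closed Cod_Ident arity_def)
  then show ?thesis
    using assms * by (auto simp: square_def composable_def Ident_closed Dom_Ident Cod_Ident Cod_closed
        Comp_Ident_left Comp_Ident_right Act_id arity_def intro!: nth_equalityI)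
qed

end

text \<open>The number of columns is an explicit argument because an array without rows does not
  determine it.\<close>

abbreviation (input) columns :: "nat \<Rightarrow> nat \<Rightarrow> 'x list list \<Rightarrow> 'x list list" where
  "columns k n xss \<equiv> map (\<lambda>j. map (\<lambda>i. xss ! i ! j) [0..<k]) [0..<n]"

lemma concat_rows:
  assumes "\<And>i. i < length xss \<Longrightarrow> length (xss ! i) = n"
  shows "concat xss = permute_list (interchange_perm (length xss) n) (concat (columns (length xss) n xss))"
proof -
  have "map (\<lambda>j. xss ! i ! j) [0..<n] = xss ! i" if "i < length xss" for i
    using assms[OF that] map_nth[of "xss ! i"] by simp
  then have "map (\<lambda>i. map (\<lambda>j. xss ! i ! j) [0..<n]) [0..<length xss] = xss"
    by (intro nth_equalityI) simp_all
  then show ?thesis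
    using permute_list_interchange_perm[of "[0..<length xss]" "[0..<n]" "\<lambda>i j. xss ! i ! j"]
    by (simp only: length_upt diff_zero)
qed

context symmetric_multicategory
begin

text \<open>Associativity on both sides separates the inserted arrows from the square, whose
  equation can then be applied; outer equivariance turns the transposition into a permutation of
  blocks, of sizes the arities of the inserted arrows. Besides pasting, this serves to split an
  arrow into unary components, where the inserted array is an identity matrix.\<close>

lemma square_Comp_columns:
  assumes s: "square f hs h fs" and l: "length gss = length hs"
    and c: "\<And>i. i < length hs \<Longrightarrow> composable M (hs ! i) (gss ! i)"
  defines "cols \<equiv> columns (length hs) (length fs) gss"
  shows "\<And>j. j < length fs \<Longrightarrow> composable M (fs ! j) (cols ! j)"
    "length cols = length fs"
    "Comp M f (map2 (Comp M) hs gss) =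
      Act M (block_perm (interchange_perm (length hs) (length fs)) (map (arity M) (concat cols)))
        (Comp M h (map2 (Comp M) fs cols))"
proof -
  have ln: "length (gss ! i) = length fs" if "i < length hs" for i
    using composable_length[OF c[OF that]] square_arity(1)[OF s that] by simp
  have cf: "composable M f hs" and ch: "composable M h fs" using square_composable[OF s] by blast+
  show cc: "composable M (fs ! j) (cols ! j)" if j: "j < length fs" for j
  proof (rule composableI)
    show "fs ! j \<in> Arr M" using composable_nth[OF ch j] by simp
    show "length (cols ! j) = arity M (fs ! j)" using j square_arity(2)[OF s] by (simp add: cols_def)
    fix i assume "i < length (cols ! j)"
    then have i: "i < length hs" using j by (simp add: cols_def)
    then show "cols ! j ! i \<in> Arr M \<and> Cod M (cols ! j ! i) = Dom M (fs ! j) ! i"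
      using composable_nth[OF c[OF i], of j] j i ln square_Dom[OF s i j] by (simp add: cols_def)
  qed
  show lc: "length cols = length fs" by (simp add: cols_def)
  have ci: "composable M (Comp M h fs) (concat cols)"
    by (rule composable_concat[OF ch lc cc])
  have concat_gss: "concat gss = permute_list (interchange_perm (length hs) (length fs)) (concat cols)"
    unfolding cols_def l[symmetric] by (rule concat_rows) (simp add: l ln)
  have "Comp M f (map2 (Comp M) hs gss) = Comp M (Comp M f hs) (concat gss)"
    by (rule Comp_assoc[OF cf l c])
  also have "\<dots> = Comp M (Act M (interchange_perm (length hs) (length fs)) (Comp M h fs))
      (permute_list (interchange_perm (length hs) (length fs)) (concat cols))"
    by (simp only: square_eq[OF s] concat_gss)
  also have "\<dots> = Act M (block_perm (interchange_perm (length hs) (length fs)) (map (arity M) (concat cols)))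
      (Comp M (Comp M h fs) (concat cols))"
    by (rule Comp_Act_outer[OF ci]) (simp add: square_arity[OF s] interchange_perm_permutes)
  also have "Comp M (Comp M h fs) (concat cols) = Comp M h (map2 (Comp M) fs cols)"
    by (rule Comp_assoc[OF ch lc cc, symmetric])
  finally show "Comp M f (map2 (Comp M) hs gss) =
      Act M (block_perm (interchange_perm (length hs) (length fs)) (map (arity M) (concat cols)))
        (Comp M h (map2 (Comp M) fs cols))" .
qed

end

text \<open>
  Permutations are compared by their action on one list of distinct labels, on which the actions of
  \<^const>\<open>block_perm\<close>, \<^const>\<open>sum_perm\<close> and \<^const>\<open>interchange_perm\<close> are rearrangements of nested lists.
\<close>

lemma interchange_perm_sum:
  "block_perm (interchange_perm (length ps) n) (concat (replicate n ps)) \<circ>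
     sum_perm (map (\<lambda>p. interchange_perm p n) ps) (map (\<lambda>p. p * n) ps)
   = interchange_perm (sum_list ps) n" (is "?B \<circ> ?S = ?I")
proof (rule permutes_eqI)
  \<comment> \<open>The row numbers, cut into blocks of sizes \<open>ps\<close>. A label is a pair
    of a column number and a row number, listed column by column.\<close>
  define X where "X = index_blocks ps"
  let ?ys = "[0..<n]"
  let ?xs = "List.product ?ys (concat X)"
  have X: "map length X = ps" "length X = length ps" "distinct (concat X)" "length (concat X) = sum_list ps"
    by (auto simp: X_def concat_index_blocks nth_index_blocks intro: nth_equalityI)
  have l: "length ?xs = sum_list ps * n" using X(4) by simp
  have s: "sum_list (concat (replicate n ps)) = sum_list ps * n"
    by (induction n) simp_all
  have lc: "length (concat (replicate n ps)) = length ps * n"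
    by (simp add: length_concat sum_list_replicate mult.commute)
  have B: "?B permutes {..<length ?xs}"
    using block_perm_permutes[of "interchange_perm (length ps) n" "concat (replicate n ps)"]
    unfolding l s lc by (simp add: interchange_perm_permutes)
  have S: "?S permutes {..<length ?xs}"
    using sum_perm_permutes[of "map (\<lambda>p. interchange_perm p n) ps" "map (\<lambda>p. p * n) ps"]
    unfolding l by (simp add: interchange_perm_permutes sum_list_mult_const)
  show "?B \<circ> ?S permutes {..<length ?xs}" using S B by (rule permutes_compose)
  show "?I permutes {..<length ?xs}" unfolding l by (rule interchange_perm_permutes)
  show "distinct ?xs" using X(3) by (simp add: distinct_product)
  let ?L = "concat (map (\<lambda>y. map (map (Pair y)) X) ?ys)"
  have xs: "?xs = concat ?L"
    by (simp add: product_concat_map map_concat concat_map_concat[symmetric] comp_def)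
  have "map length ?L = concat (replicate n (map length X))"
    by (simp add: map_concat comp_def map_replicate_const)
  then have mL: "concat (replicate n ps) = map length ?L" by (simp only: X(1))
  \<comment> \<open>The pieces of the columns are regrouped: the \<open>n\<close> pieces that belong
    to the same block of rows become adjacent.\<close>
  have "permute_list ?B ?xs = concat (permute_list (interchange_perm (length ps) n) ?L)"
    unfolding xs mL
    by (rule permute_list_block_perm)
      (use interchange_perm_permutes[of "length ps" n] in
        \<open>simp add: length_concat comp_def sum_list_triv X(2) mult.commute\<close>)
  also have "permute_list (interchange_perm (length ps) n) ?L = concat (map (\<lambda>x. map (\<lambda>y. map (Pair y) x) ?ys) X)"
    using permute_list_interchange_perm[of X ?ys "\<lambda>x y. map (Pair y) x"] X(2) by simp
  also have "concat \<dots> = concat (map (\<lambda>x. concat (map (\<lambda>y. map (Pair y) x) ?ys)) X)" (is "_ = concat ?R")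
    by (simp add: concat_map_concat[symmetric] comp_def)
  finally have 1: "permute_list ?B ?xs = concat ?R" .
  have "map length ?R = map (\<lambda>p. p * n) (map length X)"
    by (simp add: length_concat comp_def sum_list_triv)
  then have mR: "map (\<lambda>p. p * n) ps = map length ?R" by (simp only: X(1))
  \<comment> \<open>Each block of rows is now a contiguous array listed by columns, and is
    transposed by itself.\<close>
  have "permute_list ?S (concat ?R) = concat (map2 permute_list (map (\<lambda>p. interchange_perm p n) ps) ?R)"
    unfolding mR
  proof (rule permute_list_sum_perm)
    fix i assume "i < length ?R"
    then have i: "i < length ps" by (simp add: X(2))
    then have "ps ! i = length (X ! i)" using X by (metis nth_map)
    then show "map (\<lambda>p. interchange_perm p n) ps ! i permutes {..<length (?R ! i)}"
      using i interchange_perm_permutes[of "ps ! i" n]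
      by (simp add: X(2) length_concat comp_def sum_list_triv mult.commute)
  qed (simp add: X(2))
  also have "map2 permute_list (map (\<lambda>p. interchange_perm p n) ps) ?R =
      map (\<lambda>x. permute_list (interchange_perm (length x) n) (concat (map (\<lambda>y. map (Pair y) x) ?ys))) X"
    unfolding X(1)[symmetric] by (rule nth_equalityI) simp_all
  also have "\<dots> = map (\<lambda>x. concat (map (\<lambda>z. map (\<lambda>y. (y, z)) ?ys) x)) X"
  proof (rule list.map_cong0)
    fix x show "permute_list (interchange_perm (length x) n) (concat (map (\<lambda>y. map (Pair y) x) ?ys)) =
        concat (map (\<lambda>z. map (\<lambda>y. (y, z)) ?ys) x)"
      using permute_list_interchange_perm[of x ?ys "\<lambda>z y. (y, z)"] by simp
  qed
  also have "concat \<dots> = concat (map (\<lambda>z. map (\<lambda>y. (y, z)) ?ys) (concat X))"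
    by (simp add: map_concat concat_map_concat[symmetric] comp_def)
  finally have 2: "permute_list ?S (concat ?R) = concat (map (\<lambda>z. map (\<lambda>y. (y, z)) ?ys) (concat X))" .
  have "permute_list ?I ?xs = concat (map (\<lambda>z. map (\<lambda>y. (y, z)) ?ys) (concat X))"
    using permute_list_interchange_perm[of "concat X" ?ys "\<lambda>z y. (y, z)"]
    by (simp add: product_concat_map X(4))
  then show "permute_list (?B \<circ> ?S) ?xs = permute_list ?I ?xs"
    unfolding permute_list_compose[OF S] 1 2 by simp
qed

text \<open>With the left factor acting first on lists: transposing and then permuting whole rows
  has the same effect as permuting the entries of each column and then transposing. This is the
  combinatorial content of \<open>square_Act\<close>.\<close>

lemma interchange_perm_block_perm:
  assumes "\<sigma> permutes {..<k}"
  shows "interchange_perm k n \<circ> block_perm \<sigma> (replicate k n) =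
    sum_perm (replicate n \<sigma>) (replicate n k) \<circ> interchange_perm k n" (is "?I \<circ> ?B = ?S \<circ> ?I")
proof (rule permutes_eqI)
  let ?ys = "[0..<n]"
  let ?xs = "List.product ?ys [0..<k]"
  have l: "length ?xs = k * n" by simp
  have I: "?I permutes {..<length ?xs}" unfolding l by (rule interchange_perm_permutes)
  have B: "?B permutes {..<length ?xs}"
    using block_perm_permutes[of \<sigma> "replicate k n"] assms by (simp add: sum_list_replicate mult.commute)
  have S: "?S permutes {..<length ?xs}"
    using sum_perm_permutes[of "replicate n \<sigma>" "replicate n k"] assms by (simp add: sum_list_replicate)
  show "?I \<circ> ?B permutes {..<length ?xs}" using B I by (rule permutes_compose)
  show "?S \<circ> ?I permutes {..<length ?xs}" using I S by (rule permutes_compose)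
  show "distinct ?xs" by (simp add: distinct_product)
  let ?R = "map (\<lambda>x. map (\<lambda>y. (y, x)) ?ys) [0..<k]" and ?L = "map (\<lambda>y. map (Pair y) [0..<k]) ?ys"
  have mR: "replicate k n = map length ?R" and mL: "replicate n k = map length ?L"
    by (simp_all add: comp_def map_replicate_const)
  have "permute_list ?I ?xs = concat ?R"
    using permute_list_interchange_perm[of "[0..<k]" ?ys "\<lambda>x y. (y, x)"] by (simp add: product_concat_map)
  moreover have "permute_list ?B (concat ?R) = concat (permute_list \<sigma> ?R)"
    unfolding mR by (rule permute_list_block_perm) (simp add: assms)
  moreover have "permute_list \<sigma> ?R = map (\<lambda>x. map (\<lambda>y. (y, x)) ?ys) (permute_list \<sigma> [0..<k])"
    by (rule permute_list_map) (simp add: assms)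
  ultimately have 1: "permute_list ?B (permute_list ?I ?xs) =
      concat (map (\<lambda>x. map (\<lambda>y. (y, x)) ?ys) (permute_list \<sigma> [0..<k]))" by simp
  have "permute_list ?S ?xs = concat (map2 permute_list (replicate n \<sigma>) ?L)"
    unfolding mL product_concat_map by (rule permute_list_sum_perm) (simp_all add: assms)
  also have "map2 permute_list (replicate n \<sigma>) ?L = map (\<lambda>y. map (Pair y) (permute_list \<sigma> [0..<k])) ?ys"
    by (rule nth_equalityI) (simp_all add: assms permute_list_map)
  finally have "permute_list ?I (permute_list ?S ?xs) =
      concat (map (\<lambda>x. map (\<lambda>y. (y, x)) ?ys) (permute_list \<sigma> [0..<k]))"
    using permute_list_interchange_perm[of "permute_list \<sigma> [0..<k]" ?ys "\<lambda>x y. (y, x)"] by simp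
  then show "permute_list (?I \<circ> ?B) ?xs = permute_list (?S \<circ> ?I) ?xs"
    unfolding permute_list_compose[OF B] permute_list_compose[OF I] 1 by simp
qed

section \<open>Pasting squares along composition and along permutations\<close>

context symmetric_multicategory
begin

text \<open>The domains of the rows can be recovered entry by entry from those of the columns once
  their lengths are known, so for rows only the arities have to be supplied.\<close>

lemma squareI:
  assumes "composable M f hs" "composable M h fs"
    "\<And>i. i < length hs \<Longrightarrow> arity M (hs ! i) = length fs"
    "\<And>j. j < length fs \<Longrightarrow> Dom M (fs ! j) = map (\<lambda>h'. Dom M h' ! j) hs"
    "Comp M f hs = Act M (interchange_perm (length hs) (length fs)) (Comp M h fs)"
  shows "square f hs h fs"
proof -
  have "Dom M (hs ! i) = map (\<lambda>f'. Dom M f' ! i) fs" if "i < length hs" for i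
    by (rule nth_equalityI) (use that assms(3,4) in \<open>simp_all add: arity_def\<close>)
  then show ?thesis unfolding square_def using assms by blast
qed

text \<open>The arrays of the small squares are stacked on top of each other. Each small square
  replaces \<open>gs ! i\<close> by \<open>hs ! i\<close> at the price of a transposition; inner
  equivariance collects these into a \<open>sum_perm\<close>, and the outer square contributes a
  \<open>block_perm\<close>. By \<open>interchange_perm_sum\<close> the two combine to the
  transposition of the stacked array.\<close>

lemma square_Comp:
  assumes s: "square f hs h fs" and gs: "composable M f gs"
    and l: "length hss = length hs" "length gss = length hs"
    and sq: "\<And>i. i < length hs \<Longrightarrow> square (gs ! i) (hss ! i) (hs ! i) (gss ! i)"
  shows "square (Comp M f gs) (concat hss) h (map2 (Comp M) fs (columns (length hs) (length fs) gss))"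
proof -
  let ?k = "length hs" and ?n = "length fs"
  define cols where "cols = columns ?k ?n gss"
  \<comment> \<open>The numbers of rows of the small arrays, all of which have
    \<open>length fs\<close> columns.\<close>
  define ps where "ps = map (arity M) gs"
  have cf: "composable M f hs" and ch: "composable M h fs" using square_composable[OF s] by blast+
  have lg: "length gs = ?k" using gs cf by (simp add: composable_length)
  have c: "composable M (hs ! i) (gss ! i)" and c': "composable M (gs ! i) (hss ! i)" if "i < ?k" for i
    using square_composable[OF sq[OF that]] by blast+
  have lgss: "length (gss ! i) = ?n" if "i < ?k" for i
    using composable_length[OF c[OF that]] square_arity(1)[OF s that] by simp
  have lhss: "length (hss ! i) = ps ! i" if "i < ?k" for i
    using composable_length[OF c'[OF that]] that by (simp add: ps_def lg)
  have cols: "\<And>j. j < ?n \<Longrightarrow> composable M (fs ! j) (cols ! j)" "length cols = ?n"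
    "Comp M f (map2 (Comp M) hs gss) =
      Act M (block_perm (interchange_perm ?k ?n) (map (arity M) (concat cols))) (Comp M h (map2 (Comp M) fs cols))"
    unfolding cols_def using square_Comp_columns[OF s l(2)] c by blast+
  have ch': "composable M h (map2 (Comp M) fs cols)"
    using ch cols(1,2) by (intro composable_map2_Comp)
  have X: "Comp M h (map2 (Comp M) fs cols) \<in> Arr M" using ch' by (rule Comp_closed)
  have lps: "length ps = ?k" by (simp add: ps_def lg)
  have psn: "arity M (gss ! i ! j) = ps ! i" if "i < ?k" "j < ?n" for i j
    using square_arity(2)[OF sq[OF that(1)], of j] that by (simp add: lgss lhss)
  have "map (map (arity M)) cols = replicate ?n ps"
    by (rule nth_equalityI) (auto simp: cols_def psn lps intro!: nth_equalityI)
  then have a1: "map (arity M) (concat cols) = concat (replicate ?n ps)" by (simp only: map_concat)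
  have a2: "map (arity M) (map2 (Comp M) hs gss) = map (\<lambda>p. p * ?n) ps"
  proof (rule nth_equalityI)
    fix i assume "i < length (map (arity M) (map2 (Comp M) hs gss))"
    then have i: "i < ?k" by simp
    show "map (arity M) (map2 (Comp M) hs gss) ! i = map (\<lambda>p. p * ?n) ps ! i"
      using square_arity(3)[OF sq[OF i]] i by (simp add: l lps lgss lhss)
  qed (simp add: l lps)
  have sum_ps: "sum_list (concat (replicate n ps)) = sum_list ps * n" for n
    by (induction n) simp_all
  have aX: "arity M (Comp M h (map2 (Comp M) fs cols)) = sum_list ps * ?n"
  proof -
    have "arity M (Comp M h (map2 (Comp M) fs cols)) = sum_list (map (arity M) (map2 (Comp M) fs cols))"
      by (rule arity_Comp[OF ch'])
    also have "map (arity M) (map2 (Comp M) fs cols) = map (sum_list \<circ> map (arity M)) cols"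
      by (rule nth_equalityI) (use cols(1,2) in \<open>simp_all add: arity_Comp\<close>)
    also have "sum_list \<dots> = sum_list (map (arity M) (concat cols))"
      by (induction cols) simp_all
    also have "\<dots> = sum_list ps * ?n" unfolding a1 by (rule sum_ps)
    finally show ?thesis .
  qed
  let ?\<sigma>s = "map (\<lambda>p. interchange_perm p ?n) ps"
  let ?B = "block_perm (interchange_perm ?k ?n) (concat (replicate ?n ps))"
    and ?S = "sum_perm ?\<sigma>s (map (\<lambda>p. p * ?n) ps)"
  have "length (concat (replicate ?n ps)) = ?k * ?n"
    by (simp add: length_concat sum_list_replicate lps)
  then have B: "?B permutes {..<sum_list ps * ?n}"
    using block_perm_permutes[of "interchange_perm ?k ?n" "concat (replicate ?n ps)"]
    by (simp only: sum_ps interchange_perm_permutes)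
  have S: "?S permutes {..<sum_list ps * ?n}"
    using sum_perm_permutes[of ?\<sigma>s "map (\<lambda>p. p * ?n) ps"]
    by (simp add: interchange_perm_permutes sum_list_mult_const)
  have eq: "Comp M (Comp M f gs) (concat hss) =
      Act M (interchange_perm (sum_list ps) ?n) (Comp M h (map2 (Comp M) fs cols))"
  proof -
    have "Comp M (Comp M f gs) (concat hss) = Comp M f (map2 (Comp M) gs hss)"
      by (rule Comp_assoc[OF gs, symmetric]) (simp_all add: l lg c')
    also have "map2 (Comp M) gs hss = map2 (Act M) ?\<sigma>s (map2 (Comp M) hs gss)"
    proof (rule nth_equalityI)
      fix i assume "i < length (map2 (Comp M) gs hss)"
      then have i: "i < ?k" by (simp add: lg l)
      show "map2 (Comp M) gs hss ! i = map2 (Act M) ?\<sigma>s (map2 (Comp M) hs gss) ! i"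
        using square_eq[OF sq[OF i]] i by (simp add: lg l lps lgss lhss)
    qed (simp add: lg l lps)
    also have "Comp M f \<dots> = Act M (sum_perm ?\<sigma>s (map (arity M) (map2 (Comp M) hs gss))) (Comp M f (map2 (Comp M) hs gss))"
    proof (rule Comp_Act_inner)
      show "composable M f (map2 (Comp M) hs gss)"
        using cf c by (intro composable_map2_Comp) (simp_all add: l)
      fix i assume "i < length (map2 (Comp M) hs gss)"
      then have i: "i < ?k" by simp
      have "arity M (map2 (Comp M) hs gss ! i) = ps ! i * ?n"
        using square_arity(3)[OF sq[OF i]] i by (simp add: l lgss lhss)
      then show "?\<sigma>s ! i permutes {..<arity M (map2 (Comp M) hs gss ! i)}"
        using i by (simp add: lps interchange_perm_permutes)
    qed (simp add: l lps)
    also have "\<dots> = Act M ?S (Act M ?B (Comp M h (map2 (Comp M) fs cols)))"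
      using cols(3) by (simp only: a1 a2)
    also have "\<dots> = Act M (?B \<circ> ?S) (Comp M h (map2 (Comp M) fs cols))"
      by (rule Act_comp[symmetric]) (simp_all add: X aX B S)
    also have "?B \<circ> ?S = interchange_perm (sum_list ps) ?n"
      using interchange_perm_sum[of ps ?n] by (simp add: lps)
    finally show ?thesis .
  qed
  have lch: "length (concat hss) = sum_list ps"
  proof -
    have "map length hss = ps" by (rule nth_equalityI) (simp_all add: l lps lhss)
    then show ?thesis by (simp add: length_concat)
  qed
  have "square (Comp M f gs) (concat hss) h (map2 (Comp M) fs cols)"
  proof (rule squareI)
    show "composable M (Comp M f gs) (concat hss)"
      by (rule composable_concat[OF gs]) (simp_all add: l lg c')
    show "composable M h (map2 (Comp M) fs cols)" by (rule ch')
    show "Comp M (Comp M f gs) (concat hss) =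
        Act M (interchange_perm (length (concat hss)) (length (map2 (Comp M) fs cols))) (Comp M h (map2 (Comp M) fs cols))"
      using eq by (simp only: lch length_map length_zip cols(2) min.idem)
    have "arity M h' = ?n" if h': "h' \<in> set (concat hss)" for h'
    proof -
      obtain i q where iq: "i < ?k" "q < length (hss ! i)" "h' = hss ! i ! q"
        using h' l by (auto simp: in_set_conv_nth)
      then show ?thesis using square_arity(1)[OF sq[OF iq(1)] iq(2)] lgss by simp
    qed
    then show "arity M (concat hss ! i) = length (map2 (Comp M) fs cols)" if "i < length (concat hss)" for i
      using that nth_mem cols(2) by (metis length_map length_zip min.idem)
    fix j assume "j < length (map2 (Comp M) fs cols)"
    then have j: "j < ?n" by simp
    have "Dom M (Comp M (fs ! j) (cols ! j)) = concat (map (Dom M) (cols ! j))"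
      by (rule Dom_Comp[OF cols(1)[OF j]])
    also have "map (Dom M) (cols ! j) = map (map (\<lambda>h'. Dom M h' ! j)) hss"
    proof (rule nth_equalityI)
      fix i assume "i < length (map (Dom M) (cols ! j))"
      then have i: "i < ?k" using j by (simp add: cols_def)
      have "Dom M (gss ! i ! j) = map (\<lambda>h'. Dom M h' ! j) (hss ! i)"
        using sq[OF i] j lgss[OF i] unfolding square_def by metis
      then show "map (Dom M) (cols ! j) ! i = map (map (\<lambda>h'. Dom M h' ! j)) hss ! i"
        using i j by (simp add: cols_def l)
    qed (use j in \<open>simp add: cols_def l\<close>)
    also have "concat \<dots> = map (\<lambda>h'. Dom M h' ! j) (concat hss)" by (simp only: map_concat)
    finally show "Dom M (map2 (Comp M) fs cols ! j) = map (\<lambda>h'. Dom M h' ! j) (concat hss)"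
      using j cols(2) by simp
  qed
  then show ?thesis by (simp only: cols_def)
qed

text \<open>Permuting the inputs of \<open>f\<close> permutes the rows. Outer equivariance makes
  this a block permutation, \<open>interchange_perm_block_perm\<close> carries it across the
  transposition to a permutation inside every column, and inner equivariance absorbs it into the
  \<open>fs\<close>.\<close>

lemma square_Act:
  assumes s: "square f hs h fs" and \<sigma>: "\<sigma> permutes {..<arity M f}"
  shows "square (Act M \<sigma> f) (permute_list \<sigma> hs) h (map (Act M \<sigma>) fs)"
proof -
  let ?k = "length hs" and ?n = "length fs"
  have cf: "composable M f hs" and ch: "composable M h fs" using square_composable[OF s] by blast+
  have k: "arity M f = ?k" using composable_length[OF cf] by simp
  have \<sigma>': "\<sigma> permutes {..<?k}" using \<sigma> k by simp
  have fs: "fs ! j \<in> Arr M" "arity M (fs ! j) = ?k" "\<sigma> permutes {..<arity M (fs ! j)}"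
    "Dom M (fs ! j) = map (\<lambda>h'. Dom M h' ! j) hs" if "j < ?n" for j
    using composable_nth(1)[OF ch that] square_arity(2)[OF s that] \<sigma>' s that by (simp, simp, simp, unfold square_def, blast)
  have a: "map (arity M) hs = replicate ?k ?n" "map (arity M) fs = replicate ?n ?k"
    by (rule nth_equalityI; simp add: square_arity[OF s])+
  let ?Z = "Comp M h fs" and ?I = "interchange_perm ?k ?n"
    and ?B = "block_perm \<sigma> (replicate ?k ?n)" and ?S = "sum_perm (replicate ?n \<sigma>) (replicate ?n ?k)"
  have Z: "?Z \<in> Arr M" "arity M ?Z = ?k * ?n"
    using ch square_arity(3)[OF s] by (simp_all add: Comp_closed)
  have p: "?I permutes {..<?k * ?n}" "?B permutes {..<?k * ?n}" "?S permutes {..<?k * ?n}"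
    using block_perm_permutes[of \<sigma> "replicate ?k ?n"] sum_perm_permutes[of "replicate ?n \<sigma>" "replicate ?n ?k"]
      interchange_perm_permutes[of ?k ?n] \<sigma>'
    by (simp_all add: sum_list_replicate mult.commute)
  show ?thesis
  proof (rule squareI)
    show "composable M (Act M \<sigma> f) (permute_list \<sigma> hs)"
      by (rule composable_permute[OF cf \<sigma>])
    show "composable M h (map (Act M \<sigma>) fs)"
      using ch fs by (intro composableI) (simp_all add: composable_Arr composable_length composable_nth Act_closed Cod_Act)
    show "arity M (permute_list \<sigma> hs ! i) = length (map (Act M \<sigma>) fs)" if "i < length (permute_list \<sigma> hs)" for i
    proof -
      have "\<sigma> i < ?k" using that \<sigma>' by (metis length_permute_list lessThan_iff permutes_in_image)
      then show ?thesis using that \<sigma>' by (simp add: permute_list_nth square_arity[OF s])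
    qed
    show "Dom M (map (Act M \<sigma>) fs ! j) = map (\<lambda>h'. Dom M h' ! j) (permute_list \<sigma> hs)"
      if "j < length (map (Act M \<sigma>) fs)" for j
      using that fs \<sigma>' by (simp add: Dom_Act permute_list_map)
    have m: "map (Act M \<sigma>) fs = map2 (Act M) (replicate ?n \<sigma>) fs"
      by (rule nth_equalityI) simp_all
    have "Comp M (Act M \<sigma> f) (permute_list \<sigma> hs) = Act M ?B (Comp M f hs)"
      unfolding a(1)[symmetric] by (rule Comp_Act_outer[OF cf \<sigma>])
    also have "\<dots> = Act M (?I \<circ> ?B) ?Z"
      unfolding square_eq[OF s] by (rule Act_comp[symmetric]) (simp_all add: Z p)
    also have "\<dots> = Act M (?S \<circ> ?I) ?Z"
      by (simp only: interchange_perm_block_perm[OF \<sigma>'])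
    also have "\<dots> = Act M ?I (Act M ?S ?Z)"
      by (rule Act_comp) (simp_all add: Z p)
    also have "Act M ?S ?Z = Comp M h (map (Act M \<sigma>) fs)"
      unfolding m a(2)[symmetric] by (rule Comp_Act_inner[OF ch, symmetric]) (simp_all add: fs \<sigma>')
    finally show "Comp M (Act M \<sigma> f) (permute_list \<sigma> hs) =
        Act M (interchange_perm (length (permute_list \<sigma> hs)) (length (map (Act M \<sigma>) fs))) (Comp M h (map (Act M \<sigma>) fs))"
      by simp
  qed
qed

end

section \<open>Central monoids\<close>

text \<open>Meant for a diagonal array, with singletons on the diagonal and empty blocks elsewhere:
  transposing the blocks then keeps the order of the nonempty ones, and distinct labels show that
  nothing has moved.\<close>

lemma block_perm_interchange_trivial:
  assumes "concat (concat (map (\<lambda>y. map (\<lambda>x. f x y) xs) ys)) = concat (concat (map (\<lambda>x. map (\<lambda>y. f x y) ys) xs))"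
    "distinct (concat (concat (map (\<lambda>y. map (\<lambda>x. f x y) xs) ys)))"
  shows "block_perm (interchange_perm (length xs) (length ys)) (map length (concat (map (\<lambda>y. map (\<lambda>x. f x y) xs) ys))) = id"
proof (rule permutes_eq_idI[OF _ assms(2)])
  let ?L = "concat (map (\<lambda>y. map (\<lambda>x. f x y) xs) ys)"
  have "length ?L = length xs * length ys"
    by (simp add: length_concat comp_def sum_list_triv)
  then have p: "interchange_perm (length xs) (length ys) permutes {..<length ?L}"
    by (simp only: interchange_perm_permutes)
  then have "interchange_perm (length xs) (length ys) permutes {..<length (map length ?L)}"
    by (simp only: length_map)
  from block_perm_permutes[OF this]
  show "block_perm (interchange_perm (length xs) (length ys)) (map length ?L) permutes {..<length (concat ?L)}"
    by (simp only: length_concat)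
  show "permute_list (block_perm (interchange_perm (length xs) (length ys)) (map length ?L)) (concat ?L) = concat ?L"
    unfolding permute_list_block_perm[OF p] permute_list_interchange_perm using assms(1) by simp
qed

lemma block_perm_singletons:
  assumes "\<sigma> permutes {..<n}"
  shows "block_perm \<sigma> (replicate n (Suc 0)) = \<sigma>"
proof (rule permutes_eqI)
  let ?L = "map (\<lambda>x. [x]) [0..<n]"
  have r: "replicate n (Suc 0) = map length ?L" by (simp add: comp_def map_replicate_const)
  show "block_perm \<sigma> (replicate n (Suc 0)) permutes {..<length [0..<n]}"
    using block_perm_permutes[of \<sigma> "replicate n (Suc 0)"] assms by (simp add: sum_list_replicate)
  show "permute_list (block_perm \<sigma> (replicate n (Suc 0))) [0..<n] = permute_list \<sigma> [0..<n]"
    using permute_list_block_perm[of \<sigma> ?L] assms unfolding r[symmetric]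
    by (simp add: permute_list_map)
qed (use assms in simp_all)

text \<open>The monoids are unbiased, with operations of every arity as data: \<open>m_Comp\<close>
  covers associativity and, through zeros in \<open>ks\<close>, the unit laws, and
  \<open>m_Act\<close> is commutativity. In this form the interchange of an arrow with the operation
  of its own arity, on which the decomposition into components rests, is directly available.\<close>

locale central_monoids = symmetric_multicategory M
  for M :: "('o, 'a) smulticat" +
  fixes m :: "nat \<Rightarrow> 'o \<Rightarrow> 'a"
  assumes m_closed: "A \<in> Obj M \<Longrightarrow> m n A \<in> Arr M"
    and Dom_m: "A \<in> Obj M \<Longrightarrow> Dom M (m n A) = replicate n A"
    and Cod_m: "A \<in> Obj M \<Longrightarrow> Cod M (m n A) = A"
    and m_1: "A \<in> Obj M \<Longrightarrow> m (Suc 0) A = Ident M A"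
    and m_Comp: "A \<in> Obj M \<Longrightarrow> Comp M (m (length ks) A) (map (\<lambda>k. m k A) ks) = m (sum_list ks) A"
    and m_Act: "\<lbrakk>A \<in> Obj M; \<sigma> permutes {..<n}\<rbrakk> \<Longrightarrow> Act M \<sigma> (m n A) = m n A"
    and m_central: "f \<in> Arr M \<Longrightarrow> Comp M f (map (m n) (Dom M f)) =
      Act M (interchange_perm (arity M f) n) (Comp M (m n (Cod M f)) (replicate n f))"

context symmetric_multicategory
begin

text \<open>Stated for operations of one arity and outside the locale, since the tensor product
  needs it while its own central monoids are still under construction.\<close>

lemma square_mI:
  assumes "\<And>A. A \<in> Obj M \<Longrightarrow> m A \<in> Arr M \<and> Dom M (m A) = replicate n A \<and> Cod M (m A) = A"
    and f: "f \<in> Arr M"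
    and "Comp M f (map m (Dom M f)) = Act M (interchange_perm (arity M f) n) (Comp M (m (Cod M f)) (replicate n f))"
  shows "square f (map m (Dom M f)) (m (Cod M f)) (replicate n f)"
proof (rule squareI)
  have o: "Dom M f ! i \<in> Obj M" if "i < arity M f" for i
    using Dom_closed[OF f] that by (auto simp: arity_def)
  show "composable M f (map m (Dom M f))"
    by (rule composableI) (use f o assms(1) in \<open>simp_all add: arity_def\<close>)
  show "composable M (m (Cod M f)) (replicate n f)"
    by (rule composableI) (use f assms(1)[OF Cod_closed[OF f]] in \<open>simp_all add: arity_def\<close>)
  show "arity M (map m (Dom M f) ! i) = length (replicate n f)" if "i < length (map m (Dom M f))" for i
    using that assms(1)[OF o[of i]] by (simp add: arity_def)
  show "Dom M (replicate n f ! j) = map (\<lambda>h'. Dom M h' ! j) (map m (Dom M f))" if "j < length (replicate n f)" for j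
    by (rule nth_equalityI) (use that assms(1)[OF o] in \<open>simp_all add: arity_def\<close>)
qed (use assms(3) in \<open>simp add: arity_def\<close>)

end

section \<open>Decomposition of arrows into unary components\<close>

context central_monoids
begin

lemma square_m: "f \<in> Arr M \<Longrightarrow> square f (map (m n) (Dom M f)) (m n (Cod M f)) (replicate n f)"
  by (rule square_mI) (simp_all add: m_closed Dom_m Cod_m m_central)

lemma composable_m:
  "\<lbrakk>A \<in> Obj M; length fs = n; \<And>f. f \<in> set fs \<Longrightarrow> f \<in> Arr M \<and> Cod M f = A\<rbrakk> \<Longrightarrow> composable M (m n A) fs"
  by (rule composableI) (auto simp: m_closed Dom_m arity_def)

text \<open>Entry \<open>(i, j)\<close> of an identity matrix of arrows: the identity arrow plays
  the role of 1, the unit of the monoid that of 0.\<close>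

definition unit_at :: "nat \<Rightarrow> nat \<Rightarrow> 'o \<Rightarrow> 'a" where
  "unit_at i j A = (if i = j then Ident M A else m 0 A)"

lemma unit_at:
  assumes "A \<in> Obj M"
  shows "unit_at i j A \<in> Arr M" "Dom M (unit_at i j A) = (if i = j then [A] else [])" "Cod M (unit_at i j A) = A"
    "arity M (unit_at i j A) = (if i = j then 1 else 0)"
  using assms by (simp_all add: unit_at_def Ident_closed m_closed Dom_Ident Dom_m Cod_Ident Cod_m arity_def)

lemma sum_list_unit: "i < n \<Longrightarrow> sum_list (map (\<lambda>j. if i = j then Suc 0 else 0) [0..<n]) = Suc 0"
  by (induction n) (auto simp: less_Suc_eq sum_list_0)

text \<open>The entries of the row are \<open>m k A\<close> with \<open>k\<close> equal to 1 once
  and to 0 otherwise, so this unit law is the case of \<open>m_Comp\<close> in which the arities add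
  up to 1.\<close>

lemma m_unit:
  assumes "A \<in> Obj M" "i < n"
  shows "Comp M (m n A) (map (\<lambda>j. unit_at i j A) [0..<n]) = Ident M A"
proof -
  have "map (\<lambda>j. unit_at i j A) [0..<n] = map (\<lambda>k. m k A) (map (\<lambda>j. if i = j then Suc 0 else 0) [0..<n])"
    using assms by (simp add: unit_at_def m_1)
  then show ?thesis
    using m_Comp[OF assms(1), of "map (\<lambda>j. if i = j then Suc 0 else 0) [0..<n]"] assms
    by (simp only: length_map length_upt sum_list_unit) (simp add: m_1)
qed

lemma Comp_m_0: "A \<in> Obj M \<Longrightarrow> Comp M (m 0 A) [] = m 0 A"
  using m_Comp[of A "[]"] by simp

text \<open>Centrality at \<open>n = 0\<close>, where no copy of \<open>f\<close> is left on the
  other side.\<close>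

lemma unary_m_0:
  assumes "f \<in> Arr M" "Dom M f = [A]"
  shows "Comp M f [m 0 A] = m 0 (Cod M f)"
  using m_central[OF assms(1), of 0] assms Cod_closed[OF assms(1)]
  by (simp add: arity_def Comp_m_0 Act_id m_closed)

definition component :: "'a \<Rightarrow> nat \<Rightarrow> 'a" where
  "component f i = Comp M f (map (\<lambda>j. unit_at i j (Dom M f ! j)) [0..<arity M f])"

lemma component:
  assumes "f \<in> Arr M" "i < arity M f"
  shows "composable M f (map (\<lambda>j. unit_at i j (Dom M f ! j)) [0..<arity M f])"
    "component f i \<in> Arr M" "Dom M (component f i) = [Dom M f ! i]" "Cod M (component f i) = Cod M f"
proof -
  have o: "Dom M f ! j \<in> Obj M" if "j < arity M f" for j
    using Dom_closed[OF assms(1)] that by (auto simp: arity_def)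
  show c: "composable M f (map (\<lambda>j. unit_at i j (Dom M f ! j)) [0..<arity M f])"
    by (rule composableI) (use assms o in \<open>simp_all add: unit_at\<close>)
  show "component f i \<in> Arr M" "Cod M (component f i) = Cod M f"
    unfolding component_def using c by (simp_all add: Comp_closed Cod_Comp)
  have "concat (map (\<lambda>j. if i = j then [Dom M f ! j] else []) [0..<n]) = (if i < n then [Dom M f ! i] else [])" for n
    by (induction n) auto
  moreover have "Dom M (component f i) = concat (map (\<lambda>j. if i = j then [Dom M f ! j] else []) [0..<arity M f])"
    unfolding component_def Dom_Comp[OF c]
    by (intro arg_cong[where f = concat] nth_equalityI) (use o in \<open>simp_all add: unit_at\<close>)
  ultimately show "Dom M (component f i) = [Dom M f ! i]" using assms(2) by simp
qed

lemma concat_if_eq: "i < n \<Longrightarrow> concat (map (\<lambda>j. if i = j then [g j] else []) [0..<n]) = [g i]"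
  by (induction n) (auto simp: less_Suc_eq)

text \<open>Each row of the array is contracted by the monoid operation to an identity, so one side
  of the square is \<open>f\<close> itself; column \<open>j\<close> is contracted by
  \<open>f\<close> to \<open>component f j\<close>.\<close>

lemma Comp_m_component:
  assumes f: "f \<in> Arr M"
  shows "Comp M (m (arity M f) (Cod M f)) (map (component f) [0..<arity M f]) = f"
proof -
  let ?n = "arity M f" and ?A = "\<lambda>i. Dom M f ! i"
  \<comment> \<open>Row \<open>i\<close> lies over the single object \<open>?A i\<close>, so that
    \<open>m ?n (?A i)\<close> can be applied to it; a column runs through all input objects of
    \<open>f\<close>.\<close>
  define rows where "rows = map (\<lambda>i. map (\<lambda>j. unit_at i j (?A i)) [0..<?n]) [0..<?n]"
  let ?hs = "map (m ?n) (Dom M f)" and ?cols = "columns ?n ?n rows"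
  have o: "?A i \<in> Obj M" if "i < ?n" for i
    using Dom_closed[OF f] that by (auto simp: arity_def)
  have l: "length ?hs = ?n" "length (replicate ?n f) = ?n" by (simp_all add: arity_def)
  have c: "composable M (?hs ! i) (rows ! i)" if "i < length ?hs" for i
    using that o by (simp add: rows_def arity_def[symmetric]) (rule composable_m, auto simp: unit_at)
  note sq = square_m[OF f, of ?n]
  have "Comp M f (map2 (Comp M) ?hs rows) = Act M (block_perm (interchange_perm ?n ?n) (map (arity M) (concat ?cols)))
      (Comp M (m ?n (Cod M f)) (map2 (Comp M) (replicate ?n f) ?cols))"
    using square_Comp_columns(3)[OF sq _ c] unfolding l by (simp add: rows_def)
  also have "map2 (Comp M) (replicate ?n f) ?cols = map (component f) [0..<?n]"
  proof (rule nth_equalityI)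
    fix j assume "j < length (map2 (Comp M) (replicate ?n f) ?cols)"
    then have j: "j < ?n" by simp
    have "map (\<lambda>i. rows ! i ! j) [0..<?n] = map (\<lambda>i. unit_at j i (?A i)) [0..<?n]"
      using j by (auto simp: rows_def unit_at_def)
    then have "Comp M f (map (\<lambda>i. rows ! i ! j) [0..<?n]) = component f j"
      by (simp only: component_def)
    then show "map2 (Comp M) (replicate ?n f) ?cols ! j = map (component f) [0..<?n] ! j"
      using j by simp
  qed simp
  \<comment> \<open>Only the diagonal entries have inputs, one each, and they are met in the same
    order by rows and by columns.\<close>
  also have "block_perm (interchange_perm ?n ?n) (map (arity M) (concat ?cols)) = id"
  proof -
    let ?f = "\<lambda>i j. if i = j then [i] else []"
    have 1: "concat (concat (map (\<lambda>j. map (\<lambda>i. ?f i j) [0..<?n]) [0..<?n])) = [0..<?n]"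
    proof -
      have "concat (map (\<lambda>i. ?f i j) [0..<?n]) = [j]" if "j < ?n" for j
        using concat_if_eq[OF that, of id] by (simp add: eq_commute[of j] if_distrib cong: if_cong)
      then have "map (\<lambda>j. concat (map (\<lambda>i. ?f i j) [0..<?n])) [0..<?n] = map (\<lambda>j. [j]) [0..<?n]" by simp
      then show ?thesis
        by (simp only: concat_map_concat[symmetric] map_map comp_def concat_map_singleton map_ident)
    qed
    have 2: "concat (concat (map (\<lambda>i. map (\<lambda>j. ?f i j) [0..<?n]) [0..<?n])) = [0..<?n]"
    proof -
      have "concat (map (\<lambda>j. ?f i j) [0..<?n]) = [i]" if "i < ?n" for i
        using concat_if_eq[OF that, of "\<lambda>_. i"] by simp
      then have "map (\<lambda>i. concat (map (\<lambda>j. ?f i j) [0..<?n])) [0..<?n] = map (\<lambda>j. [j]) [0..<?n]" by simp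
      then show ?thesis
        by (simp only: concat_map_concat[symmetric] map_map comp_def concat_map_singleton map_ident)
    qed
    have "map (map (arity M)) ?cols = map (map length) (map (\<lambda>j. map (\<lambda>i. ?f i j) [0..<?n]) [0..<?n])"
      using o by (auto simp: rows_def unit_at)
    then have "map (arity M) (concat ?cols) = map length (concat (map (\<lambda>j. map (\<lambda>i. ?f i j) [0..<?n]) [0..<?n]))"
      by (simp only: map_concat)
    then show ?thesis
      using block_perm_interchange_trivial[of ?f "[0..<?n]" "[0..<?n]"] 1 2 by (simp only: length_upt diff_zero distinct_upt)
  qed
  also have "map2 (Comp M) ?hs rows = map (Ident M) (Dom M f)"
    by (rule nth_equalityI) (use o in \<open>simp_all add: rows_def arity_def[symmetric] m_unit\<close>)
  also have "Comp M f \<dots> = f" by (rule Comp_Ident_right[OF f])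
  also have "Act M id (Comp M (m ?n (Cod M f)) (map (component f) [0..<?n])) =
      Comp M (m ?n (Cod M f)) (map (component f) [0..<?n])"
    by (intro Act_id Comp_closed composable_m) (use f in \<open>auto simp: Cod_closed component\<close>)
  finally show ?thesis ..
qed

text \<open>The identity and the units that define a component are first absorbed by the summands
  and only then added up, where the unit law leaves the one summand that met the identity.\<close>

lemma component_Comp_m:
  assumes A: "A \<in> Obj M" and fs: "\<And>f. f \<in> set fs \<Longrightarrow> f \<in> Arr M \<and> arity M f = 1 \<and> Cod M f = A"
    and i: "i < length fs"
  shows "component (Comp M (m (length fs) A) fs) i = fs ! i"
proof -
  let ?n = "length fs" and ?g = "Comp M (m (length fs) A) fs"
  define B where "B f = hd (Dom M f)" for f
  have f: "fs ! j \<in> Arr M" "Dom M (fs ! j) = [B (fs ! j)]" "Cod M (fs ! j) = A" "B (fs ! j) \<in> Obj M" if "j < ?n" for j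
  proof -
    show *: "fs ! j \<in> Arr M" "Dom M (fs ! j) = [B (fs ! j)]" "Cod M (fs ! j) = A"
      using fs[OF nth_mem[OF that]] unary_Dom[of M "fs ! j"] by (simp_all add: B_def)
    then show "B (fs ! j) \<in> Obj M" using Dom_closed[OF *(1)] by auto
  qed
  have c: "composable M (m ?n A) fs" using A fs by (intro composable_m) auto
  have "map (Dom M) fs = map (\<lambda>f. [B f]) fs"
    by (rule nth_equalityI) (simp_all add: f)
  then have d: "Dom M ?g = map B fs" by (simp only: Dom_Comp[OF c] concat_map_singleton)
  let ?us = "map (\<lambda>j. unit_at i j (B (fs ! j))) [0..<?n]"
  have "map (\<lambda>j. unit_at i j (map B fs ! j)) [0..<?n] = ?us" by simp
  then have "component ?g i = Comp M ?g (concat (map (\<lambda>u. [u]) ?us))"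
    by (simp only: component_def arity_def d length_map concat_map_singleton map_ident)
  also have "\<dots> = Comp M (m ?n A) (map2 (Comp M) fs (map (\<lambda>u. [u]) ?us))"
    by (rule Comp_assoc[OF c, symmetric]) (simp_all add: composable_def f unit_at)
  \<comment> \<open>The matrix entry changes sides. On the diagonal, \<open>fs ! i\<close> after an
    identity is an identity after \<open>fs ! i\<close>; off the diagonal, a unary arrow sends a
    unit to a unit, which has the empty list of inputs.\<close>
  also have "map2 (Comp M) fs (map (\<lambda>u. [u]) ?us) =
      map2 (Comp M) (map (\<lambda>j. unit_at i j A) [0..<?n]) (map (\<lambda>j. if i = j then [fs ! j] else []) [0..<?n])"
  proof (rule nth_equalityI)
    fix j assume "j < length (map2 (Comp M) fs (map (\<lambda>u. [u]) ?us))"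
    then have j: "j < ?n" by simp
    have "Comp M (fs ! j) [Ident M (B (fs ! j))] = fs ! j" "Comp M (Ident M A) [fs ! j] = fs ! j"
      using Comp_Ident_right[OF f(1)[OF j]] Comp_Ident_left[OF f(1)[OF j]] f[OF j] by simp_all
    moreover have "Comp M (fs ! j) [m 0 (B (fs ! j))] = m 0 A"
      using unary_m_0[OF f(1)[OF j] f(2)[OF j]] f(3)[OF j] by simp
    ultimately show "map2 (Comp M) fs (map (\<lambda>u. [u]) ?us) ! j =
      map2 (Comp M) (map (\<lambda>j. unit_at i j A) [0..<?n]) (map (\<lambda>j. if i = j then [fs ! j] else []) [0..<?n]) ! j"
      using j A by (simp add: unit_at_def Comp_m_0)
  qed simp
  also have "Comp M (m ?n A) \<dots> = Comp M (Comp M (m ?n A) (map (\<lambda>j. unit_at i j A) [0..<?n]))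
      (concat (map (\<lambda>j. if i = j then [fs ! j] else []) [0..<?n]))"
  proof (rule Comp_assoc)
    show "composable M (m ?n A) (map (\<lambda>j. unit_at i j A) [0..<?n])"
      by (rule composable_m) (use A in \<open>auto simp: unit_at\<close>)
  qed (use A in \<open>simp_all add: unit_at composable_def f\<close>)
  also have "\<dots> = fs ! i"
    using m_unit[OF A i] concat_if_eq[OF i, of "(!) fs"] Comp_Ident_left[OF f(1)[OF i]] f(3)[OF i] by simp
  finally show ?thesis .
qed

text \<open>By centrality the unary arrow \<open>fs ! i\<close> is a monoid homomorphism and moves
  inside the sum of \<open>gss ! i\<close>; \<open>m_Comp\<close> then flattens the sum of sums. The
  outcome is the composition rule for sequences.\<close>

lemma Comp_m_Comp:
  assumes A: "A \<in> Obj M" and l: "length fs = length gss" "n = length fs"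
    and fs: "\<And>i. i < n \<Longrightarrow> fs ! i \<in> Arr M \<and> Dom M (fs ! i) = [B i] \<and> Cod M (fs ! i) = A"
    and gs: "\<And>i g. i < n \<Longrightarrow> g \<in> set (gss ! i) \<Longrightarrow> g \<in> Arr M \<and> Cod M g = B i"
  shows "Comp M (Comp M (m n A) fs) (map2 (\<lambda>i gs. Comp M (m (length gs) (B i)) gs) [0..<n] gss) =
    Comp M (m (length (concat gss)) A) (concat (map2 (\<lambda>f gs. map (\<lambda>g. Comp M f [g]) gs) fs gss))"
proof -
  have B: "B i \<in> Obj M" if "i < n" for i using fs[OF that] Dom_closed[of "fs ! i"] by auto
  have c: "composable M (m n A) fs"
    by (rule composable_m) (use A l fs in \<open>auto simp: in_set_conv_nth\<close>)
  have cg: "composable M (m (length (gss ! i)) (B i)) (gss ! i)" if "i < n" for i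
    by (rule composable_m) (use that B gs in auto)
  have cf: "composable M (fs ! i) [g]" if "i < n" "g \<in> Arr M" "Cod M g = B i" for i g
    using fs[OF that(1)] that by (simp add: composable_def)
  have 1: "Comp M (fs ! i) [Comp M (m (length (gss ! i)) (B i)) (gss ! i)] =
      Comp M (m (length (gss ! i)) A) (map (\<lambda>g. Comp M (fs ! i) [g]) (gss ! i))" if i: "i < n" for i
  proof -
    let ?k = "length (gss ! i)" and ?f = "fs ! i"
    have ck: "composable M (m ?k A) (replicate ?k ?f)"
      by (rule composable_m) (use A fs[OF i] in auto)
    have "Comp M ?f [Comp M (m ?k (B i)) (gss ! i)] = Comp M (Comp M ?f [m ?k (B i)]) (gss ! i)"
      using Comp_assoc[OF cf[OF i m_closed[OF B[OF i]] Cod_m[OF B[OF i]]], of "[gss ! i]"] cg[OF i] by simp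
    also have "Comp M ?f [m ?k (B i)] = Comp M (m ?k A) (replicate ?k ?f)"
      using m_central[of ?f ?k] fs[OF i] Comp_closed[OF ck] by (simp add: arity_def Act_id)
    also have "Comp M \<dots> (gss ! i) = Comp M (m ?k A) (map2 (Comp M) (replicate ?k ?f) (map (\<lambda>g. [g]) (gss ! i)))"
      using Comp_assoc[OF ck, of "map (\<lambda>g. [g]) (gss ! i)"] cf[OF i] gs[OF i] by simp
    also have "map2 (Comp M) (replicate ?k ?f) (map (\<lambda>g. [g]) (gss ! i)) = map (\<lambda>g. Comp M ?f [g]) (gss ! i)"
      by (rule nth_equalityI) simp_all
    finally show ?thesis .
  qed
  let ?ks = "map length gss" and ?hs = "map2 (\<lambda>f gs. map (\<lambda>g. Comp M f [g]) gs) fs gss"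
  let ?gs = "map2 (\<lambda>i gs. Comp M (m (length gs) (B i)) gs) [0..<n] gss"
  have cm: "composable M (m n A) (map (\<lambda>k. m k A) ?ks)"
    by (rule composable_m) (use A l in \<open>auto simp: m_closed Cod_m\<close>)
  have "Comp M (Comp M (m n A) fs) ?gs = Comp M (Comp M (m n A) fs) (concat (map (\<lambda>g. [g]) ?gs))"
    by (simp only: concat_map_singleton map_ident)
  also have "\<dots> = Comp M (m n A) (map2 (Comp M) fs (map (\<lambda>g. [g]) ?gs))"
    by (rule Comp_assoc[OF c, symmetric]) (use l cf cg B in \<open>simp_all add: Comp_closed Cod_Comp Cod_m\<close>)
  also have "map2 (Comp M) fs (map (\<lambda>g. [g]) ?gs) = map2 (Comp M) (map (\<lambda>k. m k A) ?ks) ?hs"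
    by (rule nth_equalityI) (use l 1 in simp_all)
  also have "Comp M (m n A) \<dots> = Comp M (Comp M (m n A) (map (\<lambda>k. m k A) ?ks)) (concat ?hs)"
  proof (rule Comp_assoc[OF cm])
    fix i assume "i < length (map (\<lambda>k. m k A) ?ks)"
    then have i: "i < n" using l by simp
    have "f \<in> Arr M \<and> Cod M f = A" if "f \<in> set (map (\<lambda>g. Comp M (fs ! i) [g]) (gss ! i))" for f
      using that gs[OF i] cf[OF i] fs[OF i] by (auto simp: Comp_closed Cod_Comp)
    then have "composable M (m (length (gss ! i)) A) (map (\<lambda>g. Comp M (fs ! i) [g]) (gss ! i))"
      by (intro composable_m[OF A]) simp_all
    then show "composable M (map (\<lambda>k. m k A) ?ks ! i) (?hs ! i)"
      using i l by simp
  qed (use l in simp)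
  also have "Comp M (m n A) (map (\<lambda>k. m k A) ?ks) = m (length (concat gss)) A"
    using m_Comp[OF A, of ?ks] l by (simp add: length_concat)
  finally show ?thesis .
qed

text \<open>An instance of outer equivariance: commutativity removes \<sigma> from the operation,
  and as all summands are unary the induced block permutation is \<sigma> itself.\<close>

lemma Comp_m_permute:
  assumes "A \<in> Obj M" "\<And>f. f \<in> set fs \<Longrightarrow> f \<in> Arr M \<and> arity M f = 1 \<and> Cod M f = A"
    and \<sigma>: "\<sigma> permutes {..<length fs}"
  shows "Comp M (m (length fs) A) (permute_list \<sigma> fs) = Act M \<sigma> (Comp M (m (length fs) A) fs)"
proof -
  have c: "composable M (m (length fs) A) fs" by (rule composable_m) (use assms in auto)
  have a: "map (arity M) fs = replicate (length fs) (Suc 0)"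
    by (rule nth_equalityI) (use assms(2) in simp_all)
  have "arity M (m (length fs) A) = length fs" using assms(1) by (simp add: arity_def Dom_m)
  then show ?thesis
    using Comp_Act_outer[OF c, of \<sigma>] \<sigma> assms(1) by (simp add: a block_perm_singletons m_Act)
qed

end

text \<open>The functor laws are reflected by a bijective functor. Thus functoriality has to be
  verified only for the summation of sequences, not for the decomposition into components.\<close>

lemma symmetric_functor_inverse:
  assumes "symmetric_functor N M G"
    and o: "\<And>A. A \<in> Obj M \<Longrightarrow> on_obj F A \<in> Obj N" "\<And>A. A \<in> Obj M \<Longrightarrow> on_obj G (on_obj F A) = A"
      "\<And>X. X \<in> Obj N \<Longrightarrow> on_obj F (on_obj G X) = X"
    and a: "\<And>f. f \<in> Arr M \<Longrightarrow> on_arr F f \<in> Arr N" "\<And>f. f \<in> Arr M \<Longrightarrow> on_arr G (on_arr F f) = f"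
      "\<And>h. h \<in> Arr N \<Longrightarrow> on_arr F (on_arr G h) = h"
  shows "symmetric_functor M N F"
proof -
  interpret G: symmetric_functor N M G by fact
  have d: "Dom N (on_arr F f) = map (on_obj F) (Dom M f)" if f: "f \<in> Arr M" for f
  proof -
    have "map (on_obj F) (map (on_obj G) (Dom N (on_arr F f))) = Dom N (on_arr F f)"
      using G.dom.Dom_closed[OF a(1)[OF f]] o(3) by (auto simp: comp_def intro!: map_idI)
    then show ?thesis using G.Dom_on_arr[OF a(1)[OF f]] a(2)[OF f] by simp
  qed
  have c: "Cod N (on_arr F f) = on_obj F (Cod M f)" if f: "f \<in> Arr M" for f
    using G.Cod_on_arr[OF a(1)[OF f]] a(2)[OF f] o(3) G.dom.Cod_closed[OF a(1)[OF f]] by metis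
  show ?thesis
  proof (unfold_locales, goal_cases)
    case (5 A) then show ?case using G.on_arr_Ident[OF o(1)] a(3) o(1,2) G.dom.Ident_closed by metis
  next
    case (6 f gs)
    have gs: "f \<in> Arr M" "set gs \<subseteq> Arr M" "map (Cod M) gs = Dom M f" using 6 by (auto simp: composable_def)
    have "map (Cod N) (map (on_arr F) gs) = map (on_obj F) (map (Cod M) gs)"
      using gs(2) c by auto
    then have cN: "composable N (on_arr F f) (map (on_arr F) gs)"
      using gs a(1) d[OF gs(1)] by (auto simp: composable_def simp del: map_map)
    have "map (on_arr G) (map (on_arr F) gs) = gs"
      using gs(2) a(2) by (auto intro!: map_idI)
    then have "on_arr G (Comp N (on_arr F f) (map (on_arr F) gs)) = Comp M f gs"
      using G.on_arr_Comp[OF cN] a(2) gs(1) by simp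
    then show ?case using a(3)[OF G.dom.Comp_closed[OF cN]] by simp
  next
    case (7 f \<sigma>)
    then have "\<sigma> permutes {..<arity N (on_arr F f)}" using d by (simp add: arity_def)
    then have "on_arr G (Act N \<sigma> (on_arr F f)) = Act M \<sigma> f" "Act N \<sigma> (on_arr F f) \<in> Arr N"
      using G.on_arr_Act[OF a(1)] G.dom.Act_closed[OF a(1)] a(2) 7(1) by simp_all
    then show ?case using a(3) by metis
  qed (simp_all add: o a d c)
qed

section \<open>The isomorphism with sequences of unary arrows\<close>

context central_monoids
begin

text \<open>A sequence is sent to its sum. The codomain recorded with a sequence gives the empty one
  a value, namely the unit over that object.\<close>

lemma seq_multicat_functor_unary:
  "symmetric_functor (seq_multicat (unary_cat M)) M
    \<lparr>on_obj = \<lambda>A. A, on_arr = \<lambda>p. Comp M (m (length (fst p)) (snd p)) (fst p)\<rparr>"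
proof -
  interpret U: category "unary_cat M" by (rule category_unary)
  have c: "composable M (m (length (fst p)) (snd p)) (fst p)" if "p \<in> Arr U.S" for p
    using that by (intro composable_m) (auto simp: U.in_Arr_S unary_simps)
  have D: "Dom M f = [hd (Dom M f)]" if "f \<in> arr (unary_cat M)" for f
    using that unary_Dom[of M f] by (simp add: unary_simps)
  show ?thesis
  proof (intro symmetric_functor.intro U.seq_multicat_symmetric symmetric_multicategory_axioms,
      unfold_locales, goal_cases)
    case (1 A) then show ?case by (simp add: U.S_simps unary_simps)
  next
    case (2 p) then show ?case using c by (simp add: Comp_closed)
  next
    case (3 p)
    then have "map (Dom M) (fst p) = map (\<lambda>f. [hd (Dom M f)]) (fst p)"
      using D by (simp add: U.in_Arr_S)
    then have "concat (map (Dom M) (fst p)) = map (\<lambda>f. hd (Dom M f)) (fst p)"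
      by (simp only: concat_map_singleton)
    then show ?case using Dom_Comp[OF c[OF 3]] by (simp add: U.S_simps unary_simps)
  next
    case (4 p) then show ?case using c by (simp add: Cod_Comp Cod_m U.in_Arr_S U.S_simps unary_simps)
  next
    case (5 A) then show ?case using Comp_Ident_left[of "Ident M A"]
      by (simp add: U.S_simps unary_simps m_1 Ident_closed Cod_Ident)
  next
    case (6 p qs)
    let ?n = "length (fst p)"
    have l: "length qs = ?n" using 6 by (simp add: U.composable_S)
    have p: "snd p \<in> Obj M" "\<And>i. i < ?n \<Longrightarrow> fst p ! i \<in> arr (unary_cat M) \<and> Cod M (fst p ! i) = snd p"
      "\<And>i. i < ?n \<Longrightarrow> hd (Dom M (fst p ! i)) = snd (qs ! i)"
      using 6 by (auto simp: U.composable_S U.in_Arr_S unary_simps)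
    have qs: "g \<in> Arr M \<and> Cod M g = snd (qs ! i)" if "i < ?n" "g \<in> set (fst (qs ! i))" for i g
    proof -
      have "qs ! i \<in> Arr U.S" using 6 that(1) l by (auto simp: U.composable_S)
      then show ?thesis using that(2) by (auto simp: U.in_Arr_S unary_simps)
    qed
    have e: "map (\<lambda>q. Comp M (m (length (fst q)) (snd q)) (fst q)) qs =
        map2 (\<lambda>i gs. Comp M (m (length gs) (snd (qs ! i))) gs) [0..<?n] (map fst qs)"
      by (rule nth_equalityI) (simp_all add: l)
    have "Comp M (Comp M (m ?n (snd p)) (fst p)) (map (\<lambda>q. Comp M (m (length (fst q)) (snd q)) (fst q)) qs) =
      Comp M (m (length (concat (map fst qs))) (snd p)) (concat (map2 (\<lambda>f gs. map (\<lambda>g. Comp M f [g]) gs) (fst p) (map fst qs)))"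
      unfolding e
    proof (rule Comp_m_Comp[OF p(1) _ HOL.refl])
      fix i assume i: "i < ?n"
      show "fst p ! i \<in> Arr M \<and> Dom M (fst p ! i) = [snd (qs ! i)] \<and> Cod M (fst p ! i) = snd p"
        using p(2)[OF i] p(3)[OF i] D[of "fst p ! i"] by (auto simp: unary_simps)
    next
      fix i g assume "i < ?n" "g \<in> set (map fst qs ! i)"
      then show "g \<in> Arr M \<and> Cod M g = snd (qs ! i)" using qs l by simp
    qed (simp add: l)
    also have "map2 (\<lambda>f gs. map (\<lambda>g. Comp M f [g]) gs) (fst p) (map fst qs) =
        map2 (\<lambda>f q. map (cmp (unary_cat M) f) (fst q)) (fst p) qs" (is "_ = ?L")
      by (rule nth_equalityI) (simp_all add: l unary_simps)
    also have "length (concat (map fst qs)) = length (concat ?L)"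
    proof -
      have "map length (map fst qs) = map length ?L"
        by (rule nth_equalityI) (simp_all add: l)
      then show ?thesis by (simp only: length_concat)
    qed
    finally show ?case by (simp add: U.S_simps)
  next
    case (7 p \<sigma>)
    then have "Comp M (m (length (fst p)) (snd p)) (permute_list \<sigma> (fst p)) =
        Act M \<sigma> (Comp M (m (length (fst p)) (snd p)) (fst p))"
      by (intro Comp_m_permute) (auto simp: U.in_Arr_S U.S_simps unary_simps)
    then show ?case by (simp add: U.S_simps)
  qed
qed

theorem is_sequential: "sequential M"
proof -
  interpret U: category "unary_cat M" by (rule category_unary)
  let ?F = "\<lparr>on_obj = \<lambda>A. A, on_arr = \<lambda>f. (map (component f) [0..<arity M f], Cod M f)\<rparr>"
  let ?G = "\<lparr>on_obj = \<lambda>A. A, on_arr = \<lambda>p. Comp M (m (length (fst p)) (snd p)) (fst p)\<rparr>"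
  have F: "on_arr ?F f \<in> Arr U.S" if "f \<in> Arr M" for f
    using that by (auto simp: U.in_Arr_S unary_simps Cod_closed component arity_def)
  have GF: "on_arr ?G (on_arr ?F f) = f" if "f \<in> Arr M" for f
    using Comp_m_component[OF that] by simp
  have FG: "on_arr ?F (on_arr ?G p) = p" if p: "p \<in> Arr U.S" for p
  proof -
    have A: "snd p \<in> Obj M" and fs: "\<And>f. f \<in> set (fst p) \<Longrightarrow> f \<in> Arr M \<and> arity M f = 1 \<and> Cod M f = snd p"
      using p by (auto simp: U.in_Arr_S unary_simps)
    have c: "composable M (m (length (fst p)) (snd p)) (fst p)"
      using A fs by (intro composable_m) auto
    have "map (arity M) (fst p) = replicate (length (fst p)) 1"
      by (rule nth_equalityI) (simp_all add: fs)
    then have "arity M (Comp M (m (length (fst p)) (snd p)) (fst p)) = length (fst p)"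
      by (simp add: arity_Comp[OF c] sum_list_replicate)
    moreover have "map (component (Comp M (m (length (fst p)) (snd p)) (fst p))) [0..<length (fst p)] = fst p"
      by (rule nth_equalityI) (simp_all add: component_Comp_m[OF A fs])
    moreover have "Cod M (Comp M (m (length (fst p)) (snd p)) (fst p)) = snd p"
      using c A by (simp add: Cod_Comp Cod_m)
    ultimately show ?thesis by simp
  qed
  have "symmetric_functor M U.S ?F"
    by (rule symmetric_functor_inverse[OF seq_multicat_functor_unary])
      (use F GF FG in \<open>simp_all add: U.S_simps unary_simps\<close>)
  then have "smulticat_iso M U.S"
    unfolding smulticat_iso_def using seq_multicat_functor_unary GF FG
    by (intro exI[of _ ?F] exI[of _ ?G]) simp
  then show ?thesis unfolding sequential_def using category_unary by blast
qed

end

section \<open>Central monoids of a sequential multicategory\<close>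

lemma permute_list_replicate:
  assumes "\<sigma> permutes {..<n}"
  shows "permute_list \<sigma> (replicate n x) = replicate n x"
proof (rule nth_equalityI)
  fix i assume "i < length (permute_list \<sigma> (replicate n x))"
  then have "i < n" "\<sigma> i < n" using permutes_in_image[OF assms, of i] by simp_all
  then show "permute_list \<sigma> (replicate n x) ! i = replicate n x ! i"
    using assms by (simp add: permute_list_nth)
qed simp

text \<open>For centrality, both composites contain every entry of the sequence \<open>n\<close>
  times, grouped by entries on one side and by copies on the other.\<close>

lemma (in category) central_monoids_seq_multicat:
  "central_monoids S (\<lambda>n X. (replicate n (idn C X), X))"
proof (intro central_monoids.intro seq_multicat_symmetric, unfold_locales, goal_cases)
  case (1 A n) then show ?case by (auto simp: in_Arr_S S_simps idn_closed tgt_idn)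
next
  case (2 A n) then show ?case by (simp add: S_simps src_idn)
next
  case (5 A ks)
  have "cmp C (idn C A) (idn C A) = idn C A"
    using cmp_idn_left[of "idn C A"] 5 by (simp add: S_simps idn_closed tgt_idn)
  then have "map2 (\<lambda>f q. map (cmp C f) (fst q)) (replicate (length ks) (idn C A)) (map (\<lambda>k. (replicate k (idn C A), A)) ks)
      = map (\<lambda>k. replicate k (idn C A)) ks"
    by (intro nth_equalityI) simp_all
  moreover have "concat (map (\<lambda>k. replicate k x) ks) = replicate (sum_list ks) x" for x :: 'b
    by (induction ks) (simp_all add: replicate_add)
  ultimately show ?case by (simp add: S_simps)
next
  case (6 A \<sigma> n)
  then show ?case by (simp add: S_simps permute_list_replicate)
next
  case (7 p n)
  have p: "f \<in> arr C" "tgt C f = snd p" if "f \<in> set (fst p)" for f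
    using 7 that by (auto simp: in_Arr_S)
  have 1: "map2 (\<lambda>f q. map (cmp C f) (fst q)) (fst p) (map (\<lambda>X. (replicate n (idn C X), X)) (map (src C) (fst p)))
      = map (\<lambda>f. map (\<lambda>_. f) [0..<n]) (fst p)"
    by (rule nth_equalityI) (simp_all add: cmp_idn_right p map_replicate_const)
  have "map (cmp C (idn C (snd p))) (fst p) = fst p"
    by (rule map_idI) (metis cmp_idn_left p)
  then have 2: "map2 (\<lambda>f q. map (cmp C f) (fst q)) (replicate n (idn C (snd p))) (replicate n p)
      = map (\<lambda>_. map (\<lambda>f. f) (fst p)) [0..<n]"
    by (intro nth_equalityI) simp_all
  show ?case
    using permute_list_interchange_perm[of "fst p" "[0..<n]" "\<lambda>f _. f"]
    unfolding S_simps fst_conv snd_conv 1 2 by simp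
qed (auto simp: S_simps)

lemma (in symmetric_functor) composable:
  assumes "composable M f gs"
  shows "composable N (on_arr F f) (map (on_arr F) gs)"
proof -
  have gs: "f \<in> Arr M" "set gs \<subseteq> Arr M" "map (Cod M) gs = Dom M f" using assms by (auto simp: composable_def)
  have "map (Cod N) (map (on_arr F) gs) = map (on_obj F) (map (Cod M) gs)"
    using gs(2) by (auto simp: Cod_on_arr)
  then show ?thesis
    using gs by (auto simp: composable_def on_arr_closed Dom_on_arr simp del: map_map)
qed

text \<open>Composites and actions are preserved, hence so are squares. This is what makes the
  operations on the hom out of a multicategory natural, and what makes the generators
  \<open>GenR\<close> central in the tensor product.\<close>

lemma (in symmetric_functor) square:
  assumes s: "dom.square f hs h fs"
  shows "cod.square (on_arr F f) (map (on_arr F) hs) (on_arr F h) (map (on_arr F) fs)"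
proof (rule cod.squareI)
  have c: "composable M f hs" "composable M h fs" using dom.square_composable[OF s] by blast+
  show "composable N (on_arr F f) (map (on_arr F) hs)" "composable N (on_arr F h) (map (on_arr F) fs)"
    using c by (simp_all add: composable)
  show "arity N (map (on_arr F) hs ! i) = length (map (on_arr F) fs)" if "i < length (map (on_arr F) hs)" for i
    using that dom.square_arity(1)[OF s] dom.composable_nth(1)[OF c(1)] by (simp add: arity_def Dom_on_arr)
  show "Dom N (map (on_arr F) fs ! j) = map (\<lambda>h'. Dom N h' ! j) (map (on_arr F) hs)"
    if "j < length (map (on_arr F) fs)" for j
  proof (rule nth_equalityI)
    have j: "j < length fs" using that by simp
    note fj = dom.composable_nth(1)[OF c(2) j]
    show "length (Dom N (map (on_arr F) fs ! j)) = length (map (\<lambda>h'. Dom N h' ! j) (map (on_arr F) hs))"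
      using j fj dom.square_arity(2)[OF s j] by (simp add: arity_def Dom_on_arr)
    fix i assume "i < length (Dom N (map (on_arr F) fs ! j))"
    then have i: "i < length hs" using j fj dom.square_arity(2)[OF s j] by (simp add: arity_def Dom_on_arr)
    show "Dom N (map (on_arr F) fs ! j) ! i = map (\<lambda>h'. Dom N h' ! j) (map (on_arr F) hs) ! i"
      using i j fj dom.composable_nth(1)[OF c(1) i] dom.square_Dom[OF s i j] dom.square_arity(2)[OF s j]
        dom.square_arity(1)[OF s i]
      by (simp add: arity_def Dom_on_arr)
  qed
  have "interchange_perm (length hs) (length fs) permutes {..<arity M (Comp M h fs)}"
    by (simp add: dom.square_arity[OF s] interchange_perm_permutes)
  then show "Comp N (on_arr F f) (map (on_arr F) hs) =
      Act N (interchange_perm (length (map (on_arr F) hs)) (length (map (on_arr F) fs)))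
        (Comp N (on_arr F h) (map (on_arr F) fs))"
    using dom.square_eq[OF s] on_arr_Comp[OF c(1)] on_arr_Comp[OF c(2)] on_arr_Act[OF dom.Comp_closed[OF c(2)]]
    by simp
qed

text \<open>The criterion is invariant under isomorphism: for centrality, the square of
  \<open>on_arr F f\<close> with the operations of \<open>N\<close> is mapped back by
  \<open>G\<close>.\<close>

lemma central_monoids_transport:
  assumes "central_monoids N m" "symmetric_functor M N F" "symmetric_functor N M G"
    and o: "\<And>A. A \<in> Obj M \<Longrightarrow> on_obj G (on_obj F A) = A" "\<And>X. X \<in> Obj N \<Longrightarrow> on_obj F (on_obj G X) = X"
    and a: "\<And>f. f \<in> Arr M \<Longrightarrow> on_arr G (on_arr F f) = f"
  shows "central_monoids M (\<lambda>n A. on_arr G (m n (on_obj F A)))"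
proof -
  interpret N: central_monoids N m by fact
  interpret F: symmetric_functor M N F by fact
  interpret G: symmetric_functor N M G by fact
  show ?thesis
  proof (unfold_locales, goal_cases)
    case (1 A n) then show ?case by (simp add: F.on_obj_closed N.m_closed G.on_arr_closed)
  next
    case (2 A n) then show ?case by (simp add: F.on_obj_closed N.m_closed G.Dom_on_arr N.Dom_m o)
  next
    case (3 A n) then show ?case by (simp add: F.on_obj_closed N.m_closed G.Cod_on_arr N.Cod_m o)
  next
    case (4 A) then show ?case by (simp add: F.on_obj_closed N.m_1 G.on_arr_Ident o)
  next
    case (5 A ks)
    then have A: "on_obj F A \<in> Obj N" by (rule F.on_obj_closed)
    have "composable N (m (length ks) (on_obj F A)) (map (\<lambda>k. m k (on_obj F A)) ks)"
      by (rule N.composable_m) (use A in \<open>auto simp: N.m_closed N.Cod_m\<close>)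
    from G.on_arr_Comp[OF this] show ?case by (simp add: N.m_Comp[OF A] comp_def)
  next
    case (6 A \<sigma> n)
    then have "on_obj F A \<in> Obj N" by (simp add: F.on_obj_closed)
    then show ?case using G.on_arr_Act[of "m n (on_obj F A)" \<sigma>] 6
      by (simp add: N.m_closed N.m_Act arity_def N.Dom_m)
  next
    case (7 f n)
    let ?f = "on_arr F f"
    have f: "?f \<in> Arr N" "on_arr G ?f = f" "Dom N ?f = map (on_obj F) (Dom M f)" "Cod N ?f = on_obj F (Cod M f)"
      using 7 by (simp_all add: F.on_arr_closed F.Dom_on_arr F.Cod_on_arr a)
    show ?case
      using F.dom.square_eq[OF G.square[OF N.square_m[OF f(1), of n]]] by (simp add: f comp_def arity_def)
  qed
qed

theorem sequential_central_monoids: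
  assumes "sequential M"
  obtains m where "central_monoids M m"
proof -
  obtain C :: "('a, 'b) cat" and F G where C: "category C" and
    F: "symmetric_functor M (seq_multicat C) F" "symmetric_functor (seq_multicat C) M G"
      "\<forall>A\<in>Obj M. on_obj G (on_obj F A) = A" "\<forall>f\<in>Arr M. on_arr G (on_arr F f) = f"
      "\<forall>X\<in>Obj (seq_multicat C). on_obj F (on_obj G X) = X"
    using assms unfolding sequential_def smulticat_iso_def by blast
  show thesis
    by (rule that, rule central_monoids_transport[OF category.central_monoids_seq_multicat[OF C] F(1,2)])
      (use F(3-) in simp_all)
qed

section \<open>The internal hom\<close>

text \<open>Splits each law of the internal hom into a law that holds pointwise in the target and an
  identity between lists of domain functors.\<close>

lemma mtransf_eqI:
  fixes \<alpha> \<beta> :: "('o, 'a, 'p, 'b) mtransf"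
  assumes "tr_dom \<alpha> = tr_dom \<beta>" "tr_cod \<alpha> = tr_cod \<beta>"
    "tr_at \<alpha> \<in> extensional S" "tr_at \<beta> \<in> extensional S" "\<And>A. A \<in> S \<Longrightarrow> tr_at \<alpha> A = tr_at \<beta> A"
  shows "\<alpha> = \<beta>"
  using assms by (intro mtransf.equality extensionalityI[of _ S]) auto

lemma permute_list_interchange_perm_replicate:
  "permute_list (interchange_perm (length xs) n) (concat (replicate n xs)) = concat (map (replicate n) xs)"
  using permute_list_interchange_perm[of xs "[0..<n]" "\<lambda>x _. x"] by (simp add: map_replicate_const)

locale multicat_pair = dom: symmetric_multicategory M + cod: symmetric_multicategory N
  for M :: "('o, 'a) smulticat" and N :: "('p, 'b) smulticat"
begin

abbreviation (input) H where "H \<equiv> internal_hom M N"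

lemma H_simps:
  "Obj H = hom_objects M N" "Arr H = hom_arrows M N" "Dom H = tr_dom" "Cod H = tr_cod"
  "arity H \<alpha> = length (tr_dom \<alpha>)"
  "tr_dom (Ident H F) = [F]" "tr_cod (Ident H F) = F"
  "A \<in> Obj M \<Longrightarrow> tr_at (Ident H F) A = Ident N (on_obj F A)"
  "tr_dom (Comp H \<alpha> \<beta>s) = concat (map tr_dom \<beta>s)" "tr_cod (Comp H \<alpha> \<beta>s) = tr_cod \<alpha>"
  "A \<in> Obj M \<Longrightarrow> tr_at (Comp H \<alpha> \<beta>s) A = Comp N (tr_at \<alpha> A) (map (\<lambda>\<beta>. tr_at \<beta> A) \<beta>s)"
  "tr_dom (Act H \<sigma> \<alpha>) = permute_list \<sigma> (tr_dom \<alpha>)" "tr_cod (Act H \<sigma> \<alpha>) = tr_cod \<alpha>"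
  "A \<in> Obj M \<Longrightarrow> tr_at (Act H \<sigma> \<alpha>) A = Act N \<sigma> (tr_at \<alpha> A)"
  "tr_at (Ident H F) \<in> extensional (Obj M)" "tr_at (Comp H \<alpha> \<beta>s) \<in> extensional (Obj M)"
  "tr_at (Act H \<sigma> \<alpha>) \<in> extensional (Obj M)"
  by (simp_all add: internal_hom_def arity_def)

lemma hom_object: "F \<in> hom_objects M N \<Longrightarrow> symmetric_functor M N F"
  by (simp add: hom_objects_def)

lemma hom_arrow:
  assumes "\<alpha> \<in> hom_arrows M N"
  shows "set (tr_dom \<alpha>) \<subseteq> hom_objects M N" "tr_cod \<alpha> \<in> hom_objects M N" "tr_at \<alpha> \<in> extensional (Obj M)"
    "A \<in> Obj M \<Longrightarrow> tr_at \<alpha> A \<in> Arr N"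
    "A \<in> Obj M \<Longrightarrow> Dom N (tr_at \<alpha> A) = map (\<lambda>F. on_obj F A) (tr_dom \<alpha>)"
    "A \<in> Obj M \<Longrightarrow> Cod N (tr_at \<alpha> A) = on_obj (tr_cod \<alpha>) A"
    "A \<in> Obj M \<Longrightarrow> arity N (tr_at \<alpha> A) = length (tr_dom \<alpha>)"
  using assms by (auto simp: hom_arrows_def arity_def)

text \<open>Naturality at \<open>f\<close> is an interchange square in \<open>N\<close> of the image
  of \<open>f\<close> with a component of \<alpha>. Together with the converse
  \<open>hom_arrowI\<close>, this lets the lemmas on squares prove that transformations are closed
  under the operations.\<close>

lemma hom_arrow_square:
  assumes "\<alpha> \<in> hom_arrows M N" "f \<in> Arr M"
  shows "cod.square (on_arr (tr_cod \<alpha>) f) (map (tr_at \<alpha>) (Dom M f))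
    (tr_at \<alpha> (Cod M f)) (map (\<lambda>F. on_arr F f) (tr_dom \<alpha>))"
proof -
  note \<alpha> = hom_arrow[OF assms(1)]
  interpret F: symmetric_functor M N "tr_cod \<alpha>" by (rule hom_object[OF \<alpha>(2)])
  have o: "Dom M f ! i \<in> Obj M" if "i < arity M f" for i
    using dom.Dom_closed[OF assms(2)] that by (auto simp: arity_def)
  have c: "Cod M f \<in> Obj M" by (rule dom.Cod_closed[OF assms(2)])
  have G: "symmetric_functor M N (tr_dom \<alpha> ! j)" if "j < length (tr_dom \<alpha>)" for j
    using that \<alpha>(1) by (intro hom_object) auto
  show ?thesis
  proof (rule cod.squareI)
    show "composable N (on_arr (tr_cod \<alpha>) f) (map (tr_at \<alpha>) (Dom M f))"
      using assms(2) o by (intro cod.composableI) (simp_all add: F.on_arr_closed F.Dom_on_arr arity_def \<alpha>)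
    show "composable N (tr_at \<alpha> (Cod M f)) (map (\<lambda>F. on_arr F f) (tr_dom \<alpha>))"
      using c assms(2) G by (intro cod.composableI)
        (simp_all add: \<alpha> symmetric_functor.on_arr_closed[OF G] symmetric_functor.Cod_on_arr[OF G])
    show "arity N (map (tr_at \<alpha>) (Dom M f) ! i) = length (map (\<lambda>F. on_arr F f) (tr_dom \<alpha>))"
      if "i < length (map (tr_at \<alpha>) (Dom M f))" for i
      using that o by (simp add: \<alpha> arity_def)
    show "Dom N (map (\<lambda>F. on_arr F f) (tr_dom \<alpha>) ! j) = map (\<lambda>h'. Dom N h' ! j) (map (tr_at \<alpha>) (Dom M f))"
      if "j < length (map (\<lambda>F. on_arr F f) (tr_dom \<alpha>))" for j
      by (rule nth_equalityI)
        (use that o assms(2) in \<open>simp_all add: symmetric_functor.Dom_on_arr[OF G] \<alpha> arity_def\<close>)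
    show "Comp N (on_arr (tr_cod \<alpha>) f) (map (tr_at \<alpha>) (Dom M f)) =
      Act N (interchange_perm (length (map (tr_at \<alpha>) (Dom M f))) (length (map (\<lambda>F. on_arr F f) (tr_dom \<alpha>))))
       (Comp N (tr_at \<alpha> (Cod M f)) (map (\<lambda>F. on_arr F f) (tr_dom \<alpha>)))"
      using assms by (simp add: hom_arrows_def arity_def)
  qed
qed

lemma hom_arrowI:
  assumes "set (tr_dom \<alpha>) \<subseteq> hom_objects M N" "tr_cod \<alpha> \<in> hom_objects M N" "tr_at \<alpha> \<in> extensional (Obj M)"
    "\<And>A. A \<in> Obj M \<Longrightarrow> tr_at \<alpha> A \<in> Arr N \<and> Dom N (tr_at \<alpha> A) = map (\<lambda>F. on_obj F A) (tr_dom \<alpha>) \<and>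
      Cod N (tr_at \<alpha> A) = on_obj (tr_cod \<alpha>) A"
    "\<And>f. f \<in> Arr M \<Longrightarrow> cod.square (on_arr (tr_cod \<alpha>) f) (map (tr_at \<alpha>) (Dom M f))
      (tr_at \<alpha> (Cod M f)) (map (\<lambda>F. on_arr F f) (tr_dom \<alpha>))"
  shows "\<alpha> \<in> hom_arrows M N"
  using assms(1-4) cod.square_eq[OF assms(5)] by (simp add: hom_arrows_def arity_def)

lemma composable_H:
  assumes "composable H \<alpha> \<beta>s"
  shows "\<alpha> \<in> hom_arrows M N" "\<beta> \<in> set \<beta>s \<Longrightarrow> \<beta> \<in> hom_arrows M N" "map tr_cod \<beta>s = tr_dom \<alpha>"
    "A \<in> Obj M \<Longrightarrow> composable N (tr_at \<alpha> A) (map (\<lambda>\<beta>. tr_at \<beta> A) \<beta>s)"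
proof -
  show \<alpha>: "\<alpha> \<in> hom_arrows M N" and \<beta>: "\<beta> \<in> set \<beta>s \<Longrightarrow> \<beta> \<in> hom_arrows M N"
    and d: "map tr_cod \<beta>s = tr_dom \<alpha>" for \<beta>
    using assms by (auto simp: composable_def H_simps)
  assume A: "A \<in> Obj M"
  have "map (Cod N) (map (\<lambda>\<beta>. tr_at \<beta> A) \<beta>s) = map (\<lambda>F. on_obj F A) (map tr_cod \<beta>s)"
    using \<beta> A by (auto simp: hom_arrow)
  then show "composable N (tr_at \<alpha> A) (map (\<lambda>\<beta>. tr_at \<beta> A) \<beta>s)"
    using A \<alpha> \<beta> d by (auto simp: composable_def hom_arrow simp del: map_map)
qed

lemma Ident_H_closed:
  assumes "F \<in> hom_objects M N"
  shows "Ident H F \<in> hom_arrows M N"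
proof (rule hom_arrowI)
  interpret F: symmetric_functor M N F by (rule hom_object[OF assms])
  show "tr_at (Ident H F) A \<in> Arr N \<and> Dom N (tr_at (Ident H F) A) = map (\<lambda>F. on_obj F A) (tr_dom (Ident H F)) \<and>
      Cod N (tr_at (Ident H F) A) = on_obj (tr_cod (Ident H F)) A" if "A \<in> Obj M" for A
    using that by (simp add: H_simps F.on_obj_closed cod.Ident_closed cod.Dom_Ident cod.Cod_Ident)
  fix f assume f: "f \<in> Arr M"
  have "map (tr_at (Ident H F)) (Dom M f) = map (Ident N) (Dom N (on_arr F f))"
    using dom.Dom_closed[OF f] by (auto simp: F.Dom_on_arr[OF f] H_simps)
  then show "cod.square (on_arr (tr_cod (Ident H F)) f) (map (tr_at (Ident H F)) (Dom M f))
      (tr_at (Ident H F) (Cod M f)) (map (\<lambda>F. on_arr F f) (tr_dom (Ident H F)))"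
    using cod.square_Ident[OF F.on_arr_closed[OF f]] f
    by (simp add: H_simps F.Cod_on_arr dom.Cod_closed cod.square_commute[of "on_arr F f"])
qed (simp_all add: H_simps assms)

text \<open>The naturality squares are flipped, so that the components at \<open>Cod M f\<close> are
  the arrows being composed; the squares of the \<open>\<beta>s\<close> are then pasted onto that of
  \<alpha>.\<close>

lemma Comp_H_closed:
  assumes c: "composable H \<alpha> \<beta>s"
  shows "Comp H \<alpha> \<beta>s \<in> hom_arrows M N"
proof (rule hom_arrowI)
  note c' = composable_H[OF c]
  note \<alpha> = hom_arrow[OF c'(1)]
  show "set (tr_dom (Comp H \<alpha> \<beta>s)) \<subseteq> hom_objects M N"
    using hom_arrow(1)[OF c'(2)] by (fastforce simp: H_simps)
  show "tr_at (Comp H \<alpha> \<beta>s) A \<in> Arr N \<and> Dom N (tr_at (Comp H \<alpha> \<beta>s) A) = map (\<lambda>F. on_obj F A) (tr_dom (Comp H \<alpha> \<beta>s)) \<and>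
      Cod N (tr_at (Comp H \<alpha> \<beta>s) A) = on_obj (tr_cod (Comp H \<alpha> \<beta>s)) A" if A: "A \<in> Obj M" for A
  proof -
    have "map (Dom N) (map (\<lambda>\<beta>. tr_at \<beta> A) \<beta>s) = map (map (\<lambda>F. on_obj F A)) (map tr_dom \<beta>s)"
      using hom_arrow(5)[OF c'(2) A] by simp
    then show ?thesis using c'(4)[OF A] A
      by (simp add: H_simps cod.Comp_closed cod.Dom_Comp cod.Cod_Comp \<alpha> map_concat del: map_map)
  qed
  fix f assume f: "f \<in> Arr M"
  have o: "Dom M f ! i \<in> Obj M" if "i < arity M f" for i
    using dom.Dom_closed[OF f] that by (auto simp: arity_def)
  have C: "Cod M f \<in> Obj M" by (rule dom.Cod_closed[OF f])
  have l: "length \<beta>s = length (tr_dom \<alpha>)" using arg_cong[OF c'(3), of length] by simp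
  let ?hss = "map (\<lambda>\<beta>. map (\<lambda>F. on_arr F f) (tr_dom \<beta>)) \<beta>s"
  let ?gss = "map (\<lambda>\<beta>. map (tr_at \<beta>) (Dom M f)) \<beta>s"
  let ?fs = "map (tr_at \<alpha>) (Dom M f)" and ?hs = "map (\<lambda>F. on_arr F f) (tr_dom \<alpha>)"
  have "cod.square (Comp N (tr_at \<alpha> (Cod M f)) (map (\<lambda>\<beta>. tr_at \<beta> (Cod M f)) \<beta>s)) (concat ?hss)
      (on_arr (tr_cod \<alpha>) f) (map2 (Comp N) ?fs (columns (length ?hs) (length ?fs) ?gss))"
  proof (rule cod.square_Comp)
    show "cod.square (tr_at \<alpha> (Cod M f)) ?hs (on_arr (tr_cod \<alpha>) f) ?fs"
      using hom_arrow_square[OF c'(1) f] by (simp add: cod.square_commute)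
    show "composable N (tr_at \<alpha> (Cod M f)) (map (\<lambda>\<beta>. tr_at \<beta> (Cod M f)) \<beta>s)"
      by (rule c'(4)[OF C])
    fix i assume "i < length ?hs"
    then have i: "i < length \<beta>s" by (simp add: l)
    then have "tr_dom \<alpha> ! i = tr_cod (\<beta>s ! i)" using c'(3) by (metis nth_map)
    then show "cod.square (map (\<lambda>\<beta>. tr_at \<beta> (Cod M f)) \<beta>s ! i) (?hss ! i) (?hs ! i) (?gss ! i)"
      using hom_arrow_square[OF c'(2)[OF nth_mem[OF i]] f] i
      by (simp add: l cod.square_commute[of _ "map (\<lambda>F. on_arr F f) _"])
  qed (simp_all add: l)
  moreover have "map2 (Comp N) ?fs (columns (length ?hs) (length ?fs) ?gss) = map (tr_at (Comp H \<alpha> \<beta>s)) (Dom M f)"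
  proof (rule nth_equalityI)
    fix j assume "j < length (map2 (Comp N) ?fs (columns (length ?hs) (length ?fs) ?gss))"
    then have j: "j < length (Dom M f)" by simp
    \<comment> \<open>Column \<open>j\<close> collects the components of all the
      \<open>\<beta>s\<close> at the \<open>j\<close>-th input object of \<open>f\<close>, which is
      what pointwise composition inserts into \<alpha> there.\<close>
    have "map (\<lambda>i. ?gss ! i ! j) [0..<length ?hs] = map (\<lambda>\<beta>. tr_at \<beta> (Dom M f ! j)) \<beta>s"
      by (rule nth_equalityI) (simp_all add: l[symmetric] j)
    then show "map2 (Comp N) ?fs (columns (length ?hs) (length ?fs) ?gss) ! j = map (tr_at (Comp H \<alpha> \<beta>s)) (Dom M f) ! j"
      using j o[of j] by (simp add: H_simps arity_def)
  qed simp
  moreover have "concat ?hss = map (\<lambda>F. on_arr F f) (tr_dom (Comp H \<alpha> \<beta>s))"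
    by (simp add: H_simps map_concat comp_def)
  ultimately show "cod.square (on_arr (tr_cod (Comp H \<alpha> \<beta>s)) f) (map (tr_at (Comp H \<alpha> \<beta>s)) (Dom M f))
      (tr_at (Comp H \<alpha> \<beta>s) (Cod M f)) (map (\<lambda>F. on_arr F f) (tr_dom (Comp H \<alpha> \<beta>s)))"
    using C by (simp add: H_simps cod.square_commute del: map_concat)
qed (simp_all add: H_simps hom_arrow[OF composable_H(1)[OF c]])

lemma Act_H_closed:
  assumes \<alpha>: "\<alpha> \<in> hom_arrows M N" and \<sigma>: "\<sigma> permutes {..<length (tr_dom \<alpha>)}"
  shows "Act H \<sigma> \<alpha> \<in> hom_arrows M N"
proof (rule hom_arrowI)
  note \<alpha>' = hom_arrow[OF \<alpha>]
  show "set (tr_dom (Act H \<sigma> \<alpha>)) \<subseteq> hom_objects M N"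
    using \<alpha>'(1) \<sigma> by (simp add: H_simps)
  show "tr_at (Act H \<sigma> \<alpha>) A \<in> Arr N \<and> Dom N (tr_at (Act H \<sigma> \<alpha>) A) = map (\<lambda>F. on_obj F A) (tr_dom (Act H \<sigma> \<alpha>)) \<and>
      Cod N (tr_at (Act H \<sigma> \<alpha>) A) = on_obj (tr_cod (Act H \<sigma> \<alpha>)) A" if A: "A \<in> Obj M" for A
    using A \<sigma> by (simp add: H_simps cod.Act_closed cod.Dom_Act cod.Cod_Act \<alpha>' permute_list_map)
  fix f assume f: "f \<in> Arr M"
  have C: "Cod M f \<in> Obj M" by (rule dom.Cod_closed[OF f])
  have "cod.square (Act N \<sigma> (tr_at \<alpha> (Cod M f))) (permute_list \<sigma> (map (\<lambda>F. on_arr F f) (tr_dom \<alpha>)))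
      (on_arr (tr_cod \<alpha>) f) (map (Act N \<sigma>) (map (tr_at \<alpha>) (Dom M f)))"
    by (rule cod.square_Act)
      (use hom_arrow_square[OF \<alpha> f] \<sigma> C in \<open>simp_all add: cod.square_commute \<alpha>'\<close>)
  moreover have "map (Act N \<sigma>) (map (tr_at \<alpha>) (Dom M f)) = map (tr_at (Act H \<sigma> \<alpha>)) (Dom M f)"
    using dom.Dom_closed[OF f] by (auto simp: H_simps)
  ultimately have "cod.square (Act N \<sigma> (tr_at \<alpha> (Cod M f))) (permute_list \<sigma> (map (\<lambda>F. on_arr F f) (tr_dom \<alpha>)))
      (on_arr (tr_cod \<alpha>) f) (map (tr_at (Act H \<sigma> \<alpha>)) (Dom M f))"
    by (simp only:)
  then show "cod.square (on_arr (tr_cod (Act H \<sigma> \<alpha>)) f) (map (tr_at (Act H \<sigma> \<alpha>)) (Dom M f))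
      (tr_at (Act H \<sigma> \<alpha>) (Cod M f)) (map (\<lambda>F. on_arr F f) (tr_dom (Act H \<sigma> \<alpha>)))"
    using C \<sigma> by (simp add: H_simps cod.square_commute permute_list_map)
qed (simp_all add: H_simps hom_arrow[OF \<alpha>])

text \<open>Every law holds pointwise because it holds in \<open>N\<close>. The domain functors are
  treated separately, by the list identities for \<open>concat\<close>, \<open>sum_perm\<close> and
  \<open>block_perm\<close>.\<close>

theorem internal_hom_symmetric: "symmetric_multicategory H"
proof (unfold_locales, goal_cases)
  case (1 \<alpha>) then show ?case by (simp add: H_simps hom_arrow)
next
  case (2 \<alpha>) then show ?case by (simp add: H_simps hom_arrow)
next
  case (3 F) then show ?case by (simp add: H_simps(1,2) Ident_H_closed)
next
  case (6 \<alpha> \<beta>s) then show ?case by (simp add: H_simps(2) Comp_H_closed)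
next
  case (9 \<alpha>)
  then have \<alpha>: "\<alpha> \<in> hom_arrows M N" by (simp add: H_simps)
  show ?case
  proof (rule mtransf_eqI[of _ _ "Obj M"])
    fix A assume "A \<in> Obj M"
    then show "tr_at (Comp H (Ident H (Cod H \<alpha>)) [\<alpha>]) A = tr_at \<alpha> A"
      using cod.Comp_Ident_left[of "tr_at \<alpha> A"] by (simp add: H_simps hom_arrow[OF \<alpha>])
  qed (simp_all add: H_simps hom_arrow[OF \<alpha>])
next
  case (10 \<alpha>)
  then have \<alpha>: "\<alpha> \<in> hom_arrows M N" by (simp add: H_simps)
  show ?case
  proof (rule mtransf_eqI[of _ _ "Obj M"])
    fix A assume "A \<in> Obj M"
    then show "tr_at (Comp H \<alpha> (map (Ident H) (Dom H \<alpha>))) A = tr_at \<alpha> A"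
      using cod.Comp_Ident_right[of "tr_at \<alpha> A"] by (simp add: H_simps hom_arrow[OF \<alpha>] comp_def)
  qed (simp_all add: H_simps hom_arrow[OF \<alpha>] comp_def)
next
  case (11 \<alpha> \<beta>s \<gamma>ss)
  show ?case
  proof (rule mtransf_eqI[of _ _ "Obj M"])
    have "map tr_dom (map2 (Comp H) \<beta>s \<gamma>ss) = map concat (map (map tr_dom) \<gamma>ss)"
      by (rule nth_equalityI) (simp_all add: 11(2) H_simps)
    then show "tr_dom (Comp H \<alpha> (map2 (Comp H) \<beta>s \<gamma>ss)) = tr_dom (Comp H (Comp H \<alpha> \<beta>s) (concat \<gamma>ss))"
      unfolding H_simps map_concat by (simp only: concat_map_concat)
    fix A assume A: "A \<in> Obj M"
    let ?\<beta>s = "map (\<lambda>\<beta>. tr_at \<beta> A) \<beta>s" and ?\<gamma>ss = "map (map (\<lambda>\<beta>. tr_at \<beta> A)) \<gamma>ss"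
    have "Comp N (tr_at \<alpha> A) (map2 (Comp N) ?\<beta>s ?\<gamma>ss) = Comp N (Comp N (tr_at \<alpha> A) ?\<beta>s) (concat ?\<gamma>ss)"
    proof (rule cod.Comp_assoc)
      show "composable N (tr_at \<alpha> A) ?\<beta>s" by (rule composable_H(4)[OF 11(1) A])
      fix i assume "i < length ?\<beta>s"
      then show "composable N (?\<beta>s ! i) (?\<gamma>ss ! i)" using composable_H(4)[OF 11(3) A, of i] by (simp add: 11(2))
    qed (simp add: 11(2))
    moreover have "map2 (Comp N) ?\<beta>s ?\<gamma>ss = map (\<lambda>\<beta>. tr_at \<beta> A) (map2 (Comp H) \<beta>s \<gamma>ss)"
      by (rule nth_equalityI) (simp_all add: 11(2) H_simps A)
    ultimately show "tr_at (Comp H \<alpha> (map2 (Comp H) \<beta>s \<gamma>ss)) A = tr_at (Comp H (Comp H \<alpha> \<beta>s) (concat \<gamma>ss)) A"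
      using A by (simp add: H_simps map_concat)
  qed (simp_all add: H_simps)
next
  case (12 \<alpha> \<sigma>) then show ?case by (simp add: H_simps(2,5) Act_H_closed)
next
  case (15 \<alpha>)
  then have \<alpha>: "\<alpha> \<in> hom_arrows M N" by (simp add: H_simps)
  show ?case
    by (rule mtransf_eqI[of _ _ "Obj M"]) (simp_all add: H_simps hom_arrow[OF \<alpha>] cod.Act_id)
next
  case (16 \<alpha> \<sigma> \<tau>)
  then have \<alpha>: "\<alpha> \<in> hom_arrows M N" by (simp add: H_simps)
  show ?case
    by (rule mtransf_eqI[of _ _ "Obj M"])
      (use 16 in \<open>simp_all add: H_simps hom_arrow[OF \<alpha>] cod.Act_comp permute_list_compose\<close>)
next
  case (17 \<alpha> \<beta>s \<sigma>s)
  note c = composable_H[OF 17(1)]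
  have \<beta>: "\<beta>s ! i \<in> hom_arrows M N" "\<sigma>s ! i permutes {..<length (tr_dom (\<beta>s ! i))}" if "i < length \<beta>s" for i
    using that c(2) 17(3)[OF that] by (simp_all add: H_simps)
  show ?case
  proof (rule mtransf_eqI[of _ _ "Obj M"])
    have "map tr_dom (map2 (Act H) \<sigma>s \<beta>s) = map2 permute_list \<sigma>s (map tr_dom \<beta>s)"
      by (rule nth_equalityI) (simp_all add: 17(2) H_simps)
    moreover have "map (arity H) \<beta>s = map length (map tr_dom \<beta>s)" by (simp add: H_simps)
    ultimately show "tr_dom (Comp H \<alpha> (map2 (Act H) \<sigma>s \<beta>s)) =
        tr_dom (Act H (sum_perm \<sigma>s (map (arity H) \<beta>s)) (Comp H \<alpha> \<beta>s))"
      unfolding H_simps by (simp only:) (rule permute_list_sum_perm[symmetric], simp_all add: 17(2) \<beta>)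
    fix A assume A: "A \<in> Obj M"
    let ?\<beta>s = "map (\<lambda>\<beta>. tr_at \<beta> A) \<beta>s"
    have "Comp N (tr_at \<alpha> A) (map2 (Act N) \<sigma>s ?\<beta>s) = Act N (sum_perm \<sigma>s (map (arity N) ?\<beta>s)) (Comp N (tr_at \<alpha> A) ?\<beta>s)"
      by (rule cod.Comp_Act_inner[OF c(4)[OF A]]) (use A in \<open>simp_all add: 17(2) hom_arrow[OF \<beta>(1)] \<beta>(2)\<close>)
    moreover have "map2 (Act N) \<sigma>s ?\<beta>s = map (\<lambda>\<beta>. tr_at \<beta> A) (map2 (Act H) \<sigma>s \<beta>s)"
      by (rule nth_equalityI) (simp_all add: 17(2) H_simps A)
    moreover have "map (arity N) ?\<beta>s = map (arity H) \<beta>s"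
      by (rule nth_equalityI) (simp_all add: H_simps hom_arrow[OF \<beta>(1)] A)
    ultimately show "tr_at (Comp H \<alpha> (map2 (Act H) \<sigma>s \<beta>s)) A =
        tr_at (Act H (sum_perm \<sigma>s (map (arity H) \<beta>s)) (Comp H \<alpha> \<beta>s)) A"
      using A by (simp only: H_simps)
  qed (simp_all add: H_simps)
next
  case (18 \<alpha> \<beta>s \<sigma>)
  note c = composable_H[OF 18(1)]
  have l: "length \<beta>s = length (tr_dom \<alpha>)" using arg_cong[OF c(3), of length] by simp
  have \<sigma>: "\<sigma> permutes {..<length \<beta>s}" using 18(2) by (simp add: H_simps l)
  show ?case
  proof (rule mtransf_eqI[of _ _ "Obj M"])
    have "map (arity H) \<beta>s = map length (map tr_dom \<beta>s)" by (simp add: H_simps)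
    then show "tr_dom (Comp H (Act H \<sigma> \<alpha>) (permute_list \<sigma> \<beta>s)) =
        tr_dom (Act H (block_perm \<sigma> (map (arity H) \<beta>s)) (Comp H \<alpha> \<beta>s))"
      unfolding H_simps using \<sigma>
      by (simp only: permute_list_map[symmetric]) (rule permute_list_block_perm[symmetric], simp)
    fix A assume A: "A \<in> Obj M"
    let ?\<beta>s = "map (\<lambda>\<beta>. tr_at \<beta> A) \<beta>s"
    have "Comp N (Act N \<sigma> (tr_at \<alpha> A)) (permute_list \<sigma> ?\<beta>s) =
        Act N (block_perm \<sigma> (map (arity N) ?\<beta>s)) (Comp N (tr_at \<alpha> A) ?\<beta>s)"
      by (rule cod.Comp_Act_outer[OF c(4)[OF A]]) (use A \<sigma> l in \<open>simp add: hom_arrow[OF c(1)]\<close>)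
    moreover have "map (arity N) ?\<beta>s = map (arity H) \<beta>s"
      by (rule nth_equalityI) (simp_all add: H_simps hom_arrow[OF c(2)] A)
    ultimately show "tr_at (Comp H (Act H \<sigma> \<alpha>) (permute_list \<sigma> \<beta>s)) A =
        tr_at (Act H (block_perm \<sigma> (map (arity H) \<beta>s)) (Comp H \<alpha> \<beta>s)) A"
      using A \<sigma> by (simp only: H_simps permute_list_map)
  qed (simp_all add: H_simps)
qed (simp_all add: H_simps)

end

section \<open>Central monoids in the internal homs\<close>

theorem central_monoids_hom_into:
  assumes "symmetric_multicategory M" "central_monoids N m"
  shows "central_monoids (internal_hom M N)
    (\<lambda>n F. \<lparr>tr_dom = replicate n F, tr_cod = F, tr_at = (\<lambda>A\<in>Obj M. m n (on_obj F A))\<rparr>)" (is "central_monoids _ ?m")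
proof -
  interpret dom: symmetric_multicategory M by fact
  interpret N: central_monoids N m by fact
  interpret multicat_pair M N ..
  interpret H: symmetric_multicategory H by (rule internal_hom_symmetric)
  have m: "tr_dom (?m n F) = replicate n F" "tr_cod (?m n F) = F"
    "A \<in> Obj M \<Longrightarrow> tr_at (?m n F) A = m n (on_obj F A)" "tr_at (?m n F) \<in> extensional (Obj M)" for n F A
    by simp_all
  have ob: "on_obj F A \<in> Obj N" if "F \<in> hom_objects M N" "A \<in> Obj M" for F A
    using symmetric_functor.on_obj_closed[OF hom_object] that by metis
  \<comment> \<open>Naturality of the operations along \<open>f\<close> is centrality of
    \<open>on_arr F f\<close> in \<open>N\<close>.\<close>
  have mH: "?m n F \<in> hom_arrows M N" if F: "F \<in> hom_objects M N" for n F
  proof (rule hom_arrowI)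
    interpret F: symmetric_functor M N F by (rule hom_object[OF F])
    fix f assume f: "f \<in> Arr M"
    have "map (tr_at (?m n F)) (Dom M f) = map (m n) (Dom N (on_arr F f))"
      using dom.Dom_closed[OF f] by (auto simp: F.Dom_on_arr[OF f])
    then show "N.square (on_arr (tr_cod (?m n F)) f) (map (tr_at (?m n F)) (Dom M f))
        (tr_at (?m n F) (Cod M f)) (map (\<lambda>F. on_arr F f) (tr_dom (?m n F)))"
      using N.square_m[OF F.on_arr_closed[OF f], of n] f by (simp add: F.Cod_on_arr dom.Cod_closed)
  qed (use F in \<open>auto simp: ob N.m_closed N.Dom_m N.Cod_m\<close>)
  show ?thesis
  proof (unfold_locales, goal_cases)
    case (1 F n) then show ?case by (simp only: H_simps(1,2) mH)
  next
    case (4 F) then show ?case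
      by (intro mtransf_eqI[of _ _ "Obj M"]) (simp_all add: H_simps N.m_1 ob)
  next
    case (5 F ks)
    have "concat (map (\<lambda>k. replicate k F) ks) = replicate (sum_list ks) F"
      by (induction ks) (simp_all add: replicate_add)
    then show ?case using 5
      by (intro mtransf_eqI[of _ _ "Obj M"])
        (simp_all add: H_simps comp_def N.m_Comp ob)
  next
    case (6 F \<sigma> n)
    then have "permute_list \<sigma> (replicate n F) = replicate n F"
      by (metis permute_list_replicate)
    then show ?case using 6
      by (intro mtransf_eqI[of _ _ "Obj M"]) (simp_all add: H_simps N.m_Act ob)
  next
    case (7 \<alpha> n)
    then have \<alpha>: "\<alpha> \<in> hom_arrows M N" by (simp add: H_simps)
    show ?case
    proof (rule mtransf_eqI[of _ _ "Obj M"])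
      show "tr_dom (Comp H \<alpha> (map (?m n) (Dom H \<alpha>))) =
          tr_dom (Act H (interchange_perm (arity H \<alpha>) n) (Comp H (?m n (Cod H \<alpha>)) (replicate n \<alpha>)))"
        by (simp add: H_simps comp_def permute_list_interchange_perm_replicate)
      fix A assume A: "A \<in> Obj M"
      \<comment> \<open>Centrality of a transformation is centrality of each of its components in
        \<open>N\<close>.\<close>
      then show "tr_at (Comp H \<alpha> (map (?m n) (Dom H \<alpha>))) A =
          tr_at (Act H (interchange_perm (arity H \<alpha>) n) (Comp H (?m n (Cod H \<alpha>)) (replicate n \<alpha>))) A"
        using N.m_central[OF hom_arrow(4)[OF \<alpha> A], of n] by (simp add: H_simps hom_arrow[OF \<alpha>] comp_def)
    qed (simp_all add: H_simps)
  qed (simp_all add: H_simps)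
qed

text \<open>The roles are exchanged in comparison with \<open>central_monoids_hom_into\<close>: the
  operations are natural because functors preserve the squares of \<open>M\<close>, and a
  transformation is central by its own naturality, taken at the arrow \<open>m n A\<close>.\<close>

theorem central_monoids_hom_from:
  assumes "central_monoids M m" "symmetric_multicategory N"
  shows "central_monoids (internal_hom M N)
    (\<lambda>n F. \<lparr>tr_dom = replicate n F, tr_cod = F, tr_at = (\<lambda>X\<in>Obj M. on_arr F (m n X))\<rparr>)" (is "central_monoids _ ?m")
proof -
  interpret M: central_monoids M m by fact
  interpret cod: symmetric_multicategory N by fact
  interpret multicat_pair M N ..
  interpret H: symmetric_multicategory H by (rule internal_hom_symmetric)
  have fn: "symmetric_functor M N F" if "F \<in> hom_objects M N" for F using that by (rule hom_object)
  have mH: "?m n F \<in> hom_arrows M N" if F: "F \<in> hom_objects M N" for n F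
  proof (rule hom_arrowI)
    interpret F: symmetric_functor M N F by (rule hom_object[OF F])
    show "tr_at (?m n F) A \<in> Arr N \<and> Dom N (tr_at (?m n F) A) = map (\<lambda>F. on_obj F A) (tr_dom (?m n F)) \<and>
      Cod N (tr_at (?m n F) A) = on_obj (tr_cod (?m n F)) A" if "A \<in> Obj M" for A
      using that by (simp add: F.on_arr_closed F.Dom_on_arr F.Cod_on_arr M.m_closed M.Dom_m M.Cod_m)
    fix f assume f: "f \<in> Arr M"
    have "map (tr_at (?m n F)) (Dom M f) = map (on_arr F) (map (m n) (Dom M f))"
      using M.Dom_closed[OF f] by auto
    then show "cod.square (on_arr (tr_cod (?m n F)) f) (map (tr_at (?m n F)) (Dom M f))
        (tr_at (?m n F) (Cod M f)) (map (\<lambda>F. on_arr F f) (tr_dom (?m n F)))"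
      using F.square[OF M.square_m[OF f, of n]] f by (simp add: M.Cod_closed del: map_map)
  qed (use F in auto)
  show ?thesis
  proof (unfold_locales, goal_cases)
    case (1 F n) then show ?case by (simp only: H_simps(1,2) mH)
  next
    case (4 F) then show ?case
      by (intro mtransf_eqI[of _ _ "Obj M"]) (simp_all add: H_simps M.m_1 symmetric_functor.on_arr_Ident[OF fn])
  next
    case (5 F ks)
    then have F: "F \<in> hom_objects M N" by (simp add: H_simps)
    interpret F: symmetric_functor M N F by (rule hom_object[OF F])
    have "concat (map (\<lambda>k. replicate k F) ks) = replicate (sum_list ks) F"
      by (induction ks) (simp_all add: replicate_add)
    moreover have "Comp N (on_arr F (m (length ks) A)) (map (\<lambda>k. on_arr F (m k A)) ks) = on_arr F (m (sum_list ks) A)"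
      if A: "A \<in> Obj M" for A
    proof -
      have "composable M (m (length ks) A) (map (\<lambda>k. m k A) ks)"
        by (rule M.composable_m) (use A in \<open>auto simp: M.m_closed M.Cod_m\<close>)
      from F.on_arr_Comp[OF this] show ?thesis by (simp add: M.m_Comp[OF A] comp_def)
    qed
    ultimately show ?case
      by (intro mtransf_eqI[of _ _ "Obj M"]) (simp_all add: H_simps comp_def)
  next
    case (6 F \<sigma> n)
    then have F: "F \<in> hom_objects M N" by (simp add: H_simps)
    interpret F: symmetric_functor M N F by (rule hom_object[OF F])
    have "permute_list \<sigma> (replicate n F) = replicate n F"
      using 6(2) by (rule permute_list_replicate)
    moreover have "Act N \<sigma> (on_arr F (m n A)) = on_arr F (m n A)" if A: "A \<in> Obj M" for A
      using F.on_arr_Act[OF M.m_closed[OF A], of \<sigma> n] 6(2) A by (simp add: arity_def M.Dom_m M.m_Act)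
    ultimately show ?case
      by (intro mtransf_eqI[of _ _ "Obj M"]) (simp_all add: H_simps)
  next
    case (7 \<alpha> n)
    then have \<alpha>: "\<alpha> \<in> hom_arrows M N" by (simp add: H_simps)
    show ?case
    proof (rule mtransf_eqI[of _ _ "Obj M"])
      show "tr_dom (Comp H \<alpha> (map (?m n) (Dom H \<alpha>))) =
          tr_dom (Act H (interchange_perm (arity H \<alpha>) n) (Comp H (?m n (Cod H \<alpha>)) (replicate n \<alpha>)))"
        by (simp add: H_simps comp_def permute_list_interchange_perm_replicate)
      fix A assume A: "A \<in> Obj M"
      have "cod.square (tr_at \<alpha> A) (map (\<lambda>F. on_arr F (m n A)) (tr_dom \<alpha>))
          (on_arr (tr_cod \<alpha>) (m n A)) (map (tr_at \<alpha>) (replicate n A))"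
        using hom_arrow_square[OF \<alpha> M.m_closed[OF A], of n] A by (simp add: cod.square_commute M.Dom_m M.Cod_m)
      from cod.square_eq[OF this] show "tr_at (Comp H \<alpha> (map (?m n) (Dom H \<alpha>))) A =
          tr_at (Act H (interchange_perm (arity H \<alpha>) n) (Comp H (?m n (Cod H \<alpha>)) (replicate n \<alpha>))) A"
        using A by (simp add: H_simps comp_def)
    qed (simp_all add: H_simps)
  qed (simp_all add: H_simps)
qed

section \<open>The tensor product\<close>

context multicat_pair
begin

abbreviation (input) T where "T \<equiv> bv_tensor M N"

abbreviation (input) cls where "cls \<equiv> bv_class M N"

abbreviation (input) wf where "wf \<equiv> tm_wf M N"

lemma bv_typed:
  assumes "bv_eq M N t u"
  shows "wf t" "wf u" "tm_dom M N t = tm_dom M N u" "tm_cod M N t = tm_cod M N u"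
  using bv_eq_typed[OF dom.symmetric_multicategory_axioms cod.symmetric_multicategory_axioms assms] by blast+

lemma cls_eqI: "bv_eq M N t u \<Longrightarrow> cls t = cls u"
  unfolding bv_class_def by (blast intro: bv_eq.sym bv_eq.trans)

lemma bv_rep: "wf t \<Longrightarrow> bv_eq M N t (bv_rep (cls t))"
  unfolding bv_rep_def bv_class_def mem_Collect_eq by (rule someI) (rule bv_eq.refl)

lemma Arr_T: "c \<in> Arr T \<longleftrightarrow> (\<exists>t. wf t \<and> c = cls t)"
  by (auto simp: bv_tensor_def)

lemma Arr_T_rep:
  assumes "c \<in> Arr T"
  shows "wf (bv_rep c)" "cls (bv_rep c) = c"
  using assms bv_rep bv_typed(2) cls_eqI unfolding Arr_T by metis+

lemma T_simps:
  "Obj T = Obj M \<times> Obj N" "Ident T P = cls (IdT P)"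
  "wf t \<Longrightarrow> cls t \<in> Arr T"
  "wf t \<Longrightarrow> Dom T (cls t) = tm_dom M N t" "wf t \<Longrightarrow> Cod T (cls t) = tm_cod M N t"
  "wf t \<Longrightarrow> arity T (cls t) = tm_arity M N t"
  using bv_typed[OF bv_rep, of t] by (auto simp: bv_tensor_def arity_def tm_arity_def)

text \<open>Composition is defined through chosen representatives; the congruence rule allows any
  others, so that calculations can be carried out on terms.\<close>

lemma Comp_T:
  assumes "wf (CompT t us)"
  shows "Comp T (cls t) (map cls us) = cls (CompT t us)"
proof -
  have "list_all2 (bv_eq M N) us (map (\<lambda>u. bv_rep (cls u)) us)"
    using assms bv_rep by (simp add: list_all2_conv_all_nth)
  then have "bv_eq M N (CompT t us) (CompT (bv_rep (cls t)) (map (\<lambda>u. bv_rep (cls u)) us))"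
    using assms bv_rep[of t] by (intro bv_eq.cong_CompT) simp_all
  then show ?thesis using cls_eqI[OF bv_eq.sym] by (simp add: bv_tensor_def comp_def)
qed

lemma Act_T:
  assumes "wf (ActT \<sigma> t)"
  shows "Act T \<sigma> (cls t) = cls (ActT \<sigma> t)"
proof -
  have "bv_eq M N (ActT \<sigma> t) (ActT \<sigma> (bv_rep (cls t)))"
    using assms bv_rep[of t] by (intro bv_eq.cong_ActT) simp_all
  then show ?thesis using cls_eqI[OF bv_eq.sym] by (simp add: bv_tensor_def)
qed

lemma composable_T_cls:
  "\<lbrakk>wf t; \<forall>u\<in>set us. wf u\<rbrakk> \<Longrightarrow> composable T (cls t) (map cls us) \<longleftrightarrow> wf (CompT t us)"
  by (auto simp: composable_def T_simps comp_def cong: map_cong)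

text \<open>Domains and codomains are constant on classes, so composability of classes lifts to
  well-formedness of a composite of representatives.\<close>

lemma composable_T_E:
  assumes "composable T f gs"
  obtains t us where "f = cls t" "gs = map cls us" "wf (CompT t us)"
proof -
  have f: "f \<in> Arr T" and gs: "set gs \<subseteq> Arr T" using assms by (auto simp: composable_def)
  have "gs = map cls (map bv_rep gs)" using gs Arr_T_rep(2) by (auto intro!: map_idI[symmetric])
  moreover have "\<forall>u\<in>set (map bv_rep gs). wf u" using gs Arr_T_rep(1) by auto
  ultimately show thesis
    using that[of "bv_rep f" "map bv_rep gs"] composable_T_cls[of "bv_rep f" "map bv_rep gs"] Arr_T_rep[OF f] assms
    by simp
qed

lemma tm_cod_closed: "wf t \<Longrightarrow> tm_cod M N t \<in> Obj M \<times> Obj N"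
  by (induction t) (auto simp: dom.Cod_closed cod.Cod_closed)

lemma tm_dom_closed: "wf t \<Longrightarrow> set (tm_dom M N t) \<subseteq> Obj M \<times> Obj N"
proof (induction t)
  case (GenL f X) then show ?case using dom.Dom_closed[of f] by auto
next
  case (GenR A h) then show ?case using cod.Dom_closed[of h] by auto
next
  case (ActT \<sigma> t) then show ?case by (auto simp: tm_arity_def)
next
  case (CompT t us) then show ?case by fastforce
qed auto

text \<open>Each axiom that equates arrows is one of the rules generating \<open>bv_eq\<close>. The
  well-formedness of both sides, required for calculating with representatives, comes from
  \<open>bv_typed\<close>.\<close>

theorem bv_tensor_symmetric: "symmetric_multicategory T"
proof (unfold_locales, goal_cases)
  case (1 f)
  then obtain t where t: "wf t" "f = cls t" by (auto simp: Arr_T)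
  then show ?case using tm_dom_closed[OF t(1)] by (simp add: T_simps)
next
  case (2 f) then show ?case using tm_cod_closed by (auto simp: Arr_T T_simps)
next
  case (3 P) then show ?case by (auto simp: T_simps)
next
  case (4 P) then show ?case by (simp add: T_simps)
next
  case (5 P) then show ?case by (simp add: T_simps)
next
  case (6 f gs) then show ?case by (elim composable_T_E) (simp only: Comp_T T_simps)
next
  case (7 f gs)
  then obtain t us where e: "f = cls t" "gs = map cls us" "wf (CompT t us)" by (rule composable_T_E)
  have "map (Dom T) (map cls us) = map (tm_dom M N) us" using e(3) by (simp add: T_simps)
  then show ?case using e(3) unfolding e(1,2) by (simp only: Comp_T T_simps tm_dom.simps)
next
  case (8 f gs)
  then obtain t us where e: "f = cls t" "gs = map cls us" "wf (CompT t us)" by (rule composable_T_E)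
  then show ?case by (simp add: Comp_T[OF e(3)] T_simps del: tm_wf.simps) (simp add: T_simps)
next
  case (9 f)
  then obtain t where t: "wf t" "f = cls t" by (auto simp: Arr_T)
  have "wf (CompT (IdT (tm_cod M N t)) [t])" using t tm_cod_closed[OF t(1)] by simp
  from Comp_T[OF this] cls_eqI[OF bv_eq.id_left[OF t(1)]] show ?case using t by (simp add: T_simps)
next
  case (10 f)
  then obtain t where t: "wf t" "f = cls t" by (auto simp: Arr_T)
  have "wf (CompT t (map IdT (tm_dom M N t)))" using t tm_dom_closed[OF t(1)] by (auto simp: comp_def)
  moreover have "map (Ident T) (tm_dom M N t) = map cls (map IdT (tm_dom M N t))"
    by (simp add: T_simps(2))
  ultimately show ?case
    using Comp_T cls_eqI[OF bv_eq.id_right[OF t(1)]] unfolding t(2) T_simps(4)[OF t(1)] by (simp only:)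
next
  case (11 f gs hss)
  obtain t us where e: "f = cls t" "gs = map cls us" "wf (CompT t us)" using 11(1) by (rule composable_T_E)
  define vss where "vss = map (map bv_rep) hss"
  have us: "wf (us ! i)" if "i < length us" for i using e(3) that by simp
  have h: "set (hss ! i) \<subseteq> Arr T" if "i < length us" for i
    using 11(3)[of i] that by (simp add: e composable_def)
  have "map cls (map bv_rep (hss ! i)) = hss ! i" "\<forall>v\<in>set (map bv_rep (hss ! i)). wf v" if "i < length us" for i
    using h[OF that] Arr_T_rep by (auto intro!: map_idI)
  then have v: "hss ! i = map cls (vss ! i)" "wf (CompT (us ! i) (vss ! i))" if "i < length us" for i
    using composable_T_cls[OF us[OF that], of "vss ! i"] 11(2) 11(3)[of i] that by (simp_all add: vss_def e)
  have lv: "length vss = length us" using 11(2) by (simp add: vss_def e)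
  have hss: "hss = map (map cls) vss"
    by (rule nth_equalityI) (use 11(2) v lv in \<open>simp_all add: e\<close>)
  note eq = bv_eq.assoc[OF e(3) lv v(2)]
  have "map2 (Comp T) (map cls us) (map (map cls) vss) = map cls (map2 CompT us vss)"
    by (rule nth_equalityI) (use v lv Comp_T in simp_all)
  then show ?case
    using Comp_T[OF bv_typed(1)[OF eq]] Comp_T[OF bv_typed(2)[OF eq]] Comp_T[OF e(3)] cls_eqI[OF eq]
    unfolding e(1,2) hss by (simp only: map_concat)
next
  case (12 f \<sigma>)
  then obtain t where t: "wf t" "f = cls t" by (auto simp: Arr_T)
  then have "wf (ActT \<sigma> t)" using 12 by (simp add: T_simps)
  then show ?case unfolding t by (simp only: Act_T T_simps)
next
  case (13 f \<sigma>)
  then obtain t where t: "wf t" "f = cls t" by (auto simp: Arr_T)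
  then have "wf (ActT \<sigma> t)" using 13 by (simp add: T_simps)
  then show ?case unfolding t using t(1) by (simp only: Act_T T_simps tm_dom.simps)
next
  case (14 f \<sigma>)
  then obtain t where t: "wf t" "f = cls t" by (auto simp: Arr_T)
  then have "wf (ActT \<sigma> t)" using 14 by (simp add: T_simps)
  then show ?case unfolding t using t(1) by (simp only: Act_T T_simps tm_cod.simps)
next
  case (15 f)
  then obtain t where t: "wf t" "f = cls t" by (auto simp: Arr_T)
  then have "wf (ActT id t)" by (simp add: permutes_id)
  then show ?case unfolding t using cls_eqI[OF bv_eq.act_id[OF t(1)]] by (simp only: Act_T)
next
  case (16 f \<sigma> \<tau>)
  then obtain t where t: "wf t" "f = cls t" by (auto simp: Arr_T)
  have eq: "bv_eq M N (ActT (\<sigma> \<circ> \<tau>) t) (ActT \<tau> (ActT \<sigma> t))"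
    using 16 t by (intro bv_eq.act_comp) (simp_all add: T_simps)
  have w: "wf (ActT \<sigma> t)" using bv_typed(2)[OF eq] by simp
  show ?case
    unfolding t Act_T[OF w] Act_T[OF bv_typed(1)[OF eq]] Act_T[OF bv_typed(2)[OF eq]] by (rule cls_eqI[OF eq])
next
  case (17 f gs \<sigma>s)
  obtain t us where e: "f = cls t" "gs = map cls us" "wf (CompT t us)" using 17(1) by (rule composable_T_E)
  have us: "wf (us ! i)" if "i < length us" for i using e(3) that by simp
  have eq: "bv_eq M N (CompT t (map2 ActT \<sigma>s us)) (ActT (sum_perm \<sigma>s (map (tm_arity M N) us)) (CompT t us))"
    by (rule bv_eq.act_inner) (use 17(2,3) e us in \<open>simp_all add: T_simps\<close>)
  have a: "map (arity T) (map cls us) = map (tm_arity M N) us" using e(3) by (simp add: T_simps)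
  have "map2 (Act T) \<sigma>s (map cls us) = map cls (map2 ActT \<sigma>s us)"
    by (rule nth_equalityI) (use 17(2,3) e us Act_T in \<open>simp_all add: T_simps\<close>)
  then show ?case
    unfolding e(1,2) a Comp_T[OF e(3)] Act_T[OF bv_typed(2)[OF eq]]
    using Comp_T[OF bv_typed(1)[OF eq]] cls_eqI[OF eq] by (simp only:)
next
  case (18 f gs \<sigma>)
  obtain t us where e: "f = cls t" "gs = map cls us" "wf (CompT t us)" using 18(1) by (rule composable_T_E)
  have \<sigma>: "\<sigma> permutes {..<tm_arity M N t}" using 18(2) e by (simp add: T_simps)
  note eq = bv_eq.act_outer[OF e(3) \<sigma>]
  have w: "wf (ActT \<sigma> t)" using e(3) \<sigma> by simp
  have "length us = tm_arity M N t"
    using e(3) by (metis length_map tm_wf.simps(4) tm_arity_def)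
  then have "permute_list \<sigma> (map cls us) = map cls (permute_list \<sigma> us)"
    using \<sigma> by (simp add: permute_list_map)
  moreover have a: "map (arity T) (map cls us) = map (tm_arity M N) us" using e(3) by (simp add: T_simps)
  ultimately show ?case
    unfolding e(1,2) a Comp_T[OF e(3)] Act_T[OF bv_typed(2)[OF eq]] Act_T[OF w]
    using Comp_T[OF bv_typed(1)[OF eq]] cls_eqI[OF eq] by (simp only:)
qed

text \<open>Carries the operations of \<open>N\<close>, their laws and their squares into the slice
  of the tensor product over each object \<open>A\<close>.\<close>

lemma GenR_functor:
  assumes A: "A \<in> Obj M"
  shows "symmetric_functor N T \<lparr>on_obj = Pair A, on_arr = \<lambda>h. cls (GenR A h)\<rparr>"
proof (intro symmetric_functor.intro cod.symmetric_multicategory_axioms bv_tensor_symmetric, unfold_locales, goal_cases)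
  case (5 X) then show ?case using cls_eqI[OF bv_eq.GenR_Ident[OF A]] by (simp add: T_simps)
next
  case (6 h ks)
  note eq = bv_eq.GenR_Comp[OF A 6]
  show ?case using cls_eqI[OF eq] Comp_T[OF bv_typed(2)[OF eq]] by (simp add: comp_def)
next
  case (7 h \<sigma>)
  note eq = bv_eq.GenR_Act[OF A 7]
  show ?case using cls_eqI[OF eq] Act_T[OF bv_typed(2)[OF eq]] by simp
qed (use A in \<open>simp_all add: T_simps\<close>)

end

section \<open>Central monoids in the tensor product\<close>

theorem central_monoids_bv_tensor:
  assumes "symmetric_multicategory M" "central_monoids N m"
  shows "central_monoids (bv_tensor M N) (\<lambda>n P. bv_class M N (GenR (fst P) (m n (snd P))))"
    (is "central_monoids _ ?m")
proof -
  interpret dom: symmetric_multicategory M by fact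
  interpret N: central_monoids N m by fact
  interpret multicat_pair M N ..
  interpret T: symmetric_multicategory T by (rule bv_tensor_symmetric)
  have m: "?m n P \<in> Arr T \<and> Dom T (?m n P) = replicate n P \<and> Cod T (?m n P) = P" if "P \<in> Obj T" for n P
    using that by (auto simp: T_simps N.m_closed N.Dom_m N.Cod_m)
  \<comment> \<open>Centrality of all arrows by induction over terms. The claim is a full square
    rather than an equation, so that pasting settles the cases \<open>CompT\<close> and
    \<open>ActT\<close>.\<close>
  have sq: "T.square (cls t) (map (?m n) (tm_dom M N t)) (?m n (tm_cod M N t)) (replicate n (cls t))" if "wf t" for t n
    using that
  proof (induction t)
    case (GenL f X)
    then have w: "wf (GenL f X)" and f: "f \<in> Arr M" and X: "X \<in> Obj N" by simp_all
    \<comment> \<open>The operations come from the second factor, so the interchange relation with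
      \<open>h = m n X\<close> is exactly centrality of the generators from the first
      factor.\<close>
    note eq = bv_eq.interchange[OF f N.m_closed[OF X, of n]]
    have "Comp T (cls (GenL f X)) (map (?m n) (tm_dom M N (GenL f X))) =
        cls (CompT (GenL f X) (map (\<lambda>A. GenR A (m n X)) (Dom M f)))"
      using Comp_T[OF bv_typed(1)[OF eq]] X by (simp add: N.Cod_m comp_def)
    also have "\<dots> = Act T (interchange_perm (arity M f) n) (cls (CompT (GenR (Cod M f) (m n X)) (map (GenL f) (replicate n X))))"
      using cls_eqI[OF eq] Act_T[OF bv_typed(2)[OF eq]] X by (simp add: N.Cod_m N.Dom_m arity_def)
    also have "cls (CompT (GenR (Cod M f) (m n X)) (map (GenL f) (replicate n X))) =
        Comp T (?m n (tm_cod M N (GenL f X))) (replicate n (cls (GenL f X)))"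
      using Comp_T[of "GenR (Cod M f) (m n X)" "map (GenL f) (replicate n X)"] bv_typed(2)[OF eq] X by (simp add: N.Dom_m)
    finally show ?case
      using T.square_mI[of "?m n" n "cls (GenL f X)"] m w by (simp add: T_simps arity_def)
  next
    case (GenR A h)
    then have A: "A \<in> Obj M" and h: "h \<in> Arr N" by simp_all
    \<comment> \<open>For generators from the second factor, centrality is inherited from
      \<open>N\<close>: one functor produces both \<open>GenR A h\<close> and the operations over
      the objects \<open>(A, X)\<close>.\<close>
    from symmetric_functor.square[OF GenR_functor[OF A] N.square_m[OF h, of n]] show ?case
      by (simp add: comp_def)
  next
    case (IdT P)
    then have P: "P \<in> Obj T" by (simp add: T_simps)
    then show ?case using T.square_Ident[of "?m n P"] m[OF P, of n] by (simp add: T_simps(2))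
  next
    case (CompT t us)
    have w: "wf t" "\<And>u. u \<in> set us \<Longrightarrow> wf u" "map (tm_cod M N) us = tm_dom M N t" using CompT.prems by auto
    have l: "length us = length (tm_dom M N t)" using arg_cong[OF w(3), of length] by simp
    let ?hs = "map (?m n) (tm_dom M N t)" and ?gss = "map (\<lambda>u. replicate n (cls u)) us"
    have "T.square (Comp T (cls t) (map cls us)) (concat (map (\<lambda>u. map (?m n) (tm_dom M N u)) us)) (?m n (tm_cod M N t))
        (map2 (Comp T) (replicate n (cls t)) (columns (length ?hs) (length (replicate n (cls t))) ?gss))"
    proof (rule T.square_Comp)
      show "T.square (cls t) ?hs (?m n (tm_cod M N t)) (replicate n (cls t))" by (rule CompT.IH(1)[OF w(1)])
      show "composable T (cls t) (map cls us)" using composable_T_cls w CompT.prems by blast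
      fix i assume "i < length ?hs"
      then have i: "i < length us" by (simp add: l)
      then have "tm_dom M N t ! i = tm_cod M N (us ! i)" using w(3) by (metis nth_map)
      then show "T.square (map cls us ! i) (map (\<lambda>u. map (?m n) (tm_dom M N u)) us ! i) (?hs ! i) (?gss ! i)"
        using CompT.IH(2)[OF nth_mem[OF i] w(2)[OF nth_mem[OF i]]] i by (simp add: l)
    qed (simp_all add: l)
    moreover have "map2 (Comp T) (replicate n (cls t)) (columns (length ?hs) (length (replicate n (cls t))) ?gss) =
        replicate n (Comp T (cls t) (map cls us))"
    proof (rule nth_equalityI)
      fix j assume "j < length (map2 (Comp T) (replicate n (cls t)) (columns (length ?hs) (length (replicate n (cls t))) ?gss))"
      then have j: "j < n" by simp
      \<comment> \<open>Every row repeats a single class, so all columns are the same list and the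
        pasted square carries \<open>n\<close> copies of the composite.\<close>
      have "map (\<lambda>i. ?gss ! i ! j) [0..<length ?hs] = map cls us"
        by (rule nth_equalityI) (simp_all add: l[symmetric] j)
      then show "map2 (Comp T) (replicate n (cls t)) (columns (length ?hs) (length (replicate n (cls t))) ?gss) ! j =
          replicate n (Comp T (cls t) (map cls us)) ! j"
        using j by simp
    qed simp
    ultimately show ?case
      using Comp_T[OF CompT.prems] by (simp add: map_concat comp_def)
  next
    case (ActT \<sigma> t)
    then have w: "wf t" "\<sigma> permutes {..<tm_arity M N t}" by simp_all
    then have "T.square (Act T \<sigma> (cls t)) (permute_list \<sigma> (map (?m n) (tm_dom M N t))) (?m n (tm_cod M N t))
        (map (Act T \<sigma>) (replicate n (cls t)))"
      using ActT.IH by (intro T.square_Act) (simp_all add: T_simps)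
    then show ?case
      using w Act_T[OF ActT.prems] by (simp add: permute_list_map tm_arity_def)
  qed
  show ?thesis
  proof (unfold_locales, goal_cases)
    case (4 P)
    then show ?case using cls_eqI[OF bv_eq.GenR_Ident, of "fst P" "snd P"] by (auto simp: T_simps N.m_1)
  next
    case (5 P ks)
    then have P: "fst P \<in> Obj M" "snd P \<in> Obj N" by (auto simp: T_simps)
    interpret F: symmetric_functor N T "\<lparr>on_obj = Pair (fst P), on_arr = \<lambda>h. cls (GenR (fst P) h)\<rparr>"
      by (rule GenR_functor[OF P(1)])
    have "composable N (m (length ks) (snd P)) (map (\<lambda>k. m k (snd P)) ks)"
      by (rule N.composable_m) (use P in \<open>auto simp: N.m_closed N.Cod_m\<close>)
    from F.on_arr_Comp[OF this] show ?case by (simp add: N.m_Comp[OF P(2)] comp_def)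
  next
    case (6 P \<sigma> n)
    then have P: "fst P \<in> Obj M" "snd P \<in> Obj N" by (auto simp: T_simps)
    interpret F: symmetric_functor N T "\<lparr>on_obj = Pair (fst P), on_arr = \<lambda>h. cls (GenR (fst P) h)\<rparr>"
      by (rule GenR_functor[OF P(1)])
    show ?case
      using F.on_arr_Act[OF N.m_closed[OF P(2)], of \<sigma> n] 6(2) P by (simp add: arity_def N.Dom_m N.m_Act)
  next
    case (7 f n)
    then obtain t where t: "wf t" "f = cls t" by (auto simp: Arr_T)
    from T.square_eq[OF sq[OF t(1), of n]] show ?case
      using t by (simp add: T_simps tm_arity_def)
  qed (use m in simp_all)
qed

theorem corollary3p8:
  fixes M :: "('o, 'a) smulticat" and L :: "('p, 'b) smulticat"
  assumes "symmetric_multicategory M" and "sequential L"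
  shows "sequential (bv_tensor M L) \<and> sequential (internal_hom M L) \<and> sequential (internal_hom L M)"
proof -
  obtain m where m: "central_monoids L m"
    using assms(2) by (rule sequential_central_monoids)
  show ?thesis
    using central_monoids_bv_tensor[OF assms(1) m, THEN central_monoids.is_sequential]
      central_monoids_hom_into[OF assms(1) m, THEN central_monoids.is_sequential]
      central_monoids_hom_from[OF m assms(1), THEN central_monoids.is_sequential] by blast
qed

end
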